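(* Let $2<q\le\infty$ and $\alpha>0$ be fixed. For each integer $N\ge1$ such that $\alpha N$ is a positive integer, let $Q=Q_N\subset\mathbb{R}^N$ be a non-empty subset of the Euclidean unit ball, let $E=E_N\subset\mathbb{R}^{\alpha N}$ be a non-empty closed permutation-invariant set, and let $A=A_N\in\mathbb{R}^{\alpha N\times N}$ have independent standard normal entries. Then there exists a sequence $K_c=K_c(N)$ of real numbers such that for every $\varepsilon>0$: with probability tending to $1$ as $N\to\infty$ the $(A,Q,E_{K,q})$-feasibility problem is unsatisfiable for $K<K_c-\varepsilon$ and satisfiable for $K>K_c+\varepsilon$. That is, for every $\varepsilon>0$ and $\eta>0$ there is $N_0$ such that for all such $N\ge N_0$ and all $K\ge0$: (i) if $K<K_c(N)-\varepsilon$, then the $(A,Q,E_{K,q})$-feasibility problem is unsatisfiable with probability at least $1-\eta$; (ii) if $K>K_c(N)+\varepsilon$, then the $(A,Q,E_{K,q})$-feasibility problem is satisfiable with probability at least $1-\eta$.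
   Context: A set $E\subset\mathbb{R}^M$ is permutation invariant if for every permutation $\pi\in S_M$ and every $x\in\mathbb{R}^M$: $(x_1,\dots,x_M)\in E$ if and only if $(x_{\pi(1)},\dots,x_{\pi(M)})\in E$. For $K\ge0$, the $\ell^q$-expansion of $E\subset\mathbb{R}^M$ is $E_{K,q}:=\{x\in\mathbb{R}^M: d_{\ell^q}(x,E)\le K\}$, where $d_{\ell^q}(x,E)=\inf_{y\in E}\|x-y\|_q$. For $Q\subset\mathbb{R}^N$, $F\subset\mathbb{R}^M$ and $A\in\mathbb{R}^{M\times N}$, the $\ell^q$-margin is $\mathcal{M}_{q,Q,F}(A):=\min_{\sigma\in Q}d_{\ell^q}(A\sigma,F)$ (an infimum if the minimum is not attained), and the $(A,Q,F)$-feasibility problem is the task of determining whether this margin is zero; it is called satisfiable if $\mathcal{M}_{q,Q,F}(A)=0$ and unsatisfiable otherwise. *)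

theory Defs
  imports "HOL-Probability.Probability"
begin

text \<open>
  Points of \<open>\<real>\<^sup>n\<close> are functions \<open>x :: nat \<Rightarrow> real\<close> with coordinates \<open>x 0, \<dots>, x (n - 1)\<close> and
  \<open>x i = 0\<close> for \<open>i \<ge> n\<close>, i.e. the points of the library space \<^const>\<open>Euclidean_space\<close>.
\<close>

abbreviation Rn :: "nat \<Rightarrow> (nat \<Rightarrow> real) set" where
  "Rn n \<equiv> topspace (Euclidean_space n)"

definition permutation_invariant :: "nat \<Rightarrow> (nat \<Rightarrow> real) set \<Rightarrow> bool" where
  "permutation_invariant n E \<longleftrightarrow>
     (\<forall>\<pi>. \<pi> permutes {..<n} \<longrightarrow> (\<forall>x\<in>Rn n. x \<in> E \<longleftrightarrow> (\<lambda>i. x (\<pi> i)) \<in> E))"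

text \<open>For \<open>q = \<infinity>\<close> the maximum is only meaningful when \<open>n \<ge> 1\<close>.\<close>

definition lq_norm :: "ereal \<Rightarrow> nat \<Rightarrow> (nat \<Rightarrow> real) \<Rightarrow> real" where
  "lq_norm q n x =
     (if q = \<infinity> then Max ((\<lambda>i. \<bar>x i\<bar>) ` {..<n})
      else (\<Sum>i<n. \<bar>x i\<bar> powr real_of_ereal q) powr (1 / real_of_ereal q))"

text \<open>The infima below are taken in \<^typ>\<open>real\<close>, so they are meaningful for non-empty index sets.\<close>

definition lq_dist :: "ereal \<Rightarrow> nat \<Rightarrow> (nat \<Rightarrow> real) \<Rightarrow> (nat \<Rightarrow> real) set \<Rightarrow> real" where
  "lq_dist q n x E = (INF y\<in>E. lq_norm q n (\<lambda>i. x i - y i))"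

definition lq_expansion :: "ereal \<Rightarrow> nat \<Rightarrow> real \<Rightarrow> (nat \<Rightarrow> real) set \<Rightarrow> (nat \<Rightarrow> real) set" where
  "lq_expansion q n K E = {x \<in> Rn n. lq_dist q n x E \<le> K}"

definition mat_vec :: "nat \<Rightarrow> nat \<Rightarrow> (nat \<Rightarrow> nat \<Rightarrow> real) \<Rightarrow> (nat \<Rightarrow> real) \<Rightarrow> nat \<Rightarrow> real" where
  "mat_vec m n A x = (\<lambda>i. if i < m then (\<Sum>j<n. A i j * x j) else 0)"

definition lq_margin ::
  "ereal \<Rightarrow> nat \<Rightarrow> nat \<Rightarrow> (nat \<Rightarrow> real) set \<Rightarrow> (nat \<Rightarrow> real) set \<Rightarrow> (nat \<Rightarrow> nat \<Rightarrow> real) \<Rightarrow> real" where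
  "lq_margin q m n Q F A = (INF \<sigma>\<in>Q. lq_dist q m (mat_vec m n A \<sigma>) F)"

definition satisfiable ::
  "ereal \<Rightarrow> nat \<Rightarrow> nat \<Rightarrow> (nat \<Rightarrow> nat \<Rightarrow> real) \<Rightarrow> (nat \<Rightarrow> real) set \<Rightarrow> (nat \<Rightarrow> real) set \<Rightarrow> bool" where
  "satisfiable q m n A Q F \<longleftrightarrow> lq_margin q m n Q F A = 0"

definition std_normal_matrix ::
  "'w measure \<Rightarrow> nat \<Rightarrow> nat \<Rightarrow> ('w \<Rightarrow> nat \<Rightarrow> nat \<Rightarrow> real) \<Rightarrow> bool" where
  "std_normal_matrix P m n A \<longleftrightarrow>
     prob_space.indep_vars P (\<lambda>_. borel) (\<lambda>(i, j) \<omega>. A \<omega> i j) ({..<m} \<times> {..<n}) \<and>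
     (\<forall>i<m. \<forall>j<n. distributed P lborel (\<lambda>\<omega>. A \<omega> i j) std_normal_density)"

end

theory Submission
  imports Defs "HOL-Real_Asymp.Real_Asymp"
begin

text \<open>
  Let \<open>f A\<close> be the distance, in \<open>\<ell>\<^sup>q\<close>, between \<open>E\<close> and the image of \<open>Q\<close> under the Gaussian matrix \<open>A\<close>. By the triangle
  inequality the problem for the expansion of \<open>E\<close> by \<open>K\<close> is satisfiable when \<open>f A < K\<close> and unsatisfiable when \<open>f A > K\<close>, so
  the theorem says that the fluctuations of \<open>f A\<close> tend to zero. As \<open>f\<close> is Lipschitz with constant one in the Euclidean norm
  of the matrix, Gaussian concentration only shows that they are bounded. The improvement has two sources: \<open>f\<close> is invariant
  under permutations of the rows, since \<open>E\<close> is, and \<open>q > 2\<close>.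

  The gradient of \<open>f\<close> in row \<open>i\<close> has length at most \<open>s i\<close>, where \<open>s\<close> is the gradient of the \<open>\<ell>\<^sup>q\<close>-norm at the residual of
  an optimal pair. The vector \<open>s\<close> is bounded by one in the dual exponent, which is less than two; hence its square sum is at
  most one, while for \<open>m\<close> rows its sum is at most of order \<open>m powr (1 / q)\<close>. By exchangeability every row gradient has second
  moment at most \<open>1 / m\<close> but first moment at most of order \<open>m powr (1 / q - 1)\<close>, far below \<open>m powr (- 1 / 2)\<close>: the gradient is
  concentrated on a small event, different for different rows. Hypercontractivity shows that such a function has little
  weight on low degrees. As the weight on degrees above \<open>L\<close> is at most a constant over \<open>L\<close>, the variance is at most a constant
  times \<open>3 ^ L * m powr (1 / q - 1 / 2) + 1 / L\<close>, for every \<open>L\<close>.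

  This is carried out on the discrete cube, where the entries of the matrix are normalised random walks of length \<open>k\<close>.
  There all averages are finite sums and hypercontractivity is a short induction (\<open>cavg_walsh_fourth\<close>); its dual form
  (\<open>cavg_noise_square\<close>) yields the variance bound \<open>variance_exchangeable_blocks\<close>. Since \<open>f\<close> is an infimum, optimal pairs give
  one-sided increments only; these suffice, because after noise a decrease is comparable to an increase (\<open>noise_dif_le\<close>).
  The increments are computed for a norm with one extra coordinate \<open>\<rho>\<close>, which removes the singularity at the origin
  (\<open>block_grad_gap_le\<close>). The bound then passes through three limits, each by Fatou's lemma for the mean square difference of
  two independent copies: \<open>k\<close> to infinity, with walks coupled to Gaussian variables by Skorohod's theorem
  (\<open>msd_gaussian_rnorm_gap\<close>), then \<open>\<rho>\<close> to zero, and for \<open>q = \<infinity>\<close> also the exponent to infinity (\<open>msd_gaussian_lq_gap\<close>).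
  Finally \<open>K\<^sub>c N\<close> is chosen as a value around which \<open>f A\<close> has small second moment, and Chebyshev's inequality concludes.
\<close>

section \<open>Harmonic analysis on the discrete cube\<close>

definition cube :: "'b set \<Rightarrow> ('b \<Rightarrow> real) set" where
  "cube B = B \<rightarrow>\<^sub>E {-1, 1}"

definition cavg :: "'b set \<Rightarrow> (('b \<Rightarrow> real) \<Rightarrow> real) \<Rightarrow> real" where
  "cavg B F = (\<Sum>x\<in>cube B. F x) / 2 ^ card B"

lemma finite_cube: "finite B \<Longrightarrow> finite (cube B)"
  by (simp add: cube_def finite_PiE)

lemma card_cube: "finite B \<Longrightarrow> card (cube B) = 2 ^ card B"
  by (simp add: cube_def card_PiE numeral_2_eq_2)

lemma cube_sq: "x \<in> cube B \<Longrightarrow> e \<in> B \<Longrightarrow> x e * x e = 1"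
  by (auto simp: cube_def PiE_iff)

lemma cube_abs: "x \<in> cube B \<Longrightarrow> e \<in> B \<Longrightarrow> \<bar>x e\<bar> = 1"
  by (auto simp: cube_def PiE_iff)

lemma cavg_cong: "(\<And>x. x \<in> cube B \<Longrightarrow> F x = G x) \<Longrightarrow> cavg B F = cavg B G"
  by (simp add: cavg_def)

lemma cavg_add: "cavg B (\<lambda>x. F x + G x) = cavg B F + cavg B G"
  by (simp add: cavg_def sum.distrib add_divide_distrib)

lemma cavg_diff: "cavg B (\<lambda>x. F x - G x) = cavg B F - cavg B G"
  by (simp add: cavg_def sum_subtractf diff_divide_distrib)

lemma cavg_cmult: "cavg B (\<lambda>x. c * F x) = c * cavg B F"
  by (simp add: cavg_def sum_distrib_left)

lemma cavg_sum: "cavg B (\<lambda>x. \<Sum>i\<in>J. F i x) = (\<Sum>i\<in>J. cavg B (F i))"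
  unfolding cavg_def by (subst sum.swap) (simp add: sum_divide_distrib)

lemma cavg_mono: "(\<And>x. x \<in> cube B \<Longrightarrow> F x \<le> G x) \<Longrightarrow> cavg B F \<le> cavg B G"
  unfolding cavg_def by (intro divide_right_mono sum_mono) auto

lemma cavg_nonneg: "(\<And>x. x \<in> cube B \<Longrightarrow> 0 \<le> F x) \<Longrightarrow> 0 \<le> cavg B F"
  unfolding cavg_def by (intro divide_nonneg_nonneg sum_nonneg) auto

lemma cavg_const: "finite B \<Longrightarrow> cavg B (\<lambda>_. c) = c"
  by (simp add: cavg_def card_cube)

lemma cavg_Cauchy_Schwarz:
  "(cavg B (\<lambda>x. F x * G x))\<^sup>2 \<le> cavg B (\<lambda>x. (F x)\<^sup>2) * cavg B (\<lambda>x. (G x)\<^sup>2)"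
proof -
  have "(cavg B (\<lambda>x. F x * G x))\<^sup>2 = (\<Sum>x\<in>cube B. F x * G x)\<^sup>2 / (2 ^ card B)\<^sup>2"
    by (simp add: cavg_def power_divide)
  also have "\<dots> \<le> ((\<Sum>x\<in>cube B. (F x)\<^sup>2) * (\<Sum>x\<in>cube B. (G x)\<^sup>2)) / (2 ^ card B)\<^sup>2"
    by (intro divide_right_mono Cauchy_Schwarz_ineq_sum) auto
  finally show ?thesis by (simp add: cavg_def power2_eq_square)
qed

lemma cavg_insert:
  assumes "finite B" "e \<notin> B"
  shows "cavg (insert e B) F = cavg B (\<lambda>x. (F (x(e := 1)) + F (x(e := -1))) / 2)"
proof -
  have "cube (insert e B) = (\<lambda>(s, x). x(e := s)) ` ({-1, 1} \<times> cube B)"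
    unfolding cube_def by (rule PiE_insert_eq)
  moreover have "inj_on (\<lambda>(s, x). x(e := s)) ({-1, 1} \<times> cube B)"
    unfolding cube_def using inj_combinator[OF assms(2), of "\<lambda>_. {-1,1::real}"] by simp
  ultimately have "(\<Sum>x\<in>cube (insert e B). F x) = (\<Sum>(s,x)\<in>{-1, 1} \<times> cube B. F (x(e := s)))"
    by (simp add: sum.reindex case_prod_unfold comp_def)
  also have "\<dots> = (\<Sum>x\<in>cube B. F (x(e := 1)) + F (x(e := -1)))"
    by (subst sum.cartesian_product[symmetric]) (simp add: sum.distrib add.commute)
  finally show ?thesis
    using assms by (simp add: cavg_def sum_divide_distrib[symmetric])
qed

definition flip :: "'b \<Rightarrow> ('b \<Rightarrow> real) \<Rightarrow> 'b \<Rightarrow> real" where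
  "flip e x = x(e := - x e)"

lemma flip_flip [simp]: "flip e (flip e x) = x"
  by (simp add: flip_def)

lemma flip_cube: "e \<in> B \<Longrightarrow> x \<in> cube B \<Longrightarrow> flip e x \<in> cube B"
  by (auto simp: flip_def cube_def PiE_iff extensional_def)

lemma cavg_reindex:
  assumes "bij_betw h (cube B) (cube B)"
  shows "cavg B (\<lambda>x. F (h x)) = cavg B F"
  unfolding cavg_def using sum.reindex_bij_betw[OF assms, of F] by simp

lemma cavg_flip:
  assumes "e \<in> B"
  shows "cavg B (\<lambda>x. F (flip e x)) = cavg B F"
  by (rule cavg_reindex, rule bij_betwI[where g = "flip e"]) (auto simp: flip_cube assms)

text \<open>
  The Walsh characters, an orthonormal basis of the functions on the cube; \<open>fourier\<close> below gives the coordinates in it.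
\<close>

definition chi :: "'b set \<Rightarrow> ('b \<Rightarrow> real) \<Rightarrow> real" where
  "chi T x = (\<Prod>e\<in>T. x e)"

definition walsh :: "'b set \<Rightarrow> ('b set \<Rightarrow> real) \<Rightarrow> ('b \<Rightarrow> real) \<Rightarrow> real" where
  "walsh B a x = (\<Sum>T\<in>Pow B. a T * chi T x)"

lemma sum_Pow_insert:
  fixes F :: "'b set \<Rightarrow> real"
  assumes "finite B" "e \<notin> B"
  shows "(\<Sum>T\<in>Pow (insert e B). F T) = (\<Sum>T\<in>Pow B. F T) + (\<Sum>T\<in>Pow B. F (insert e T))"
proof -
  have "inj_on (insert e) (Pow B)"
    using assms(2) by (auto simp: inj_on_def)
  moreover have "Pow B \<inter> insert e ` Pow B = {}"
    using assms(2) by auto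
  ultimately show ?thesis
    using assms(1) by (simp add: Pow_insert sum.union_disjoint sum.reindex)
qed

lemma chi_upd: "e \<notin> T \<Longrightarrow> chi T (x(e := s)) = chi T x"
  unfolding chi_def by (rule prod.cong) auto

lemma walsh_insert:
  assumes "finite B" "e \<notin> B"
  shows "walsh (insert e B) a (x(e := s)) = walsh B a x + s * walsh B (\<lambda>T. a (insert e T)) x"
proof -
  have "chi (insert e T) (x(e := s)) = s * chi T x" if "T \<in> Pow B" for T
  proof -
    have "finite T" "e \<notin> T" using that assms finite_subset by auto
    then show ?thesis using chi_upd[of e T x s] by (simp add: chi_def)
  qed
  moreover have "chi T (x(e := s)) = chi T x" if "T \<in> Pow B" for T
    using that assms by (intro chi_upd) auto
  ultimately show ?thesis
    using assms by (simp add: walsh_def sum_Pow_insert sum_distrib_left mult.left_commute)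
qed

lemma parseval:
  assumes "finite B"
  shows "cavg B (\<lambda>x. (walsh B a x)\<^sup>2) = (\<Sum>T\<in>Pow B. (a T)\<^sup>2)"
  using assms
proof (induction B arbitrary: a)
  case empty
  then show ?case by (simp add: cavg_def cube_def walsh_def chi_def)
next
  case (insert e B)
  have "cavg (insert e B) (\<lambda>x. (walsh (insert e B) a x)\<^sup>2)
      = cavg B (\<lambda>x. (walsh B a x)\<^sup>2 + (walsh B (\<lambda>T. a (insert e T)) x)\<^sup>2)"
    using insert.hyps
    by (auto simp: cavg_insert walsh_insert power2_eq_square field_simps intro!: cavg_cong)
  then show ?case using insert by (simp add: cavg_add sum_Pow_insert)
qed

text \<open>
  Bonami's hypercontractive inequality from \<open>L\<^sup>2\<close> to \<open>L\<^sup>4\<close>, by induction on the number of bits. Splitting off one bit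
  writes the polynomial as \<open>F \<plusminus> G / sqrt 3\<close>; averaging the fourth power over the sign kills the odd terms, and
  the mixed term \<open>6 F\<^sup>2 G\<^sup>2 / 3\<close> is controlled by Cauchy-Schwarz. The value \<open>1 / sqrt 3\<close> is what makes the
  three terms fit into the square \<open>(p + r)\<^sup>2\<close>.
\<close>

lemma cavg_walsh_fourth:
  assumes "finite B"
  shows "cavg B (\<lambda>x. (walsh B (\<lambda>T. (1 / sqrt 3) ^ card T * a T) x) ^ 4) \<le> (\<Sum>T\<in>Pow B. (a T)\<^sup>2)\<^sup>2"
  using assms
proof (induction B arbitrary: a)
  case empty
  then show ?case by (simp add: cavg_def cube_def walsh_def chi_def)
next
  case (insert e B)
  let ?r = "1 / sqrt 3 :: real"
  define b where "b T = a (insert e T)" for T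
  define F where "F = walsh B (\<lambda>T. ?r ^ card T * a T)"
  define G where "G = walsh B (\<lambda>T. ?r ^ card T * b T)"
  define p where "p = (\<Sum>T\<in>Pow B. (a T)\<^sup>2)"
  define r where "r = (\<Sum>T\<in>Pow B. (b T)\<^sup>2)"
  have card_ins: "card (insert e T) = Suc (card T)" if "T \<in> Pow B" for T
    using that insert.hyps finite_subset by (metis PowD card_insert_disjoint subsetD)
  have "walsh B (\<lambda>T. ?r ^ card (insert e T) * a (insert e T)) x = ?r * G x" for x
    unfolding G_def walsh_def sum_distrib_left
    by (intro sum.cong refl, subst card_ins) (auto simp: b_def)
  then have W: "walsh (insert e B) (\<lambda>T. ?r ^ card T * a T) (x(e := s)) = F x + s * (?r * G x)" for x s
    using insert.hyps by (simp add: walsh_insert F_def)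
  have alg: "((u + v) ^ 4 + (u - v) ^ 4) / 2 = u^4 + 6 * u\<^sup>2 * v\<^sup>2 + v^4" for u v :: real
    by (simp add: power4_eq_xxxx power2_eq_square algebra_simps)
  have r2: "(?r * g)\<^sup>2 = g\<^sup>2 / 3" and r4: "(?r * g) ^ 4 = g ^ 4 / 9" for g
  proof -
    show *: "(?r * g)\<^sup>2 = g\<^sup>2 / 3" by (simp add: power_mult_distrib power_divide)
    have "(?r * g) ^ 4 = ((?r * g)\<^sup>2)\<^sup>2" by (simp only: power_mult[symmetric]) simp
    also have "\<dots> = g ^ 4 / 9" unfolding * by (simp add: power_divide)
    finally show "(?r * g) ^ 4 = g ^ 4 / 9" .
  qed
  have "cavg (insert e B) (\<lambda>x. (walsh (insert e B) (\<lambda>T. ?r ^ card T * a T) x) ^ 4)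
      = cavg B (\<lambda>x. ((F x + ?r * G x) ^ 4 + (F x - ?r * G x) ^ 4) / 2)"
    by (subst cavg_insert[OF insert.hyps]) (simp add: W)
  also have "\<dots> = cavg B (\<lambda>x. F x ^ 4 + 2 * ((F x)\<^sup>2 * (G x)\<^sup>2) + (1/9) * G x ^ 4)"
    unfolding alg r2 r4 by simp
  also have "\<dots> = cavg B (\<lambda>x. F x ^ 4) + 2 * cavg B (\<lambda>x. (F x)\<^sup>2 * (G x)\<^sup>2) + (1/9) * cavg B (\<lambda>x. G x ^ 4)"
    unfolding cavg_add cavg_cmult ..
  also have "\<dots> \<le> p\<^sup>2 + 2 * (p * r) + r\<^sup>2"
  proof -
    have F4: "cavg B (\<lambda>x. F x ^ 4) \<le> p\<^sup>2" unfolding F_def p_def by (rule insert.IH)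
    have G4: "cavg B (\<lambda>x. G x ^ 4) \<le> r\<^sup>2" unfolding G_def r_def by (rule insert.IH)
    have nn: "0 \<le> cavg B (\<lambda>x. F x ^ 4)" "0 \<le> cavg B (\<lambda>x. G x ^ 4)" by (auto intro!: cavg_nonneg)
    have pr: "0 \<le> p" "0 \<le> r" by (auto simp: p_def r_def intro!: sum_nonneg)
    have "(cavg B (\<lambda>x. (F x)\<^sup>2 * (G x)\<^sup>2))\<^sup>2 \<le> cavg B (\<lambda>x. F x ^ 4) * cavg B (\<lambda>x. G x ^ 4)"
      using cavg_Cauchy_Schwarz[of B "\<lambda>x. (F x)\<^sup>2" "\<lambda>x. (G x)\<^sup>2"] by (simp flip: power_mult)
    also have "\<dots> \<le> p\<^sup>2 * r\<^sup>2" using F4 G4 nn by (intro mult_mono) auto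
    finally have "cavg B (\<lambda>x. (F x)\<^sup>2 * (G x)\<^sup>2) \<le> p * r"
      using pr by - (rule power2_le_imp_le, auto simp: power_mult_distrib)
    then show ?thesis using F4 G4 nn by simp
  qed
  also have "\<dots> = (p + r)\<^sup>2" by (simp add: power2_sum)
  also have "p + r = (\<Sum>T\<in>Pow (insert e B). (a T)\<^sup>2)"
    using insert.hyps by (simp add: sum_Pow_insert p_def r_def b_def)
  finally show ?case .
qed

definition fourier :: "'b set \<Rightarrow> (('b \<Rightarrow> real) \<Rightarrow> real) \<Rightarrow> 'b set \<Rightarrow> real" where
  "fourier B f T = cavg B (\<lambda>x. f x * chi T x)"

text \<open>
  For \<open>\<bar>\<rho>\<bar> \<le> 1\<close> the product is the density, relative to the uniform measure, of a \<open>\<rho>\<close>-correlated copy of \<open>x\<close>.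
\<close>

definition noise :: "real \<Rightarrow> 'b set \<Rightarrow> (('b \<Rightarrow> real) \<Rightarrow> real) \<Rightarrow> ('b \<Rightarrow> real) \<Rightarrow> real" where
  "noise \<rho> B f x = cavg B (\<lambda>y. f y * (\<Prod>e\<in>B. 1 + \<rho> * x e * y e))"

text \<open>
  Expanding the product over bits shows that the noise operator damps the character of \<open>T\<close> by \<open>\<rho> ^ card T\<close>.
\<close>

lemma noise_walsh:
  assumes "finite B"
  shows "noise \<rho> B f x = walsh B (\<lambda>T. \<rho> ^ card T * fourier B f T) x"
proof -
  have "(\<Prod>e\<in>B. 1 + \<rho> * x e * y e) = (\<Sum>T\<in>Pow B. \<rho> ^ card T * chi T x * chi T y)" for y
  proof -
    have "(\<Prod>e\<in>B. 1 + \<rho> * x e * y e) = (\<Sum>T\<in>Pow B. \<Prod>e\<in>T. \<rho> * x e * y e)"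
      using prod_add[OF assms, of "\<lambda>e. \<rho> * x e * y e" "\<lambda>_. 1"] by (simp add: add.commute)
    then show ?thesis by (simp add: chi_def prod.distrib)
  qed
  then have "noise \<rho> B f x = cavg B (\<lambda>y. \<Sum>T\<in>Pow B. (\<rho> ^ card T * chi T x) * (f y * chi T y))"
    by (simp add: noise_def sum_distrib_left mult_ac)
  then show ?thesis
    unfolding cavg_sum cavg_cmult by (simp add: walsh_def fourier_def mult_ac)
qed

text \<open>
  With full correlation the kernel is concentrated at \<open>x\<close>; together with the previous lemma this is the Walsh
  inversion formula.
\<close>

lemma noise_one:
  assumes "finite B" "x \<in> cube B"
  shows "noise 1 B f x = f x"
proof -
  have "(\<Prod>e\<in>B. 1 + 1 * x e * y e) = (if y = x then 2 ^ card B else 0)" if y: "y \<in> cube B" for y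
  proof (cases "y = x")
    case True
    then show ?thesis using cube_sq[OF assms(2)] by simp
  next
    case False
    then obtain e where e: "e \<in> B" "x e \<noteq> y e"
      using assms(2) y unfolding cube_def by (metis PiE_ext)
    then have "1 + 1 * x e * y e = 0"
      using cube_abs[OF assms(2), of e] cube_abs[OF y, of e] by (auto simp: abs_if split: if_splits)
    then show ?thesis using False e(1) assms(1) by (simp add: prod_zero_iff) blast
  qed
  then have "noise 1 B f x = cavg B (\<lambda>y. f y * (if y = x then 2 ^ card B else 0))"
    unfolding noise_def by (intro cavg_cong) simp
  also have "\<dots> = f x"
    using assms by (simp add: cavg_def finite_cube if_distrib[of "\<lambda>c. f _ * c"] sum.delta cong: if_cong)
  finally show ?thesis .
qed

lemma walsh_fourier:
  assumes "finite B" "x \<in> cube B"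
  shows "walsh B (fourier B f) x = f x"
  using noise_walsh[OF assms(1), of 1 f x] noise_one[OF assms, of f] by simp

lemma cavg_square_fourier:
  assumes "finite B"
  shows "cavg B (\<lambda>x. (f x)\<^sup>2) = (\<Sum>T\<in>Pow B. (fourier B f T)\<^sup>2)"
  using parseval[OF assms, of "fourier B f"] walsh_fourier[OF assms, of _ f]
  by (simp cong: cavg_cong)

text \<open>
  The dual form of hypercontractivity: noise makes the second moment small for a non-negative function that is
  small in \<open>L\<^sup>1\<close> compared with \<open>L\<^sup>2\<close>. With \<open>h\<close> the noised function and \<open>u\<close> the function noised twice, the second
  moment of \<open>h\<close> is the mean of \<open>g u\<close>; two applications of Cauchy-Schwarz bring in the fourth moment of \<open>u\<close>,
  which \<open>cavg_walsh_fourth\<close> bounds by the square of the second moment of \<open>h\<close>.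
\<close>

lemma cavg_noise_square:
  fixes g :: "('b \<Rightarrow> real) \<Rightarrow> real"
  assumes B: "finite B" and g: "\<And>x. x \<in> cube B \<Longrightarrow> 0 \<le> g x"
  shows "cavg B (\<lambda>x. (noise (1 / sqrt 3) B g x)\<^sup>2) \<le> cavg B g * sqrt (cavg B (\<lambda>x. (g x)\<^sup>2))"
proof -
  let ?r = "1 / sqrt 3 :: real"
  let ?c = "\<lambda>T. ?r ^ card T * fourier B g T"
  define u where "u = walsh B (\<lambda>T. ?r ^ card T * ?c T)"
  define X where "X = cavg B (\<lambda>x. (noise ?r B g x)\<^sup>2)"
  define Y where "Y = cavg B (\<lambda>x. g x * (u x)\<^sup>2)"
  define b where "b = cavg B (\<lambda>x. (g x)\<^sup>2)"
  have X0: "0 \<le> X" and Y0: "0 \<le> Y" and b0: "0 \<le> b" and a0: "0 \<le> cavg B g"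
    using g by (auto simp: X_def Y_def b_def intro!: cavg_nonneg)
  have X_sum: "X = (\<Sum>T\<in>Pow B. (?c T)\<^sup>2)"
    unfolding X_def noise_walsh[OF B] by (rule parseval[OF B])
  have u4: "cavg B (\<lambda>x. (u x) ^ 4) \<le> X\<^sup>2"
    unfolding u_def X_sum by (rule cavg_walsh_fourth[OF B])
  have "cavg B (\<lambda>x. g x * u x) = cavg B (\<lambda>x. \<Sum>T\<in>Pow B. (?r ^ card T * ?c T) * (g x * chi T x))"
    by (simp add: u_def walsh_def sum_distrib_left mult_ac)
  also have "\<dots> = (\<Sum>T\<in>Pow B. (?r ^ card T * ?c T) * fourier B g T)"
    unfolding cavg_sum cavg_cmult fourier_def ..
  also have "\<dots> = X"
    unfolding X_sum by (intro sum.cong refl) (simp only: power2_eq_square mult_ac)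
  finally have X_gu: "X = cavg B (\<lambda>x. g x * u x)" ..
  \<comment> \<open>Splitting \<open>g u\<close> as \<open>sqrt g\<close> times \<open>sqrt g u\<close> produces the first moment of \<open>g\<close>.\<close>
  have "X\<^sup>2 = (cavg B (\<lambda>x. sqrt (g x) * (sqrt (g x) * u x)))\<^sup>2"
    unfolding X_gu using g by (intro arg_cong[of _ _ "\<lambda>z. z\<^sup>2"] cavg_cong) (simp flip: mult.assoc)
  also have "\<dots> \<le> cavg B (\<lambda>x. (sqrt (g x))\<^sup>2) * cavg B (\<lambda>x. (sqrt (g x) * u x)\<^sup>2)"
    by (rule cavg_Cauchy_Schwarz)
  also have "\<dots> = cavg B g * Y"
    unfolding Y_def using g by (simp add: power_mult_distrib cong: cavg_cong)
  finally have XY: "X\<^sup>2 \<le> cavg B g * Y" .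
  have "Y\<^sup>2 \<le> b * cavg B (\<lambda>x. ((u x)\<^sup>2)\<^sup>2)"
    unfolding Y_def b_def by (rule cavg_Cauchy_Schwarz)
  also have "\<dots> \<le> b * X\<^sup>2"
    using u4 b0 by (intro mult_left_mono) (simp_all flip: power_mult)
  finally have "Y \<le> sqrt b * X"
    using b0 X0 by - (rule power2_le_imp_le, auto simp: power_mult_distrib)
  then have "X\<^sup>2 \<le> cavg B g * (sqrt b * X)"
    using XY a0 by (meson mult_left_mono order_trans)
  then have "X * X \<le> (cavg B g * sqrt b) * X"
    by (simp add: power2_eq_square mult_ac)
  then have "X \<le> cavg B g * sqrt b"
    using X0 a0 b0 by (cases "X = 0") (auto simp: mult_le_cancel_right)
  then show ?thesis by (simp add: X_def b_def)
qed

section \<open>Variance of functions of exchangeable blocks of bits\<close>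

definition dif :: "'b \<Rightarrow> (('b \<Rightarrow> real) \<Rightarrow> real) \<Rightarrow> ('b \<Rightarrow> real) \<Rightarrow> real" where
  "dif e f x = (f x - f (flip e x)) / 2"

text \<open>
  Only increases of \<open>f\<close> are recorded: for an infimum they can be bounded by means of a near-minimiser at \<open>x\<close> itself,
  whereas a decrease depends on the minimisers at the flipped point. The full derivative is recovered by
  \<open>dif_up\<close> and \<open>dif_square_up\<close>.
\<close>

definition up :: "'b \<Rightarrow> (('b \<Rightarrow> real) \<Rightarrow> real) \<Rightarrow> ('b \<Rightarrow> real) \<Rightarrow> real" where
  "up e f x = max 0 ((f (flip e x) - f x) / 2)"

lemma up_nonneg: "0 \<le> up e f x"
  by (simp add: up_def)

lemma dif_up: "dif e f x = up e f (flip e x) - up e f x"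
  by (simp add: dif_def up_def max_def field_simps)

lemma dif_square_up: "(dif e f x)\<^sup>2 = (up e f (flip e x))\<^sup>2 + (up e f x)\<^sup>2"
  by (simp add: dif_def up_def max_def power2_eq_square field_simps)

lemma chi_flip:
  assumes "finite T"
  shows "chi T (flip e x) = (if e \<in> T then - chi T x else chi T x)"
proof (cases "e \<in> T")
  case True
  have "chi T (flip e x) = flip e x e * (\<Prod>c\<in>T - {e}. flip e x c)"
    unfolding chi_def using assms True by (rule prod.remove)
  also have "\<dots> = - (x e * (\<Prod>c\<in>T - {e}. x c))"
    by (simp add: flip_def)
  also have "\<dots> = - chi T x"
    unfolding chi_def using prod.remove[OF assms True, of x] by simp
  finally show ?thesis using True by simp
next
  case False
  then show ?thesis by (simp add: flip_def chi_upd)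
qed

lemma fourier_dif:
  assumes "finite B" "e \<in> B" "T \<subseteq> B"
  shows "fourier B (dif e f) T = (if e \<in> T then fourier B f T else 0)"
proof -
  have T: "finite T" using assms finite_subset by auto
  have "cavg B (\<lambda>x. f (flip e x) * chi T x) = cavg B (\<lambda>x. f x * chi T (flip e x))"
    using cavg_flip[OF assms(2), of "\<lambda>x. f x * chi T (flip e x)"] by simp
  also have "\<dots> = (if e \<in> T then - fourier B f T else fourier B f T)"
    using cavg_cmult[of B "-1" "\<lambda>x. f x * chi T x"] by (simp add: chi_flip[OF T] fourier_def)
  finally have *: "cavg B (\<lambda>x. f (flip e x) * chi T x) = (if e \<in> T then - fourier B f T else fourier B f T)" .
  have "fourier B (dif e f) T = (1/2) * (fourier B f T - cavg B (\<lambda>x. f (flip e x) * chi T x))"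
    unfolding fourier_def cavg_diff[symmetric] cavg_cmult[symmetric] by (simp add: dif_def algebra_simps diff_divide_distrib)
  then show ?thesis unfolding * by (cases "e \<in> T") simp_all
qed

text \<open>
  The weight that turns the variance into an energy: degrees up to \<open>L\<close> are paid for by the noised energy, higher
  degrees by the plain energy divided by \<open>L\<close>.
\<close>

lemma low_degree_weight:
  assumes "1 \<le> k" "1 \<le> (L::nat)"
  shows "1 \<le> 3 ^ L * (real k * (1/3) ^ k) + real k / real L"
proof (cases "k \<le> L")
  case True
  then have "(3::real) ^ k \<le> 3 ^ L" by (intro power_increasing) auto
  then have "1 \<le> (3::real) ^ L * (1/3) ^ k" by (simp add: power_divide)
  also have "\<dots> \<le> 3 ^ L * (real k * (1/3) ^ k)" using assms by simp
  finally show ?thesis by (simp add: add_increasing2)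
next
  case False
  then have "1 \<le> real k / real L" using assms by simp
  then show ?thesis by (simp add: add_increasing)
qed

text \<open>
  The argument of Kahn, Kalai and Linial: apply the pointwise inequality between weights to each Walsh degree and
  recognise the two sums as energies. Noise with parameter \<open>1 / sqrt 3\<close> contributes \<open>(1/3) ^ card T\<close>, since the
  second moment squares the damping factor.
\<close>

lemma variance_low_degree:
  fixes f :: "('b \<Rightarrow> real) \<Rightarrow> real"
  assumes B: "finite B" and L: "1 \<le> (L::nat)"
  shows "cavg B (\<lambda>x. (f x)\<^sup>2) - (cavg B f)\<^sup>2
    \<le> 3 ^ L * (\<Sum>e\<in>B. cavg B (\<lambda>x. (noise (1 / sqrt 3) B (dif e f) x)\<^sup>2))
      + (\<Sum>e\<in>B. cavg B (\<lambda>x. (dif e f x)\<^sup>2)) / L"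
proof -
  let ?a = "\<lambda>T. (fourier B f T)\<^sup>2"
  have third: "((1 / sqrt 3) ^ k)\<^sup>2 = (1 / 3 :: real) ^ k" for k
    by (simp add: power_mult[symmetric] mult.commute[of k] power_mult power_divide)
  have count: "(\<Sum>e\<in>B. \<Sum>T\<in>Pow B. if e \<in> T then u T else 0) = (\<Sum>T\<in>Pow B. real (card T) * u T)" for u :: "'b set \<Rightarrow> real"
  proof -
    have "(\<Sum>e\<in>B. if e \<in> T then u T else 0) = real (card T) * u T" if "T \<in> Pow B" for T
    proof -
      have "(\<Sum>e\<in>B. if e \<in> T then u T else 0) = (\<Sum>e\<in>B \<inter> T. u T)"
        by (rule sum.inter_restrict[OF B, symmetric])
      also have "B \<inter> T = T" using that by auto
      finally show ?thesis by simp
    qed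
    then show ?thesis by (subst sum.swap) simp
  qed
  have N: "(\<Sum>e\<in>B. cavg B (\<lambda>x. (noise (1 / sqrt 3) B (dif e f) x)\<^sup>2))
      = (\<Sum>T\<in>Pow B. real (card T) * ((1/3) ^ card T * ?a T))"
    unfolding count[symmetric] noise_walsh[OF B] parseval[OF B] power_mult_distrib third
    by (intro sum.cong refl) (simp add: fourier_dif[OF B])
  have D: "(\<Sum>e\<in>B. cavg B (\<lambda>x. (dif e f x)\<^sup>2)) = (\<Sum>T\<in>Pow B. real (card T) * ?a T)"
    unfolding count[symmetric] cavg_square_fourier[OF B]
    by (intro sum.cong refl) (simp add: fourier_dif[OF B])
  have "cavg B (\<lambda>x. (f x)\<^sup>2) - (cavg B f)\<^sup>2 = (\<Sum>T\<in>Pow B - {{}}. ?a T)"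
    unfolding cavg_square_fourier[OF B] using B
    by (subst sum.remove[of "Pow B" "{}"]) (auto simp: fourier_def chi_def)
  also have "\<dots> \<le> (\<Sum>T\<in>Pow B - {{}}. (3 ^ L * (real (card T) * (1/3) ^ card T) + real (card T) / real L) * ?a T)"
  proof (rule sum_mono)
    fix T assume "T \<in> Pow B - {{}}"
    then have "1 \<le> card T" using B finite_subset[of T B] by (simp add: Suc_le_eq card_gt_0_iff)
    from low_degree_weight[OF this L] show "?a T \<le> (3 ^ L * (real (card T) * (1/3) ^ card T) + real (card T) / real L) * ?a T"
      using mult_right_mono[of 1 _ "?a T"] by simp
  qed
  also have "\<dots> = (\<Sum>T\<in>Pow B. (3 ^ L * (real (card T) * (1/3) ^ card T) + real (card T) / real L) * ?a T)"
    using B by (intro sum.mono_neutral_left) auto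
  also have "\<dots> = 3 ^ L * (\<Sum>T\<in>Pow B. real (card T) * ((1/3) ^ card T * ?a T))
      + (\<Sum>T\<in>Pow B. real (card T) * ?a T) / L"
    by (simp add: sum_distrib_left sum_divide_distrib sum.distrib[symmetric] algebra_simps)
  finally show ?thesis unfolding N D .
qed

lemma noise_kernel_nonneg:
  assumes "\<bar>\<rho>\<bar> \<le> 1" "x \<in> cube B" "y \<in> cube B"
  shows "0 \<le> (\<Prod>e\<in>B. 1 + \<rho> * x e * y e)"
proof (rule prod_nonneg)
  fix e assume "e \<in> B"
  then have "\<bar>\<rho> * x e * y e\<bar> \<le> 1"
    using assms(1) cube_abs[OF assms(2)] cube_abs[OF assms(3)] by (simp add: abs_mult)
  then show "0 \<le> 1 + \<rho> * x e * y e" by linarith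
qed

lemma noise_nonneg:
  assumes "\<bar>\<rho>\<bar> \<le> 1" "x \<in> cube B" "\<And>y. y \<in> cube B \<Longrightarrow> 0 \<le> h y"
  shows "0 \<le> noise \<rho> B h x"
  unfolding noise_def using assms by (intro cavg_nonneg mult_nonneg_nonneg noise_kernel_nonneg) auto

text \<open>
  Minkowski's inequality for the Euclidean length of a finite sum of vectors.
\<close>

lemma L2_set_sum_le:
  "L2_set (\<lambda>c. \<Sum>y\<in>Y. F y c) C \<le> (\<Sum>y\<in>Y. L2_set (F y) C)"
proof (induction Y rule: infinite_finite_induct)
  case (insert y Y)
  have "L2_set (\<lambda>c. F y c + (\<Sum>y\<in>Y. F y c)) C \<le> L2_set (F y) C + L2_set (\<lambda>c. \<Sum>y\<in>Y. F y c) C"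
    by (rule L2_set_triangle_ineq)
  then show ?case using insert by simp
qed (simp_all add: L2_set_def)

text \<open>
  Noise is an average, so by convexity the length of the noised vector is at most the noised length.
\<close>

lemma L2_set_noise_le:
  assumes "\<bar>\<rho>\<bar> \<le> 1" "x \<in> cube B"
  shows "L2_set (\<lambda>c. noise \<rho> B (h c) x) C \<le> noise \<rho> B (\<lambda>y. L2_set (\<lambda>c. h c y) C) x"
proof -
  define K where "K y = (\<Prod>e\<in>B. 1 + \<rho> * x e * y e) / 2 ^ card B" for y
  have K: "0 \<le> K y" if "y \<in> cube B" for y
    unfolding K_def using noise_kernel_nonneg[OF assms that] by simp
  have noise: "noise \<rho> B g x = (\<Sum>y\<in>cube B. K y * g y)" for g
    by (simp add: noise_def cavg_def K_def sum_divide_distrib mult.commute)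
  have "L2_set (\<lambda>c. noise \<rho> B (h c) x) C \<le> (\<Sum>y\<in>cube B. L2_set (\<lambda>c. K y * h c y) C)"
    unfolding noise by (rule L2_set_sum_le)
  also have "\<dots> = (\<Sum>y\<in>cube B. K y * L2_set (\<lambda>c. h c y) C)"
    using K by (simp add: L2_set_right_distrib)
  finally show ?thesis unfolding noise .
qed

text \<open>
  Flipping one bit changes one factor of the kernel, from \<open>1 + \<rho>\<close> to \<open>1 - \<rho>\<close> or conversely, and
  \<open>(1 + \<rho>) / (1 - \<rho>) \<le> 4\<close> at \<open>\<rho> = 1 / sqrt 3\<close>.
\<close>

lemma noise_flip_le:
  assumes B: "finite B" "e \<in> B" and x: "x \<in> cube B" and h: "\<And>y. 0 \<le> h y"
  shows "noise (1 / sqrt 3) B (\<lambda>y. h (flip e y)) x \<le> 4 * noise (1 / sqrt 3) B h x"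
proof -
  let ?r = "1 / sqrt 3 :: real"
  define K where "K y = (\<Prod>c\<in>B. 1 + ?r * x c * y c)" for y
  have r: "0 \<le> ?r" "?r \<le> 3 / 5"
  proof -
    have "(5 / 3 :: real) \<le> sqrt 3" by (rule real_le_rsqrt) (simp add: power2_eq_square)
    then show "?r \<le> 3 / 5" by (simp add: field_simps)
  qed simp
  have K_flip: "K (flip e y) \<le> 4 * K y" if y: "y \<in> cube B" for y
  proof -
    define R where "R = (\<Prod>c\<in>B - {e}. 1 + ?r * x c * y c)"
    have xs: "x \<in> cube B \<Longrightarrow> restrict x (B - {e}) \<in> cube (B - {e})" for x :: "'a \<Rightarrow> real"
      by (auto simp: cube_def PiE_iff)
    have "R = (\<Prod>c\<in>B - {e}. 1 + ?r * restrict x (B - {e}) c * restrict y (B - {e}) c)"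
      unfolding R_def by (intro prod.cong) auto
    then have R: "0 \<le> R"
      using noise_kernel_nonneg[of ?r "restrict x (B - {e})" "B - {e}" "restrict y (B - {e})"] r xs[OF x] xs[OF y] by simp
    have "K y = (1 + ?r * x e * y e) * R"
      unfolding K_def R_def using B by (rule prod.remove)
    moreover have "K (flip e y) = (1 - ?r * x e * y e) * R"
    proof -
      have "K (flip e y) = (1 + ?r * x e * flip e y e) * (\<Prod>c\<in>B - {e}. 1 + ?r * x c * flip e y c)"
        unfolding K_def using B by (rule prod.remove)
      then show ?thesis by (simp add: R_def flip_def)
    qed
    moreover have "1 - ?r * x e * y e \<le> 4 * (1 + ?r * x e * y e)"
    proof -
      have "\<bar>?r * x e * y e\<bar> \<le> 3 / 5" using cube_abs[OF x B(2)] cube_abs[OF y B(2)] r by (simp add: abs_mult)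
      moreover have "1 - t \<le> 4 * (1 + t)" if "\<bar>t\<bar> \<le> 3 / 5" for t :: real using that unfolding abs_le_iff by simp
      ultimately show ?thesis by blast
    qed
    ultimately show ?thesis using mult_right_mono[OF _ R] by (metis mult.assoc)
  qed
  have "noise ?r B (\<lambda>y. h (flip e y)) x = cavg B (\<lambda>y. h y * K (flip e y))"
    using cavg_flip[OF B(2), of "\<lambda>y. h y * K (flip e y)"] by (simp add: noise_def K_def)
  also have "\<dots> \<le> cavg B (\<lambda>y. 4 * (h y * K y))"
    using K_flip mult_left_mono[OF K_flip h] by (intro cavg_mono) (simp add: mult.left_commute)
  also have "\<dots> = 4 * noise ?r B h x"
    by (simp add: cavg_cmult noise_def K_def)
  finally show ?thesis .
qed

text \<open>
  After noise, a derivative is controlled by upward increments at \<open>x\<close> alone: the downward ones are upward increments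
  at the flipped point, and noise distinguishes the two points only up to a factor of four.
\<close>

lemma noise_dif_le:
  assumes B: "finite B" "e \<in> B" and x: "x \<in> cube B"
  shows "\<bar>noise (1 / sqrt 3) B (dif e f) x\<bar> \<le> 4 * noise (1 / sqrt 3) B (up e f) x"
proof -
  let ?r = "1 / sqrt 3 :: real"
  have r: "\<bar>?r\<bar> \<le> 1" by simp
  have "noise ?r B (dif e f) x = noise ?r B (\<lambda>y. up e f (flip e y)) x - noise ?r B (up e f) x"
    unfolding noise_def cavg_diff[symmetric] dif_up by (simp add: left_diff_distrib)
  moreover have "0 \<le> noise ?r B (\<lambda>y. up e f (flip e y)) x" "0 \<le> noise ?r B (up e f) x"
    by (intro noise_nonneg[OF r x] up_nonneg)+
  moreover have "noise ?r B (\<lambda>y. up e f (flip e y)) x \<le> 4 * noise ?r B (up e f) x"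
    by (rule noise_flip_le[OF B x up_nonneg])
  ultimately show ?thesis by linarith
qed

definition block_grad :: "'r \<Rightarrow> 'c set \<Rightarrow> (('r \<times> 'c \<Rightarrow> real) \<Rightarrow> real) \<Rightarrow> ('r \<times> 'c \<Rightarrow> real) \<Rightarrow> real" where
  "block_grad i C f x = L2_set (\<lambda>c. up (i, c) f x) C"

lemma block_grad_nonneg: "0 \<le> block_grad i C f x"
  by (simp add: block_grad_def)

lemma L2_set_square: "(L2_set f A)\<^sup>2 = (\<Sum>i\<in>A. (f i)\<^sup>2)"
  by (simp add: L2_set_def sum_nonneg)

text \<open>
  An \<open>L\<^sup>1\<close>-\<open>L\<^sup>2\<close> inequality in the spirit of Talagrand, for blocks of bits instead of single bits. Treating a
  block as one vector-valued derivative is essential: its length is the only quantity that is known to be small in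
  \<open>L\<^sup>1\<close>.
\<close>

lemma variance_blocks:
  fixes f :: "('r \<times> 'c \<Rightarrow> real) \<Rightarrow> real"
  assumes fin: "finite R" "finite C" and L: "1 \<le> (L::nat)"
  defines "B \<equiv> R \<times> C"
  shows "cavg B (\<lambda>x. (f x)\<^sup>2) - (cavg B f)\<^sup>2
    \<le> 16 * 3 ^ L * (\<Sum>i\<in>R. cavg B (block_grad i C f) * sqrt (cavg B (\<lambda>x. (block_grad i C f x)\<^sup>2)))
      + 2 * (\<Sum>i\<in>R. cavg B (\<lambda>x. (block_grad i C f x)\<^sup>2)) / L"
proof -
  let ?r = "1 / sqrt 3 :: real"
  have r: "\<bar>?r\<bar> \<le> 1" by simp
  have B: "finite B" using fin by (simp add: B_def)
  have split: "(\<Sum>e\<in>B. F e) = (\<Sum>i\<in>R. \<Sum>c\<in>C. F (i, c))" for F :: "'r \<times> 'c \<Rightarrow> real"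
    unfolding B_def by (simp add: sum.cartesian_product)
  have row: "(\<Sum>c\<in>C. cavg B (\<lambda>x. (noise ?r B (dif (i, c) f) x)\<^sup>2))
      \<le> 16 * (cavg B (block_grad i C f) * sqrt (cavg B (\<lambda>x. (block_grad i C f x)\<^sup>2)))" if i: "i \<in> R" for i
  proof -
    have "(\<Sum>c\<in>C. (noise ?r B (dif (i, c) f) x)\<^sup>2) \<le> 16 * (noise ?r B (block_grad i C f) x)\<^sup>2"
      if x: "x \<in> cube B" for x
    proof -
      have "(\<Sum>c\<in>C. (noise ?r B (dif (i, c) f) x)\<^sup>2) \<le> (\<Sum>c\<in>C. (4 * noise ?r B (up (i, c) f) x)\<^sup>2)"
        using noise_dif_le[OF B _ x] i by (intro sum_mono) (metis B_def SigmaI abs_ge_zero power_mono power2_abs)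
      also have "\<dots> = 16 * (L2_set (\<lambda>c. noise ?r B (up (i, c) f) x) C)\<^sup>2"
        by (simp add: L2_set_square power_mult_distrib sum_distrib_left)
      also have "\<dots> \<le> 16 * (noise ?r B (block_grad i C f) x)\<^sup>2"
        unfolding block_grad_def using L2_set_noise_le[OF r x, of "\<lambda>c. up (i, c) f" C]
        by (intro mult_left_mono power_mono) auto
      finally show ?thesis .
    qed
    then have "(\<Sum>c\<in>C. cavg B (\<lambda>x. (noise ?r B (dif (i, c) f) x)\<^sup>2))
        \<le> 16 * cavg B (\<lambda>x. (noise ?r B (block_grad i C f) x)\<^sup>2)"
      unfolding cavg_sum[symmetric] cavg_cmult[symmetric] by (rule cavg_mono)
    also have "\<dots> \<le> 16 * (cavg B (block_grad i C f) * sqrt (cavg B (\<lambda>x. (block_grad i C f x)\<^sup>2)))"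
      using cavg_noise_square[OF B, of "block_grad i C f", OF block_grad_nonneg] by simp
    finally show ?thesis .
  qed
  have energy: "(\<Sum>c\<in>C. cavg B (\<lambda>x. (dif (i, c) f x)\<^sup>2)) = 2 * cavg B (\<lambda>x. (block_grad i C f x)\<^sup>2)"
    if "i \<in> R" for i
  proof -
    have "cavg B (\<lambda>x. (dif (i, c) f x)\<^sup>2) = 2 * cavg B (\<lambda>x. (up (i, c) f x)\<^sup>2)" if "c \<in> C" for c
      using cavg_flip[of "(i, c)" B "\<lambda>x. (up (i, c) f x)\<^sup>2"] that \<open>i \<in> R\<close>
      by (simp add: dif_square_up cavg_add B_def)
    then show ?thesis
      by (simp add: block_grad_def L2_set_square cavg_sum sum_distrib_left)
  qed
  have "cavg B (\<lambda>x. (f x)\<^sup>2) - (cavg B f)\<^sup>2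
    \<le> 3 ^ L * (\<Sum>i\<in>R. \<Sum>c\<in>C. cavg B (\<lambda>x. (noise ?r B (dif (i, c) f) x)\<^sup>2))
      + (\<Sum>i\<in>R. \<Sum>c\<in>C. cavg B (\<lambda>x. (dif (i, c) f x)\<^sup>2)) / L"
    using variance_low_degree[OF B L, of f] unfolding split .
  also have "\<dots> \<le> 3 ^ L * (\<Sum>i\<in>R. 16 * (cavg B (block_grad i C f) * sqrt (cavg B (\<lambda>x. (block_grad i C f x)\<^sup>2))))
      + (\<Sum>i\<in>R. 2 * cavg B (\<lambda>x. (block_grad i C f x)\<^sup>2)) / L"
    using row energy by (intro add_mono mult_left_mono sum_mono divide_right_mono) auto
  finally show ?thesis by (simp add: sum_distrib_left[symmetric] mult.left_commute[of _ 16] mult.assoc)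
qed

text \<open>
  Swapping two blocks is a measure-preserving symmetry of the cube that exchanges their gradients.
\<close>

lemma cavg_block_grad_exchangeable:
  fixes f :: "('r \<times> 'c \<Rightarrow> real) \<Rightarrow> real"
  assumes "i \<in> R" "j \<in> R"
    and sym: "\<And>x. x \<in> cube (R \<times> C) \<Longrightarrow> f (\<lambda>(r, c). x (Transposition.transpose i j r, c)) = f x"
  shows "cavg (R \<times> C) (\<lambda>x. \<phi> (block_grad j C f x)) = cavg (R \<times> C) (\<lambda>x. \<phi> (block_grad i C f x))"
proof -
  define s where "s x = (\<lambda>(r, c). x (Transposition.transpose i j r, c))" for x :: "'r \<times> 'c \<Rightarrow> real"
  have ss: "s (s x) = x" for x
    by (auto simp: s_def)
  have tR: "Transposition.transpose i j r \<in> R \<longleftrightarrow> r \<in> R" for r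
    using assms(1,2) by (auto simp: Transposition.transpose_def)
  have s_cube: "s x \<in> cube (R \<times> C)" if "x \<in> cube (R \<times> C)" for x
    using that tR by (auto simp: s_def cube_def PiE_iff extensional_def split_beta)
  have "bij_betw s (cube (R \<times> C)) (cube (R \<times> C))"
    by (rule bij_betwI[where g = s]) (auto simp: ss s_cube)
  from cavg_reindex[OF this, of "\<lambda>x. \<phi> (block_grad j C f x)"]
  have "cavg (R \<times> C) (\<lambda>x. \<phi> (block_grad j C f x)) = cavg (R \<times> C) (\<lambda>x. \<phi> (block_grad j C f (s x)))"
    by simp
  also have "\<dots> = cavg (R \<times> C) (\<lambda>x. \<phi> (block_grad i C f x))"
  proof (rule cavg_cong)
    fix x assume x: "x \<in> cube (R \<times> C)"
    have "up (j, c) f (s x) = up (i, c) f x" if c: "c \<in> C" for c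
    proof -
      have "flip (j, c) (s x) = s (flip (i, c) x)"
        by (auto simp: flip_def s_def fun_eq_iff Transposition.transpose_def)
      then show ?thesis
        using sym[OF x] sym[OF flip_cube[OF _ x, of "(i, c)"]] c assms(1) by (simp add: up_def s_def[symmetric])
    qed
    then show "\<phi> (block_grad j C f (s x)) = \<phi> (block_grad i C f x)"
      by (simp add: block_grad_def L2_set_def)
  qed
  finally show ?thesis .
qed

text \<open>
  Exchangeability turns pointwise bounds on sums over all blocks into bounds on the moments of each block gradient,
  namely \<open>a / M\<close> and \<open>b / M\<close> for \<open>M\<close> blocks. This is where the gain comes from: if \<open>b\<close> is of order one, the first
  term is \<open>a / sqrt M\<close>.
\<close>

lemma variance_exchangeable_blocks:
  fixes f :: "('r \<times> 'c \<Rightarrow> real) \<Rightarrow> real"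
  assumes fin: "finite R" "finite C" and R: "R \<noteq> {}" and L: "1 \<le> (L::nat)"
    and sym: "\<And>i j x. i \<in> R \<Longrightarrow> j \<in> R \<Longrightarrow> x \<in> cube (R \<times> C) \<Longrightarrow> f (\<lambda>(r, c). x (Transposition.transpose i j r, c)) = f x"
    and a: "\<And>x. x \<in> cube (R \<times> C) \<Longrightarrow> (\<Sum>i\<in>R. block_grad i C f x) \<le> a"
    and b: "\<And>x. x \<in> cube (R \<times> C) \<Longrightarrow> (\<Sum>i\<in>R. (block_grad i C f x)\<^sup>2) \<le> b"
  shows "cavg (R \<times> C) (\<lambda>x. (f x)\<^sup>2) - (cavg (R \<times> C) f)\<^sup>2 \<le> 16 * 3 ^ L * (a * sqrt (b / card R)) + 2 * b / L"
proof -
  let ?B = "R \<times> C"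
  obtain i0 where i0: "i0 \<in> R" using R by auto
  define M where "M = real (card R)"
  have M: "0 < M" using fin R by (simp add: M_def card_gt_0_iff)
  define u where "u = cavg ?B (block_grad i0 C f)"
  define v where "v = cavg ?B (\<lambda>x. (block_grad i0 C f x)\<^sup>2)"
  have u: "cavg ?B (block_grad i C f) = u" if "i \<in> R" for i
    unfolding u_def by (rule cavg_block_grad_exchangeable[OF i0 that, where \<phi> = "\<lambda>t. t"]) (rule sym[OF i0 that])
  have v: "cavg ?B (\<lambda>x. (block_grad i C f x)\<^sup>2) = v" if "i \<in> R" for i
    unfolding v_def by (rule cavg_block_grad_exchangeable[OF i0 that, where \<phi> = "\<lambda>t. t\<^sup>2"]) (rule sym[OF i0 that])
  have u0: "0 \<le> u" and v0: "0 \<le> v"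
    by (auto simp: u_def v_def intro!: cavg_nonneg block_grad_nonneg)
  have B: "finite ?B" using fin by simp
  have "M * u = cavg ?B (\<lambda>x. \<Sum>i\<in>R. block_grad i C f x)"
    unfolding cavg_sum using u by (simp add: M_def)
  also have "\<dots> \<le> cavg ?B (\<lambda>x. a)" by (intro cavg_mono a)
  finally have Mu: "M * u \<le> a" by (simp add: cavg_const[OF B])
  have "M * v = cavg ?B (\<lambda>x. \<Sum>i\<in>R. (block_grad i C f x)\<^sup>2)"
    unfolding cavg_sum using v by (simp add: M_def)
  also have "\<dots> \<le> cavg ?B (\<lambda>x. b)" by (intro cavg_mono b)
  finally have Mv: "M * v \<le> b" by (simp add: cavg_const[OF B])
  have "cavg ?B (\<lambda>x. (f x)\<^sup>2) - (cavg ?B f)\<^sup>2 \<le> 16 * 3 ^ L * (M * (u * sqrt v)) + 2 * (M * v) / L"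
    using variance_blocks[OF fin L, of f] by (simp add: u v M_def)
  also have "\<dots> \<le> 16 * 3 ^ L * (a * sqrt (b / M)) + 2 * b / L"
  proof (intro add_mono mult_left_mono divide_right_mono)
    have "v \<le> b / M" using Mv M by (simp add: field_simps)
    then have "(M * u) * sqrt v \<le> a * sqrt (b / M)"
      using Mu M u0 v0 by (intro mult_mono) (auto intro: order_trans[of 0 "M * u"])
    then show "M * (u * sqrt v) \<le> a * sqrt (b / M)" by (simp add: mult.assoc)
  qed (use Mv in auto)
  finally show ?thesis by (simp add: M_def)
qed

text \<open>
  The variance is half the mean square difference of two independent copies; the latter form passes to limits
  without any integrability assumption.
\<close>

lemma cavg_cavg_square_diff:
  assumes "finite B"
  shows "cavg B (\<lambda>x. cavg B (\<lambda>y. (f x - f y)\<^sup>2)) = 2 * (cavg B (\<lambda>x. (f x)\<^sup>2) - (cavg B f)\<^sup>2)"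
proof -
  have "(f x - f y)\<^sup>2 = ((f x)\<^sup>2 + (f y)\<^sup>2) - (2 * f x) * f y" for x y
    by (simp add: power2_eq_square algebra_simps)
  then have "cavg B (\<lambda>x. cavg B (\<lambda>y. (f x - f y)\<^sup>2))
    = cavg B (\<lambda>x. ((f x)\<^sup>2 + cavg B (\<lambda>y. (f y)\<^sup>2)) - (2 * f x) * cavg B f)"
    by (simp only: cavg_diff cavg_add cavg_cmult cavg_const[OF assms])
  also have "\<dots> = cavg B (\<lambda>x. ((f x)\<^sup>2 + cavg B (\<lambda>y. (f y)\<^sup>2)) - (2 * cavg B f) * f x)"
    by (simp add: mult_ac)
  also have "\<dots> = cavg B (\<lambda>x. (f x)\<^sup>2) + cavg B (\<lambda>x. (f x)\<^sup>2) - 2 * cavg B f * cavg B f"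
    by (simp only: cavg_diff cavg_add cavg_cmult cavg_const[OF assms])
  finally show ?thesis by (simp add: power2_eq_square)
qed

section \<open>The norms and their one-coordinate increments\<close>

text \<open>
  The index set is arbitrary so that one further coordinate can be added to a vector.
\<close>

definition pnorm :: "real \<Rightarrow> 'i set \<Rightarrow> ('i \<Rightarrow> real) \<Rightarrow> real" where
  "pnorm q I x = (\<Sum>i\<in>I. \<bar>x i\<bar> powr q) powr (1 / q)"

lemma pnorm_nonneg: "0 \<le> pnorm q I x"
  by (simp add: pnorm_def)

lemma pnorm_powr: "0 < q \<Longrightarrow> pnorm q I x powr q = (\<Sum>i\<in>I. \<bar>x i\<bar> powr q)"
  by (simp add: pnorm_def powr_powr sum_nonneg)

lemma pnorm_cong: "(\<And>i. i \<in> I \<Longrightarrow> x i = y i) \<Longrightarrow> pnorm q I x = pnorm q I y"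
  by (simp add: pnorm_def)

lemma pnorm_leI:
  assumes "0 < q" "0 \<le> c" "(\<Sum>i\<in>I. \<bar>x i\<bar> powr q) \<le> c powr q"
  shows "pnorm q I x \<le> c"
proof -
  have "pnorm q I x \<le> (c powr q) powr (1 / q)"
    unfolding pnorm_def using assms by (intro powr_mono2) (auto intro: sum_nonneg)
  then show ?thesis using assms by (simp add: powr_powr)
qed

lemma abs_le_pnorm:
  assumes "finite I" "i \<in> I" "0 < q"
  shows "\<bar>x i\<bar> \<le> pnorm q I x"
proof -
  have "\<bar>x i\<bar> powr q \<le> (\<Sum>i\<in>I. \<bar>x i\<bar> powr q)"
    using assms by (intro member_le_sum) auto
  then have "(\<bar>x i\<bar> powr q) powr (1 / q) \<le> pnorm q I x"
    unfolding pnorm_def using assms by (intro powr_mono2) auto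
  then show ?thesis using assms by (simp add: powr_powr)
qed

text \<open>
  Each \<open>\<bar>x i\<bar>\<close> is at most the \<open>\<ell>\<^sup>1\<close>-norm, so \<open>q - 1\<close> of its \<open>q\<close> powers may be replaced by that norm.
\<close>

lemma pnorm_le_sum:
  assumes I: "finite I" and q: "1 \<le> q"
  shows "pnorm q I x \<le> (\<Sum>i\<in>I. \<bar>x i\<bar>)"
proof (rule pnorm_leI)
  let ?S = "\<Sum>i\<in>I. \<bar>x i\<bar>"
  have S0: "0 \<le> ?S" by (rule sum_nonneg) auto
  have "\<bar>x i\<bar> powr q \<le> \<bar>x i\<bar> * ?S powr (q - 1)" if "i \<in> I" for i
  proof (cases "x i = 0")
    case False
    have "\<bar>x i\<bar> \<le> ?S" using I that by (intro member_le_sum) auto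
    then have "\<bar>x i\<bar> powr (q - 1) \<le> ?S powr (q - 1)" using q by (intro powr_mono2) auto
    moreover have "\<bar>x i\<bar> powr q = \<bar>x i\<bar> * \<bar>x i\<bar> powr (q - 1)"
      using False by (simp add: powr_diff)
    ultimately show ?thesis by (simp add: mult_left_mono)
  qed simp
  then have "(\<Sum>i\<in>I. \<bar>x i\<bar> powr q) \<le> (\<Sum>i\<in>I. \<bar>x i\<bar> * ?S powr (q - 1))" by (rule sum_mono)
  also have "\<dots> = ?S * ?S powr (q - 1)" by (simp add: sum_distrib_right)
  also have "\<dots> = ?S powr q"
    using S0 by (cases "?S = 0") (simp_all add: powr_diff)
  finally show "(\<Sum>i\<in>I. \<bar>x i\<bar> powr q) \<le> ?S powr q" .
qed (use q in \<open>auto intro: sum_nonneg\<close>)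

lemma convex_powr_nonneg:
  fixes u v t q :: real
  assumes q: "1 \<le> q" and "0 \<le> u" "0 \<le> v" "0 \<le> t" "t \<le> 1"
  shows "((1 - t) * u + t * v) powr q \<le> (1 - t) * u powr q + t * v powr q"
proof -
  have shrink: "(s * z) powr q \<le> s * z powr q" if "0 \<le> s" "s \<le> 1" "0 \<le> z" for s z :: real
  proof -
    have "s powr q \<le> s" using powr_mono'[of 1 q s] that q by (cases "s = 0") auto
    then show ?thesis using that by (simp add: powr_mult mult_right_mono)
  qed
  consider "u = 0" | "v = 0" | "0 < u" "0 < v" using assms by linarith
  then show ?thesis
  proof cases
    case 1
    then show ?thesis using shrink[of t v] assms by simp
  next
    case 2
    then show ?thesis using shrink[of "1 - t" u] assms by simp
  next
    case 3
    have "convex_on {0<..} (\<lambda>x. x powr q)" by (rule powr_convex[OF q])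
    from convex_onD[OF this, of t u v] show ?thesis using 3 assms by simp
  qed
qed

text \<open>
  Minkowski's inequality. After scaling, \<open>\<bar>x\<bar> + \<bar>y\<bar>\<close> is a convex combination of two vectors of norm one, so the claim
  is convexity of the power function.
\<close>

lemma pnorm_triangle:
  assumes I: "finite I" and q: "1 \<le> q"
  shows "pnorm q I (\<lambda>i. x i + y i) \<le> pnorm q I x + pnorm q I y"
proof -
  let ?a = "pnorm q I x" and ?b = "pnorm q I y"
  have q0: "0 < q" using q by simp
  have ab: "0 \<le> ?a" "0 \<le> ?b" by (rule pnorm_nonneg)+
  consider "?a = 0" | "?b = 0" | "0 < ?a" "0 < ?b" using ab by linarith
  then show ?thesis
  proof cases
    case 1
    then have "x i = 0" if "i \<in> I" for i using abs_le_pnorm[OF I that q0, of x] by simp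
    then show ?thesis using 1 by (simp cong: pnorm_cong)
  next
    case 2
    then have "y i = 0" if "i \<in> I" for i using abs_le_pnorm[OF I that q0, of y] by simp
    then show ?thesis using 2 by (simp cong: pnorm_cong)
  next
    case 3
    define c where "c = ?a + ?b"
    define t where "t = ?b / c"
    have c: "0 < c" and t: "0 \<le> t" "t \<le> 1" "1 - t = ?a / c"
      using 3 by (auto simp: c_def t_def field_simps)
    have "\<bar>x i + y i\<bar> powr q \<le> c powr q * ((1 - t) * (\<bar>x i\<bar> powr q / ?a powr q) + t * (\<bar>y i\<bar> powr q / ?b powr q))" for i
    proof -
      have "c * ((1 - t) * (\<bar>x i\<bar> / ?a) + t * (\<bar>y i\<bar> / ?b)) = \<bar>x i\<bar> + \<bar>y i\<bar>"
        unfolding t(3) using 3 c by (simp add: t_def field_simps)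
      then have "\<bar>x i + y i\<bar> powr q \<le> (c * ((1 - t) * (\<bar>x i\<bar> / ?a) + t * (\<bar>y i\<bar> / ?b))) powr q"
        using q0 by (intro powr_mono2) auto
      also have "\<dots> = c powr q * ((1 - t) * (\<bar>x i\<bar> / ?a) + t * (\<bar>y i\<bar> / ?b)) powr q"
        using c t 3 by (intro powr_mult)
      also have "\<dots> \<le> c powr q * ((1 - t) * (\<bar>x i\<bar> / ?a) powr q + t * (\<bar>y i\<bar> / ?b) powr q)"
        using t 3 q by (intro mult_left_mono convex_powr_nonneg) auto
      finally show ?thesis using 3 by (simp add: powr_divide)
    qed
    then have "(\<Sum>i\<in>I. \<bar>x i + y i\<bar> powr q)
        \<le> (\<Sum>i\<in>I. c powr q * ((1 - t) * (\<bar>x i\<bar> powr q / ?a powr q) + t * (\<bar>y i\<bar> powr q / ?b powr q)))"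
      by (rule sum_mono)
    also have "\<dots> = c powr q * ((1 - t) * ((\<Sum>i\<in>I. \<bar>x i\<bar> powr q) / ?a powr q) + t * ((\<Sum>i\<in>I. \<bar>y i\<bar> powr q) / ?b powr q))"
      by (simp only: sum_distrib_left sum_divide_distrib sum.distrib distrib_left)
    also have "\<dots> = c powr q"
      unfolding pnorm_powr[OF q0, symmetric] using 3 by simp
    finally show ?thesis
      unfolding c_def[symmetric] using c q0 by (intro pnorm_leI) auto
  qed
qed

lemma pnorm_diff_le:
  assumes I: "finite I" and q: "1 \<le> q"
  shows "pnorm q I x \<le> pnorm q I y + (\<Sum>i\<in>I. \<bar>x i - y i\<bar>)"
  using pnorm_triangle[OF I q, of y "\<lambda>i. x i - y i"] pnorm_le_sum[OF I q, of "\<lambda>i. x i - y i"] by simp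

lemma powr_Lipschitz_unit:
  fixes u w p :: real
  assumes p: "1 \<le> p" and u: "0 \<le> u" "u \<le> w" "w \<le> 1"
  shows "w powr p - u powr p \<le> p * (w - u)"
proof (cases "u = w")
  case False
  then have "u < w" using u by simp
  have "\<exists>l z. u < z \<and> z < w \<and> ((\<lambda>z. z powr p) has_real_derivative l) (at z) \<and> w powr p - u powr p = (w - u) * l"
  proof (rule MVT[OF \<open>u < w\<close>])
    show "continuous_on {u..w} (\<lambda>z. z powr p)" using p u by (intro continuous_on_powr') (auto intro!: continuous_intros)
    fix z assume "u < z" "z < w"
    then have "0 < z" using u by simp
    then show "(\<lambda>z. z powr p) differentiable at z"
      using has_real_derivative_powr[of z p] real_differentiable_def by blast
  qed
  then obtain l z where z: "u < z" "z < w" "((\<lambda>z. z powr p) has_real_derivative l) (at z)"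
    and eq: "w powr p - u powr p = (w - u) * l" by blast
  have "0 < z" using u z by simp
  then have "l = p * z powr (p - 1)"
    using DERIV_unique[OF z(3) has_real_derivative_powr] by simp
  moreover have "z powr (p - 1) \<le> 1" using \<open>0 < z\<close> z u p by (intro powr_le1) auto
  ultimately have "l \<le> p" using p by (simp add: mult_left_le)
  then show ?thesis unfolding eq using u by (simp add: mult.commute[of p] mult_left_mono)
qed simp

text \<open>
  The derivative of the norm in one coordinate is \<open>(z / S z) powr (q - 1)\<close>. The mean value theorem evaluates it at
  an intermediate point; moving that point back to \<open>a\<close> costs at most \<open>(q - 1) (b - a) / \<rho>\<close>, because the norm is
  at least \<open>\<rho>\<close> and increasing. The bound is one-sided, hence involves no second derivative of the norm.
\<close>

lemma one_coordinate_increment_nonneg: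
  fixes c q \<rho> a b :: real
  assumes q: "2 \<le> q" and \<rho>: "0 < \<rho>" and c: "\<rho> powr q \<le> c" and ab: "0 \<le> a" "a \<le> b"
  defines "S \<equiv> \<lambda>z. (c + z powr q) powr (1 / q)"
  shows "S b - S a \<le> (b - a) * ((a / S a) powr (q - 1) + (q - 1) * (b - a) / \<rho>)"
proof (cases "a = b")
  case False
  then have "a < b" using ab by simp
  have c0: "0 < c" using \<rho> order_less_le_trans[OF _ c, of 0] by simp
  have S_ge: "\<rho> \<le> S z" if "0 \<le> z" for z
  proof -
    have "(\<rho> powr q) powr (1 / q) \<le> S z"
      unfolding S_def using q c by (intro powr_mono2) (auto intro: add_increasing2)
    then show ?thesis using \<rho> q by (simp add: powr_powr)
  qed
  have S_powr: "S z powr q = c + z powr q" for z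
    unfolding S_def using q c0 by (simp add: powr_powr add_nonneg_nonneg less_imp_le)
  have DS: "(S has_real_derivative (z / S z) powr (q - 1)) (at z)" if z: "0 < z" for z
  proof -
    have pos: "0 < c + z powr q" using c0 by (simp add: add_pos_nonneg)
    have "(S has_real_derivative (1 / q * (c + z powr q) powr (1 / q - 1) * (q * z powr (q - 1)))) (at z)"
      unfolding S_def using z pos q by (auto intro!: derivative_eq_intros)
    moreover have "(z / S z) powr (q - 1) = z powr (q - 1) * (c + z powr q) powr (1 / q - 1)"
    proof -
      have "(z / S z) powr (q - 1) = z powr (q - 1) / S z powr (q - 1)"
        using z by (simp add: powr_divide S_def)
      also have "S z powr (q - 1) = (c + z powr q) powr (1 - 1 / q)"
        unfolding S_def using q by (simp add: powr_powr field_simps)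
      also have "z powr (q - 1) / \<dots> = z powr (q - 1) * (c + z powr q) powr (- (1 - 1 / q))"
        unfolding powr_minus divide_inverse ..
      finally show ?thesis by simp
    qed
    ultimately show ?thesis using q by (simp add: mult.commute)
  qed
  have "\<exists>l z. a < z \<and> z < b \<and> (S has_real_derivative l) (at z) \<and> S b - S a = (b - a) * l"
  proof (rule MVT[OF \<open>a < b\<close>])
    show "continuous_on {a..b} S"
      unfolding S_def using q ab c0
      by (intro continuous_on_powr' continuous_on_add continuous_on_const continuous_on_id) (auto simp: add_nonneg_nonneg less_imp_le)
    fix z assume "a < z" "z < b"
    then show "S differentiable at z" using DS[of z] ab real_differentiable_def by force
  qed
  then obtain l z where z: "a < z" "z < b" "(S has_real_derivative l) (at z)"
    and eq: "S b - S a = (b - a) * l" by blast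
  have z0: "0 < z" using z ab by simp
  have l: "l = (z / S z) powr (q - 1)" using DERIV_unique[OF z(3) DS[OF z0]] .
  have Sz: "0 < S z" "\<rho> \<le> S z" "0 < S a" "\<rho> \<le> S a"
    using S_ge[of z] S_ge[of a] \<rho> z0 ab by auto
  have "S a \<le> S z"
    unfolding S_def using q ab z c0 by (intro powr_mono2 add_mono) (auto simp: add_nonneg_nonneg less_imp_le)
  have z_le: "z / S z \<le> 1"
  proof -
    have "z powr q \<le> S z powr q" using S_powr c0 by simp
    then have "z \<le> S z" using powr_less_mono2[of q "S z" z] q Sz by fastforce
    then show ?thesis using Sz by simp
  qed
  let ?u = "a / S z"
  have "l - ?u powr (q - 1) \<le> (q - 1) * (z / S z - ?u)"
    unfolding l using q z z_le ab Sz by (intro powr_Lipschitz_unit) (auto simp: divide_right_mono)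
  also have "\<dots> \<le> (q - 1) * ((b - a) / \<rho>)"
    unfolding diff_divide_distrib[symmetric] using q Sz z \<rho> by (intro mult_left_mono frac_le) auto
  finally have "l \<le> ?u powr (q - 1) + (q - 1) * (b - a) / \<rho>" by simp
  moreover have "?u powr (q - 1) \<le> (a / S a) powr (q - 1)"
    using ab Sz q \<open>S a \<le> S z\<close> by (intro powr_mono2 divide_left_mono) auto
  ultimately show ?thesis unfolding eq using ab by (intro mult_left_mono) auto
qed simp

text \<open>
  The coordinate \<open>k\<close> with fixed value \<open>\<rho>\<close> keeps the norm away from its singularity at the origin.
\<close>

lemma pnorm_coordinate_increment:
  assumes q: "2 \<le> q" and \<rho>: "0 < \<rho>" and I: "finite I" "i \<in> I" "k \<in> I" "k \<noteq> i" and xo: "x k = \<rho>"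
  shows "pnorm q I (x(i := x i + t)) - pnorm q I x
    \<le> \<bar>t\<bar> * ((\<bar>x i\<bar> / pnorm q I x) powr (q - 1) + (q - 1) * \<bar>t\<bar> / \<rho>)"
proof -
  define c where "c = (\<Sum>j\<in>I - {i}. \<bar>x j\<bar> powr q)"
  define S where "S z = (c + z powr q) powr (1 / q)" for z
  have S: "pnorm q I (x(i := z)) = S \<bar>z\<bar>" for z
  proof -
    have "(\<Sum>j\<in>I. \<bar>(x(i := z)) j\<bar> powr q) = \<bar>z\<bar> powr q + (\<Sum>j\<in>I - {i}. \<bar>(x(i := z)) j\<bar> powr q)"
      by (subst sum.remove[OF I(1,2)]) simp
    then show ?thesis by (simp add: pnorm_def S_def c_def add.commute)
  qed
  have c: "\<rho> powr q \<le> c"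
    unfolding c_def using member_le_sum[of k "I - {i}" "\<lambda>j. \<bar>x j\<bar> powr q"] I xo \<rho> by simp
  have c0: "0 \<le> c" unfolding c_def by (rule sum_nonneg) auto
  have Sx: "pnorm q I x = S \<bar>x i\<bar>" using S[of "x i"] by simp
  let ?a = "\<bar>x i\<bar>" and ?b = "\<bar>x i + t\<bar>"
  show ?thesis
  proof (cases "?a \<le> ?b")
    case True
    have "S ?b - S ?a \<le> (?b - ?a) * ((?a / S ?a) powr (q - 1) + (q - 1) * (?b - ?a) / \<rho>)"
      unfolding S_def by (rule one_coordinate_increment_nonneg[OF q \<rho> c _ True]) simp
    also have "\<dots> \<le> \<bar>t\<bar> * ((?a / S ?a) powr (q - 1) + (q - 1) * \<bar>t\<bar> / \<rho>)"
      using True q \<rho> by (intro mult_mono add_mono divide_right_mono mult_left_mono) auto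
    finally show ?thesis unfolding S Sx .
  next
    case False
    then have "S ?b \<le> S ?a"
      unfolding S_def using q c0 by (intro powr_mono2 add_mono) auto
    moreover have "0 \<le> \<bar>t\<bar> * ((\<bar>x i\<bar> / pnorm q I x) powr (q - 1) + (q - 1) * \<bar>t\<bar> / \<rho>)"
      using q \<rho> by simp
    ultimately show ?thesis unfolding S Sx by linarith
  qed
qed

text \<open>
  The gradient of the norm has unit length in the dual exponent \<open>q / (q - 1)\<close>. As this is below two, its
  \<open>\<ell>\<^sup>2\<close>-length is at most one, while its \<open>\<ell>\<^sup>1\<close>-length over \<open>M\<close> coordinates is at most of order \<open>M powr (1 / q)\<close>, which
  is \<open>o(sqrt M)\<close> exactly when \<open>q > 2\<close>.
\<close>

lemma dual_weights:
  assumes q: "2 < q" and fin: "finite J" "J \<subseteq> I" "finite I" and J: "J \<noteq> {}" and pos: "0 < pnorm q I x"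
  defines "s \<equiv> \<lambda>i. (\<bar>x i\<bar> / pnorm q I x) powr (q - 1)"
  shows "(\<Sum>i\<in>J. s i) \<le> 2 * card J powr (1 / q)" and "(\<Sum>i\<in>J. (s i)\<^sup>2) \<le> 1"
    and "\<And>i. i \<in> J \<Longrightarrow> s i \<le> 1"
proof -
  define w where "w i = \<bar>x i\<bar> / pnorm q I x" for i
  have w0: "0 \<le> w i" for i by (simp add: w_def pnorm_nonneg)
  have w1: "w i \<le> 1" if "i \<in> J" for i
    using abs_le_pnorm[of I i q x] fin that q pos by (auto simp: w_def)
  have "(\<Sum>i\<in>J. w i powr q) = (\<Sum>i\<in>J. \<bar>x i\<bar> powr q) / pnorm q I x powr q"
    by (simp add: w_def powr_divide pnorm_nonneg sum_divide_distrib)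
  also have "\<dots> \<le> 1"
  proof -
    have "(\<Sum>i\<in>J. \<bar>x i\<bar> powr q) \<le> pnorm q I x powr q"
      using q fin by (simp add: pnorm_powr sum_mono2)
    then show ?thesis using pos by simp
  qed
  finally have wq: "(\<Sum>i\<in>J. w i powr q) \<le> 1" .
  show "s i \<le> 1" if "i \<in> J" for i
    using w1[OF that] w0[of i] q by (simp add: s_def w_def[symmetric] powr_le1)
  have "(s i)\<^sup>2 \<le> w i powr q" if "i \<in> J" for i
  proof -
    have "(s i)\<^sup>2 = w i powr (2 * (q - 1))"
      by (simp add: s_def w_def[symmetric] power2_eq_square powr_add[symmetric])
    also have "\<dots> \<le> w i powr q"
      using w0 w1[OF that] q by (intro powr_mono') auto
    finally show ?thesis .
  qed
  then have "(\<Sum>i\<in>J. (s i)\<^sup>2) \<le> (\<Sum>i\<in>J. w i powr q)" by (rule sum_mono)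
  then show "(\<Sum>i\<in>J. (s i)\<^sup>2) \<le> 1" using wq by simp
  define m where "m = real (card J)"
  have m: "0 < m" using fin J by (simp add: m_def card_gt_0_iff)
  define l where "l = m powr (1 / q)"
  have l: "0 < l" using m by (simp add: l_def)
  \<comment> \<open>The larger of the two terms dominates according to whether \<open>w i\<close> exceeds \<open>1 / l\<close>; the choice of \<open>l\<close> balances their sums.\<close>
  have "s i \<le> l * w i powr q + l powr (1 - q)" for i
  proof (cases "1 \<le> l * w i")
    case True
    then have "0 < w i" using w0[of i] by (cases "w i = 0") auto
    then have "l * w i powr q = (l * w i) * s i"
      by (simp add: s_def w_def[symmetric] powr_diff)
    moreover have "s i \<le> (l * w i) * s i"
      using mult_right_mono[OF True, of "s i"] by (simp add: s_def)
    ultimately have "s i \<le> l * w i powr q" by (simp only:)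
    then show ?thesis using powr_ge_zero[of l "1 - q"] by linarith
  next
    case False
    then have "w i \<le> 1 / l" using l by (simp add: field_simps)
    then have "s i \<le> (1 / l) powr (q - 1)"
      unfolding s_def w_def[symmetric] using w0 q by (intro powr_mono2) auto
    also have "\<dots> = l powr (1 - q)"
      using l powr_minus[of l "q - 1"] by (simp add: powr_divide) (simp add: divide_inverse)
    finally show ?thesis using l by (simp add: add_increasing)
  qed
  then have "(\<Sum>i\<in>J. s i) \<le> (\<Sum>i\<in>J. l * w i powr q + l powr (1 - q))" by (intro sum_mono)
  also have "\<dots> = l * (\<Sum>i\<in>J. w i powr q) + m * l powr (1 - q)"
    by (simp add: sum.distrib sum_distrib_left m_def)
  also have "m * l powr (1 - q) = l"
  proof -
    have "l powr (1 - q) = l / l powr q" using l by (simp add: powr_diff)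
    also have "l powr q = m" using q m by (simp add: l_def powr_powr)
    finally show ?thesis using m by simp
  qed
  also have "l * (\<Sum>i\<in>J. w i powr q) \<le> l" using wq l by (simp add: mult_left_le)
  finally show "(\<Sum>i\<in>J. s i) \<le> 2 * card J powr (1 / q)" by (simp add: l_def m_def)
qed

section \<open>The margin on the cube\<close>

definition residual :: "nat \<Rightarrow> nat \<Rightarrow> (nat \<times> nat \<Rightarrow> real) \<Rightarrow> (nat \<Rightarrow> real) \<Rightarrow> (nat \<Rightarrow> real) \<Rightarrow> nat \<Rightarrow> real" where
  "residual m n a \<sigma> y = (\<lambda>i. mat_vec m n (\<lambda>i j. a (i, j)) \<sigma> i - y i)"

text \<open>
  The margin for an arbitrary function \<open>\<nu>\<close> in place of the norm, as a function of the family of matrix entries, so that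
  it lives on a product space.
\<close>

definition gap ::
  "((nat \<Rightarrow> real) \<Rightarrow> real) \<Rightarrow> nat \<Rightarrow> nat \<Rightarrow> (nat \<Rightarrow> real) set \<Rightarrow> (nat \<Rightarrow> real) set \<Rightarrow> (nat \<times> nat \<Rightarrow> real) \<Rightarrow> real" where
  "gap \<nu> m n Q F a = (INF \<sigma>\<in>Q. INF y\<in>F. \<nu> (residual m n a \<sigma> y))"

lemma INF2_lower:
  fixes u :: "'x \<Rightarrow> 'y \<Rightarrow> real"
  assumes u0: "\<And>s y. 0 \<le> u s y" and "s \<in> Q" "y \<in> F"
  shows "(INF s\<in>Q. INF y\<in>F. u s y) \<le> u s y"
proof -
  have inner: "bdd_below (u s ` F)" for s by (rule bdd_belowI[of _ 0]) (auto simp: u0)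
  have "0 \<le> (INF y\<in>F. u s y)" for s
    using assms(3) u0 by (intro cINF_greatest) auto
  then have "bdd_below ((\<lambda>s. INF y\<in>F. u s y) ` Q)" by (intro bdd_belowI[of _ 0]) auto
  then have "(INF s\<in>Q. INF y\<in>F. u s y) \<le> (INF y\<in>F. u s y)" using assms(2) by (rule cINF_lower)
  also have "\<dots> \<le> u s y" using inner assms(3) by (rule cINF_lower)
  finally show ?thesis .
qed

lemma INF2_greatest:
  fixes v :: "'x \<Rightarrow> 'y \<Rightarrow> real"
  assumes "Q \<noteq> {}" "F \<noteq> {}" and "\<And>s y. s \<in> Q \<Longrightarrow> y \<in> F \<Longrightarrow> c \<le> v s y"
  shows "c \<le> (INF s\<in>Q. INF y\<in>F. v s y)"
  using assms by (intro cINF_greatest) auto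

lemma INF2_near:
  fixes v :: "'x \<Rightarrow> 'y \<Rightarrow> real"
  assumes "Q \<noteq> {}" "F \<noteq> {}" and "(INF s\<in>Q. INF y\<in>F. v s y) < c"
  obtains s y where "s \<in> Q" "y \<in> F" "v s y < c"
  using INF2_greatest[OF assms(1,2), of c v] assms(3) by (meson not_le)

lemma gap_lower:
  assumes "\<And>r. 0 \<le> \<nu> r" "\<sigma> \<in> Q" "y \<in> F"
  shows "gap \<nu> m n Q F a \<le> \<nu> (residual m n a \<sigma> y)"
  unfolding gap_def using assms by (intro INF2_lower[of "\<lambda>\<sigma> y. \<nu> (residual m n a \<sigma> y)"]) auto

lemma gap_greatest:
  assumes "Q \<noteq> {}" "F \<noteq> {}" "\<And>\<sigma> y. \<sigma> \<in> Q \<Longrightarrow> y \<in> F \<Longrightarrow> c \<le> \<nu> (residual m n a \<sigma> y)"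
  shows "c \<le> gap \<nu> m n Q F a"
  unfolding gap_def using assms by (rule INF2_greatest)

lemma gap_near:
  assumes "Q \<noteq> {}" "F \<noteq> {}" "gap \<nu> m n Q F a < c"
  obtains \<sigma> y where "\<sigma> \<in> Q" "y \<in> F" "\<nu> (residual m n a \<sigma> y) < c"
  using assms unfolding gap_def by (rule INF2_near)

text \<open>
  Comparison of margins reduces to comparison at each pair of competitors.
\<close>

lemma gap_le_gap_add:
  assumes "\<And>r. 0 \<le> \<nu> r" "Q \<noteq> {}" "F \<noteq> {}"
    and "\<And>\<sigma> y. \<sigma> \<in> Q \<Longrightarrow> y \<in> F \<Longrightarrow> \<nu> (residual m n a \<sigma> y) \<le> \<nu>' (residual m n b \<sigma> y) + d"
  shows "gap \<nu> m n Q F a \<le> gap \<nu>' m n Q F b + d"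
proof -
  have "gap \<nu> m n Q F a - d \<le> gap \<nu>' m n Q F b"
  proof (rule gap_greatest[OF assms(2,3)])
    fix \<sigma> y assume "\<sigma> \<in> Q" "y \<in> F"
    then show "gap \<nu> m n Q F a - d \<le> \<nu>' (residual m n b \<sigma> y)"
      using gap_lower[of \<nu> \<sigma> Q y F m n a] assms(1,4) by fastforce
  qed
  then show ?thesis by simp
qed

text \<open>
  A permutation of the rows of the matrix can be undone by the same permutation of the point of \<open>E\<close>. For an
  involution the resulting inequality, used twice, gives equality.
\<close>

lemma gap_permute_rows:
  assumes \<nu>: "\<And>r. 0 \<le> \<nu> r" "\<And>r. \<nu> (\<lambda>i. r (\<pi> i)) = \<nu> r"
    and \<pi>: "\<pi> permutes {..<m}" "\<And>i. \<pi> (\<pi> i) = i"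
    and ne: "Q \<noteq> {}" "E \<noteq> {}" and E: "permutation_invariant m E" "E \<subseteq> Rn m"
  shows "gap \<nu> m n Q E (\<lambda>(i, j). a (\<pi> i, j)) = gap \<nu> m n Q E a"
proof -
  have le: "gap \<nu> m n Q E (\<lambda>(i, j). a (\<pi> i, j)) \<le> gap \<nu> m n Q E a" for a
  proof (rule gap_greatest[OF ne])
    fix \<sigma> y assume \<sigma>: "\<sigma> \<in> Q" and y: "y \<in> E"
    have y': "(\<lambda>i. y (\<pi> i)) \<in> E"
      using E \<pi>(1) y unfolding permutation_invariant_def by blast
    have "\<pi> i < m \<longleftrightarrow> i < m" for i
      using permutes_in_image[OF \<pi>(1), of i] by simp
    then have "residual m n (\<lambda>(i, j). a (\<pi> i, j)) \<sigma> (\<lambda>i. y (\<pi> i)) = (\<lambda>i. residual m n a \<sigma> y (\<pi> i))"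
      by (auto simp: residual_def mat_vec_def fun_eq_iff)
    then have "\<nu> (residual m n (\<lambda>(i, j). a (\<pi> i, j)) \<sigma> (\<lambda>i. y (\<pi> i))) = \<nu> (residual m n a \<sigma> y)"
      by (simp add: \<nu>(2))
    then show "gap \<nu> m n Q E (\<lambda>(i, j). a (\<pi> i, j)) \<le> \<nu> (residual m n a \<sigma> y)"
      using gap_lower[of \<nu>, OF \<nu>(1) \<sigma> y', of m n "\<lambda>(i, j). a (\<pi> i, j)"] by simp
  qed
  from le[of "\<lambda>(i, j). a (\<pi> i, j)"] have "gap \<nu> m n Q E a \<le> gap \<nu> m n Q E (\<lambda>(i, j). a (\<pi> i, j))"
    by (simp add: \<pi>(2))
  with le[of a] show ?thesis by simp
qed

text \<open>
  The \<open>\<ell>\<^sup>q\<close>-norm regularised by an additional coordinate of size \<open>\<rho>\<close>: it is at least \<open>\<rho>\<close> and hence has a gradient that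
  varies slowly.
\<close>

definition rnorm :: "real \<Rightarrow> real \<Rightarrow> nat \<Rightarrow> (nat \<Rightarrow> real) \<Rightarrow> real" where
  "rnorm q \<rho> m r = pnorm q {..m} (r(m := \<rho>))"

lemma rnorm_nonneg: "0 \<le> rnorm q \<rho> m r"
  by (simp add: rnorm_def pnorm_nonneg)

lemma rnorm_ge:
  assumes "0 < q" "0 \<le> \<rho>"
  shows "\<rho> \<le> rnorm q \<rho> m r"
  using abs_le_pnorm[of "{..m}" m q "r(m := \<rho>)"] assms by (simp add: rnorm_def)

lemma rnorm_permute:
  assumes "\<pi> permutes {..<m}"
  shows "rnorm q \<rho> m (\<lambda>i. r (\<pi> i)) = rnorm q \<rho> m r"
proof -
  have \<pi>: "\<pi> permutes {..m}" "\<pi> m = m" 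
    using permutes_subset[OF assms, of "{..m}"] permutes_not_in[OF assms, of m] by force+
  have eq: "(\<lambda>i. r (\<pi> i))(m := \<rho>) = (\<lambda>i. (r(m := \<rho>)) (\<pi> i))"
  proof
    fix i
    have "\<pi> i = m \<longleftrightarrow> i = m" using \<pi> permutes_inj[OF \<pi>(1)] by (metis injD)
    then show "((\<lambda>i. r (\<pi> i))(m := \<rho>)) i = (r(m := \<rho>)) (\<pi> i)" by simp
  qed
  have "(\<Sum>i\<in>{..m}. \<bar>(r(m := \<rho>)) (\<pi> i)\<bar> powr q) = (\<Sum>i\<in>{..m}. \<bar>(r(m := \<rho>)) i\<bar> powr q)"
    using sum.permute[OF \<pi>(1), of "\<lambda>i. \<bar>(r(m := \<rho>)) i\<bar> powr q"] by (simp add: comp_def)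
  then show ?thesis unfolding rnorm_def eq pnorm_def by simp
qed

text \<open>
  The matrix whose entries are the values of independent normalised random walks of length \<open>k\<close>.
\<close>

definition grid :: "nat \<Rightarrow> (nat \<times> nat \<times> nat \<Rightarrow> real) \<Rightarrow> nat \<times> nat \<Rightarrow> real" where
  "grid k x = (\<lambda>(i, j). (\<Sum>l<k. x (i, j, l)) / sqrt (real k))"

text \<open>
  Flipping one bit changes a single entry of the matrix, hence a single coordinate of the residual.
\<close>

lemma residual_flip:
  assumes "i < m" "j < n" "l < k"
  shows "residual m n (grid k (flip (i, j, l) x)) \<sigma> y
    = (residual m n (grid k x) \<sigma> y)(i := residual m n (grid k x) \<sigma> y i + (- 2 * x (i, j, l) * \<sigma> j / sqrt k))"
proof
  fix i'
  have grid: "grid k (flip (i, j, l) x) (i', j')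
      = grid k x (i', j') + (if i' = i \<and> j' = j then - 2 * x (i, j, l) / sqrt k else 0)" for j'
  proof -
    have "(\<Sum>l'<k. flip (i, j, l) x (i', j', l'))
        = (\<Sum>l'<k. x (i', j', l') + (if l' = l then (if i' = i \<and> j' = j then - 2 * x (i, j, l) else 0) else 0))"
      by (intro sum.cong) (auto simp: flip_def)
    also have "\<dots> = (\<Sum>l'<k. x (i', j', l')) + (if i' = i \<and> j' = j then - 2 * x (i, j, l) else 0)"
      using assms(3) by (simp add: sum.distrib)
    finally show ?thesis by (simp add: grid_def add_divide_distrib)
  qed
  have "(\<Sum>j'<n. grid k (flip (i, j, l) x) (i', j') * \<sigma> j')
      = (\<Sum>j'<n. grid k x (i', j') * \<sigma> j' + (if j' = j then (if i' = i then - 2 * x (i, j, l) * \<sigma> j / sqrt k else 0) else 0))"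
    unfolding grid by (intro sum.cong) (auto simp: algebra_simps)
  also have "\<dots> = (\<Sum>j'<n. grid k x (i', j') * \<sigma> j') + (if i' = i then - 2 * x (i, j, l) * \<sigma> j / sqrt k else 0)"
    using assms(2) by (simp add: sum.distrib)
  finally show "residual m n (grid k (flip (i, j, l) x)) \<sigma> y i'
    = ((residual m n (grid k x) \<sigma> y)(i := residual m n (grid k x) \<sigma> y i + (- 2 * x (i, j, l) * \<sigma> j / sqrt k))) i'"
    using assms(1) by (auto simp: residual_def mat_vec_def)
qed

text \<open>
  The block gradient of row \<open>i\<close> is essentially the \<open>i\<close>-th component \<open>s i\<close> of the gradient of the norm at the residual
  of a near-minimiser, because the point \<open>\<sigma>\<close> lies in the Euclidean unit ball. Near-minimisers within \<open>2 / k\<close> are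
  precise enough: the induced error per bit is \<open>1 / k\<close>, and there are \<open>n * k\<close> bits in a row.
\<close>

lemma block_grad_gap_le:
  fixes Q E :: "(nat \<Rightarrow> real) set"
  assumes q: "2 < q" and \<rho>: "0 < \<rho>" and m: "1 \<le> m" and k: "1 \<le> k"
    and ne: "Q \<noteq> {}" "E \<noteq> {}" and Q: "\<And>\<sigma>. \<sigma> \<in> Q \<Longrightarrow> L2_set \<sigma> {..<n} \<le> 1"
    and x: "x \<in> cube ({..<m} \<times> {..<n} \<times> {..<k})"
  defines "F \<equiv> \<lambda>x. gap (rnorm q \<rho> m) m n Q E (grid k x)"
  obtains s where "(\<Sum>i<m. s i) \<le> 2 * m powr (1 / q)" "(\<Sum>i<m. (s i)\<^sup>2) \<le> 1"
    and "\<And>i. i < m \<Longrightarrow> 0 \<le> s i" "\<And>i. i < m \<Longrightarrow> s i \<le> 1"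
    and "\<And>i. i < m \<Longrightarrow> block_grad i ({..<n} \<times> {..<k}) F x \<le> s i + (2 * (q - 1) / \<rho> + sqrt n) * (1 / sqrt k)"
proof -
  let ?C = "{..<n} \<times> {..<k}"
  have k0: "0 < real k" using k by simp
  have "F x < F x + 2 / k" using k0 by simp
  then obtain \<sigma> y where \<sigma>: "\<sigma> \<in> Q" and y: "y \<in> E"
    and near: "rnorm q \<rho> m (residual m n (grid k x) \<sigma> y) < F x + 2 / k"
    unfolding F_def using gap_near[OF ne] by metis
  define r where "r = (residual m n (grid k x) \<sigma> y)(m := \<rho>)"
  define s where "s i = (\<bar>r i\<bar> / pnorm q {..m} r) powr (q - 1)" for i
  have pos: "0 < pnorm q {..m} r"
    using rnorm_ge[of q \<rho> m "residual m n (grid k x) \<sigma> y"] q \<rho> by (simp add: rnorm_def r_def)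
  have dual: "(\<Sum>i<m. s i) \<le> 2 * real (card {..<m}) powr (1 / q)" "(\<Sum>i<m. (s i)\<^sup>2) \<le> 1"
      "\<And>i. i \<in> {..<m} \<Longrightarrow> s i \<le> 1"
  proof -
    have "0 \<in> {..<m}" using m by simp
    then have "{..<m} \<noteq> {}" by blast
    note dw = dual_weights[OF q finite_lessThan _ finite_atMost this pos, folded s_def]
    show "(\<Sum>i<m. s i) \<le> 2 * real (card {..<m}) powr (1 / q)" "(\<Sum>i<m. (s i)\<^sup>2) \<le> 1"
      "\<And>i. i \<in> {..<m} \<Longrightarrow> s i \<le> 1"
      by (rule dw; force)+
  qed
  have bound: "block_grad i ?C F x \<le> s i + (2 * (q - 1) / \<rho> + sqrt n) * (1 / sqrt k)" if i: "i < m" for i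
  proof -
    define c where "c = 2 * (q - 1) / \<rho> * (1 / sqrt k)"
    have c0: "0 \<le> c" using q \<rho> by (simp add: c_def)
    have s0: "0 \<le> s i" by (simp add: s_def)
    have up_le: "up (i, j, l) F x \<le> (s i + c) * (\<bar>\<sigma> j\<bar> / sqrt k) + 1 / k" if j: "j < n" and l: "l < k" for j l
    proof -
      define t where "t = - 2 * x (i, j, l) * \<sigma> j / sqrt k"
      have xe: "\<bar>x (i, j, l)\<bar> = 1" using i j l by (intro cube_abs[OF x]) auto
      have t: "\<bar>t\<bar> = 2 * (\<bar>\<sigma> j\<bar> / sqrt k)" by (simp add: t_def abs_mult xe)
      have "\<bar>\<sigma> j\<bar> \<le> L2_set \<sigma> {..<n}"
        using member_le_L2_set[of "{..<n}" j "\<lambda>i. \<bar>\<sigma> i\<bar>"] j by (simp add: L2_set_def)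
      then have \<sigma>1: "\<bar>\<sigma> j\<bar> \<le> 1" using Q[OF \<sigma>] by simp
      have "F (flip (i, j, l) x) \<le> rnorm q \<rho> m (residual m n (grid k (flip (i, j, l) x)) \<sigma> y)"
        unfolding F_def by (rule gap_lower[OF rnorm_nonneg \<sigma> y])
      also have "\<dots> = pnorm q {..m} (r(i := r i + t))"
        unfolding residual_flip[OF i j l] rnorm_def r_def t_def using i by (simp add: fun_upd_twist)
      finally have "F (flip (i, j, l) x) - F x \<le> pnorm q {..m} (r(i := r i + t)) - pnorm q {..m} r + 2 / k"
        using near by (simp add: rnorm_def r_def)
      also have "pnorm q {..m} (r(i := r i + t)) - pnorm q {..m} r \<le> \<bar>t\<bar> * (s i + (q - 1) * \<bar>t\<bar> / \<rho>)"
        unfolding s_def using q \<rho> i by (intro pnorm_coordinate_increment[where k = m]) (auto simp: r_def)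
      also have "\<dots> \<le> \<bar>t\<bar> * (s i + c)"
      proof (intro mult_left_mono add_left_mono)
        have "\<bar>t\<bar> \<le> 2 / sqrt k" unfolding t using \<sigma>1 by (simp add: divide_right_mono)
        then have "(q - 1) * \<bar>t\<bar> \<le> (q - 1) * (2 / sqrt k)" using q by (intro mult_left_mono) auto
        then have "(q - 1) * \<bar>t\<bar> / \<rho> \<le> (q - 1) * (2 / sqrt k) / \<rho>" using \<rho> by (intro divide_right_mono) auto
        then show "(q - 1) * \<bar>t\<bar> / \<rho> \<le> c" by (simp add: c_def mult_ac)
      qed simp
      finally have "F (flip (i, j, l) x) - F x \<le> 2 * ((s i + c) * (\<bar>\<sigma> j\<bar> / sqrt k) + 1 / k)"
        by (simp add: t distrib_left mult_ac)
      moreover have "0 \<le> (s i + c) * (\<bar>\<sigma> j\<bar> / sqrt k) + 1 / k" using s0 c0 by simp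
      moreover have "up (i, j, l) F x \<le> w" if "F (flip (i, j, l) x) - F x \<le> 2 * w" "0 \<le> w" for w
        using that by (simp add: up_def)
      ultimately show ?thesis by blast
    qed
    have "block_grad i ?C F x \<le> L2_set (\<lambda>p. (s i + c) * (\<bar>\<sigma> (fst p)\<bar> / sqrt k) + 1 / k) ?C"
      unfolding block_grad_def using up_le up_nonneg by (intro L2_set_mono) auto
    also have "\<dots> \<le> L2_set (\<lambda>p. (s i + c) * (\<bar>\<sigma> (fst p)\<bar> / sqrt k)) ?C + L2_set (\<lambda>_. 1 / k) ?C"
      using L2_set_triangle_ineq[of "\<lambda>p. (s i + c) * (\<bar>\<sigma> (fst p)\<bar> / sqrt k)" "\<lambda>_. 1 / k" ?C] .
    also have "L2_set (\<lambda>_. 1 / k) ?C = sqrt n * (1 / sqrt k)"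
      using k0 by (simp add: L2_set_def card_cartesian_product power_divide power2_eq_square real_sqrt_divide)
    also have "L2_set (\<lambda>p. (s i + c) * (\<bar>\<sigma> (fst p)\<bar> / sqrt k)) ?C = (s i + c) * L2_set \<sigma> {..<n}"
    proof -
      have "L2_set (\<lambda>p. \<bar>\<sigma> (fst p)\<bar> / sqrt k) ?C = L2_set \<sigma> {..<n}"
      proof -
        have "(\<Sum>p\<in>?C. (\<bar>\<sigma> (fst p)\<bar> / sqrt k)\<^sup>2) = (\<Sum>(j, l)\<in>?C. (\<sigma> j)\<^sup>2 / k)"
          by (simp add: split_beta power_divide)
        also have "\<dots> = (\<Sum>j<n. \<Sum>l<k. (\<sigma> j)\<^sup>2 / k)"
          by (rule sum.cartesian_product[symmetric])
        also have "\<dots> = (\<Sum>j<n. (\<sigma> j)\<^sup>2)" using k0 by simp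
        finally show ?thesis by (simp add: L2_set_def)
      qed
      then show ?thesis
        using L2_set_right_distrib[of "s i + c" "\<lambda>p. \<bar>\<sigma> (fst p)\<bar> / sqrt k" ?C] s0 c0 by simp
    qed
    also have "(s i + c) * L2_set \<sigma> {..<n} \<le> s i + c"
      using Q[OF \<sigma>] s0 c0 by (simp add: mult_left_le)
    finally show ?thesis unfolding c_def by (simp only: distrib_right add.assoc)
  qed
  show ?thesis
    by (rule that[of s]) (use dual bound in \<open>auto simp: s_def\<close>)
qed

lemma grid_permute:
  "grid k (\<lambda>(r, c). x (\<pi> r, c)) = (\<lambda>(i, j). grid k x (\<pi> i, j))"
  by (auto simp: grid_def fun_eq_iff)

lemma inverse_sqrt_tendsto_0: "(\<lambda>k. 1 / sqrt (real k)) \<longlonglongrightarrow> 0"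
  by (rule tendsto_divide_0[OF tendsto_const])
     (intro filterlim_at_top_imp_at_infinity filterlim_compose[OF sqrt_at_top] filterlim_real_sequentially)

text \<open>
  For fixed dimensions and \<open>k\<close> large the error terms disappear, so the sums of the block gradients and of their
  squares are at most \<open>3 * m powr (1 / q)\<close> and \<open>2\<close>.
\<close>

lemma cube_variance_gap:
  fixes Q E :: "(nat \<Rightarrow> real) set"
  assumes q: "2 < q" and \<rho>: "0 < \<rho>" and m: "1 \<le> m" and L: "1 \<le> (L::nat)"
    and ne: "Q \<noteq> {}" "E \<noteq> {}" and Q: "\<And>\<sigma>. \<sigma> \<in> Q \<Longrightarrow> L2_set \<sigma> {..<n} \<le> 1"
    and E: "permutation_invariant m E" "E \<subseteq> Rn m"
  defines "F \<equiv> \<lambda>k x. gap (rnorm q \<rho> m) m n Q E (grid k x)"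
    and "B \<equiv> \<lambda>k. {..<m} \<times> {..<n} \<times> {..<k}"
  shows "\<forall>\<^sub>F k in sequentially. cavg (B k) (\<lambda>x. cavg (B k) (\<lambda>y. (F k x - F k y)\<^sup>2))
    \<le> 2 * (96 * 3 ^ L * m powr (1 / q - 1 / 2) + 4 / L)"
proof -
  define c where "c = 2 * (q - 1) / \<rho> + sqrt n"
  have c0: "0 \<le> c" using q \<rho> by (simp add: c_def)
  define a where "a k = 2 * m powr (1 / q) + m * c * (1 / sqrt k)" for k :: nat
  define b where "b k = 1 + m * (2 * c * (1 / sqrt k) + c\<^sup>2 * (1 / sqrt k)\<^sup>2)" for k :: nat
  have m0: "0 < real m" "0 < m powr (1 / q)" using m by auto
  have "a \<longlonglongrightarrow> 2 * m powr (1 / q) + m * c * 0"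
    unfolding a_def by (intro tendsto_intros inverse_sqrt_tendsto_0)
  then have ev_a: "\<forall>\<^sub>F k in sequentially. a k < 3 * m powr (1 / q)"
    using m0 by (intro order_tendstoD(2)[of a]) auto
  have "b \<longlonglongrightarrow> 1 + m * (2 * c * 0 + c\<^sup>2 * 0\<^sup>2)"
    unfolding b_def by (intro tendsto_intros inverse_sqrt_tendsto_0)
  then have ev_b: "\<forall>\<^sub>F k in sequentially. b k < 2"
    by (intro order_tendstoD(2)[of b]) auto
  show ?thesis
    using ev_a ev_b eventually_ge_at_top[of 1]
  proof eventually_elim
    case (elim k)
    let ?C = "{..<n} \<times> {..<k}"
    have sums: "(\<Sum>i<m. block_grad i ?C (F k) x) \<le> a k" "(\<Sum>i<m. (block_grad i ?C (F k) x)\<^sup>2) \<le> b k"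
      if x: "x \<in> cube (B k)" for x
    proof -
      obtain s where s: "(\<Sum>i<m. s i) \<le> 2 * m powr (1 / q)" "(\<Sum>i<m. (s i)\<^sup>2) \<le> 1"
        "\<And>i. i < m \<Longrightarrow> 0 \<le> s i" "\<And>i. i < m \<Longrightarrow> s i \<le> 1"
        "\<And>i. i < m \<Longrightarrow> block_grad i ?C (F k) x \<le> s i + c * (1 / sqrt k)"
        using block_grad_gap_le[OF q \<rho> m elim(3) ne Q x[unfolded B_def]] unfolding F_def c_def by blast
      have "(\<Sum>i<m. block_grad i ?C (F k) x) \<le> (\<Sum>i<m. s i + c * (1 / sqrt k))"
        using s(5) by (intro sum_mono) auto
      then show "(\<Sum>i<m. block_grad i ?C (F k) x) \<le> a k"
        using s(1) by (simp add: sum.distrib a_def)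
      have "(block_grad i ?C (F k) x)\<^sup>2 \<le> (s i)\<^sup>2 + (2 * c * (1 / sqrt k) + c\<^sup>2 * (1 / sqrt k)\<^sup>2)" if i: "i < m" for i
      proof -
        have "(block_grad i ?C (F k) x)\<^sup>2 \<le> (s i + c * (1 / sqrt k))\<^sup>2"
          using s(5)[OF i] block_grad_nonneg by (intro power_mono) auto
        also have "\<dots> = (s i)\<^sup>2 + s i * (2 * c * (1 / sqrt k)) + c\<^sup>2 * (1 / sqrt k)\<^sup>2"
          by (simp only: power2_sum power_mult_distrib) (simp only: mult_ac)
        also have "s i * (2 * c * (1 / sqrt k)) \<le> 1 * (2 * c * (1 / sqrt k))"
          using s(4)[OF i] c0 by (intro mult_right_mono) auto
        finally show ?thesis by simp
      qed
      then have "(\<Sum>i<m. (block_grad i ?C (F k) x)\<^sup>2) \<le> (\<Sum>i<m. (s i)\<^sup>2 + (2 * c * (1 / sqrt k) + c\<^sup>2 * (1 / sqrt k)\<^sup>2))"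
        by (intro sum_mono) auto
      then show "(\<Sum>i<m. (block_grad i ?C (F k) x)\<^sup>2) \<le> b k"
        using s(2) by (simp add: sum.distrib b_def)
    qed
    have sym: "F k (\<lambda>(r, c). x (Transposition.transpose i j r, c)) = F k x" if "i < m" "j < m" for i j x
    proof -
      have \<pi>: "Transposition.transpose i j permutes {..<m}"
        using that by (intro permutes_swap_id) auto
      show ?thesis
        unfolding F_def grid_permute
        by (rule gap_permute_rows[OF rnorm_nonneg rnorm_permute[OF \<pi>] \<pi> _ ne E]) simp
    qed
    have "0 \<in> {..<m}" using m by simp
    then have R: "{..<m} \<noteq> {}" by blast
    have ab0: "0 \<le> a k" "0 \<le> b k" using c0 by (auto simp: a_def b_def)
    have "cavg (B k) (\<lambda>x. (F k x)\<^sup>2) - (cavg (B k) (F k))\<^sup>2 \<le> 16 * 3 ^ L * (a k * sqrt (b k / m)) + 2 * b k / L"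
      using variance_exchangeable_blocks[of "{..<m}" ?C L "F k" "a k" "b k"] R L sym sums
      by (simp add: B_def)
    also have "\<dots> \<le> 16 * 3 ^ L * (3 * m powr (1 / q) * (2 / sqrt m)) + 2 * 2 / L"
    proof (intro add_mono mult_left_mono mult_mono divide_right_mono)
      have "sqrt (b k) \<le> 2" using elim(2) by (intro real_le_lsqrt) auto
      then show "sqrt (b k / m) \<le> 2 / sqrt m" by (simp add: real_sqrt_divide divide_right_mono)
    qed (use elim ab0 in auto)
    also have "\<dots> = 96 * 3 ^ L * m powr (1 / q - 1 / 2) + 4 / L"
      using m0 by (simp add: powr_diff powr_half_sqrt)
    finally show ?case
      using cavg_cavg_square_diff[of "B k" "F k"] by (simp add: B_def)
  qed
qed

section \<open>From bits to Gaussian matrices\<close>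

definition walk :: "nat \<Rightarrow> (nat \<Rightarrow> real) \<Rightarrow> real" where
  "walk k x = (\<Sum>l<k. x l) / sqrt k"

definition walk_law :: "nat \<Rightarrow> real measure" where
  "walk_law k = distr (measure_pmf (pmf_of_set (cube {..<k}))) borel (walk k)"

lemma cube_nonempty: "cube B \<noteq> {}"
  by (simp add: cube_def PiE_eq_empty_iff)

lemma real_distribution_walk_law: "real_distribution (walk_law k)"
  unfolding walk_law_def
  by (intro prob_space.real_distribution_distr prob_space_measure_pmf) simp

text \<open>
  The characteristic function factorises over the steps, and a single step contributes a cosine.
\<close>

lemma char_walk_law: "char (walk_law k) t = complex_of_real (cos (t / sqrt k) ^ k)"
proof -
  let ?C = "cube {..<k}" and ?\<theta> = "t / sqrt k"
  have fin: "finite ?C" by (simp add: finite_cube)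
  have "char (walk_law k) t = (CLINT x|measure_pmf (pmf_of_set ?C). iexp (t * walk k x))"
    unfolding char_def walk_law_def by (subst integral_distr) auto
  also have "\<dots> = (\<Sum>x\<in>?C. pmf (pmf_of_set ?C) x *\<^sub>R iexp (t * walk k x))"
    using set_pmf_of_set[OF cube_nonempty fin] fin by (intro integral_measure_pmf) auto
  also have "\<dots> = (\<Sum>x\<in>?C. \<Prod>l<k. iexp (?\<theta> * x l)) / 2 ^ k"
    unfolding sum_divide_distrib
  proof (intro sum.cong refl)
    fix x assume "x \<in> ?C"
    then have "pmf (pmf_of_set ?C) x = 1 / 2 ^ k"
      using pmf_of_set[OF cube_nonempty fin] by (simp add: card_cube)
    moreover have "iexp (t * walk k x) = (\<Prod>l<k. iexp (?\<theta> * x l))"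
      unfolding exp_sum[OF finite_lessThan, symmetric]
      by (simp add: walk_def sum_distrib_left sum_divide_distrib)
    ultimately show "pmf (pmf_of_set ?C) x *\<^sub>R iexp (t * walk k x) = (\<Prod>l<k. iexp (?\<theta> * x l)) / 2 ^ k"
      by (simp add: scaleR_conv_of_real)
  qed
  also have "(\<Sum>x\<in>?C. \<Prod>l<k. iexp (?\<theta> * x l)) = (\<Prod>l<k. \<Sum>s\<in>{-1,1}. iexp (?\<theta> * s))"
    unfolding cube_def by (rule prod_sum_PiE[symmetric]) auto
  also have "(\<Sum>s\<in>{-1,1::real}. iexp (?\<theta> * s)) = 2 * complex_of_real (cos ?\<theta>)"
    by (simp add: cos_of_real[symmetric] cos_exp_eq)
  finally show ?thesis by (simp add: power_mult_distrib)
qed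

lemma cos_power_tendsto: "(\<lambda>k. cos (t / sqrt (real k)) ^ k) \<longlonglongrightarrow> exp (- (t\<^sup>2) / 2)"
proof -
  have pos: "(\<lambda>k. cos (t / sqrt (real k)) ^ k) \<longlonglongrightarrow> exp (- (t\<^sup>2 / 2))" if "0 < t" for t :: real
    using that unfolding power2_eq_square by real_asymp
  consider "t = 0" | "0 < t" | "t < 0" by linarith
  then show ?thesis
  proof cases
    case 3
    then show ?thesis using pos[of "- t"] by simp
  qed (use pos[of t] in auto)
qed

lemma weak_conv_walk_law: "weak_conv_m walk_law std_normal_distribution"
proof (rule levy_continuity[OF real_distribution_walk_law real_dist_normal_dist])
  fix t
  have "(\<lambda>k. complex_of_real (cos (t / sqrt (real k)) ^ k)) \<longlonglongrightarrow> complex_of_real (exp (- (t\<^sup>2) / 2))"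
    by (intro tendsto_of_real cos_power_tendsto)
  then show "(\<lambda>k. char (walk_law k) t) \<longlonglongrightarrow> char std_normal_distribution t"
    by (simp add: char_walk_law char_std_normal_distribution)
qed

text \<open>
  A sum over functions on \<open>insert i I\<close> as an iterated sum, the discrete analogue of splitting off one factor of a
  product measure.
\<close>

lemma sum_PiE_insert:
  fixes F :: "('i \<Rightarrow> 'a) \<Rightarrow> 'c :: comm_monoid_add"
  assumes "i \<notin> I"
  shows "(\<Sum>X\<in>PiE (insert i I) (\<lambda>_. S). F X) = (\<Sum>X\<in>PiE I (\<lambda>_. S). \<Sum>y\<in>S. F (X(i := y)))"
proof -
  have "(\<Sum>X\<in>PiE (insert i I) (\<lambda>_. S). F X) = (\<Sum>(y, X)\<in>S \<times> PiE I (\<lambda>_. S). F (X(i := y)))"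
    unfolding PiE_insert_eq using inj_combinator[OF assms, of "\<lambda>_. S"]
    by (simp add: sum.reindex case_prod_unfold comp_def)
  then show ?thesis by (subst sum.swap) (simp add: sum.cartesian_product)
qed

lemma nn_integral_walk_law:
  assumes "g \<in> borel_measurable borel"
  shows "(\<integral>\<^sup>+ z. g z \<partial>walk_law k) = (\<Sum>y\<in>cube {..<k}. g (walk k y)) * ennreal (1 / 2 ^ k)"
proof -
  have "(\<integral>\<^sup>+ z. g z \<partial>walk_law k) = (\<integral>\<^sup>+ y. g (walk k y) \<partial>measure_pmf (pmf_of_set (cube {..<k})))"
    unfolding walk_law_def using assms by (subst nn_integral_distr) auto
  also have "\<dots> = (\<Sum>y\<in>cube {..<k}. g (walk k y)) / ennreal (2 ^ k)"
    by (subst nn_integral_pmf_of_set) (simp_all add: cube_nonempty finite_cube card_cube ennreal_power[symmetric])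
  finally show ?thesis
    by (simp add: divide_ennreal_def inverse_ennreal inverse_eq_divide)
qed

lemma nn_integral_PiM_walk_law:
  fixes G :: "('i \<Rightarrow> real) \<Rightarrow> ennreal"
  assumes "finite I" and "G \<in> borel_measurable (PiM I (\<lambda>_. borel))"
  shows "(\<integral>\<^sup>+ a. G a \<partial>PiM I (\<lambda>_. walk_law k))
    = (\<Sum>X\<in>PiE I (\<lambda>_. cube {..<k}). G (\<lambda>i\<in>I. walk k (X i))) * ennreal ((1 / 2 ^ k) ^ card I)"
  using assms
proof (induction I arbitrary: G)
  case empty
  interpret real_distribution "walk_law k" by (rule real_distribution_walk_law)
  interpret product_prob_space "\<lambda>_. walk_law k" by unfold_locales
  show ?case by (simp add: PiM_empty nn_integral_count_space_finite)
next
  case (insert i I)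
  interpret real_distribution "walk_law k" by (rule real_distribution_walk_law)
  interpret product_prob_space "\<lambda>_. walk_law k" by unfold_locales
  have sets: "sets (PiM J (\<lambda>_. walk_law k)) = sets (PiM J (\<lambda>_. borel))" for J :: "'i set"
    by (intro sets_PiM_cong) auto
  have G: "G \<in> borel_measurable (PiM (insert i I) (\<lambda>_. walk_law k))"
    using insert.prems unfolding measurable_cong_sets[OF sets refl] .
  define H where "H a = (\<Sum>y\<in>cube {..<k}. G (a(i := walk k y))) * ennreal (1 / 2 ^ k)" for a
  have G1: "(\<lambda>a. G (a(i := c))) \<in> borel_measurable (PiM I (\<lambda>_. borel))" for c
    by (rule measurable_compose[OF _ insert.prems], rule measurable_fun_upd[where J = I]) auto
  have H: "H \<in> borel_measurable (PiM I (\<lambda>_. borel))"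
    unfolding H_def using G1 by (intro borel_measurable_times_ennreal borel_measurable_sum) auto
  have "(\<integral>\<^sup>+ a. G a \<partial>PiM (insert i I) (\<lambda>_. walk_law k))
      = (\<integral>\<^sup>+ a. (\<integral>\<^sup>+ z. G (a(i := z)) \<partial>walk_law k) \<partial>PiM I (\<lambda>_. walk_law k))"
    by (rule product_nn_integral_insert[OF insert.hyps G])
  also have "\<dots> = (\<integral>\<^sup>+ a. H a \<partial>PiM I (\<lambda>_. walk_law k))"
  proof (rule nn_integral_cong)
    fix a assume "a \<in> space (PiM I (\<lambda>_. walk_law k))"
    then have a: "a \<in> space (PiM I (\<lambda>_. borel))" using sets_eq_imp_space_eq[OF sets[of I]] by simp
    have "(\<lambda>z. G (a(i := z))) \<in> borel_measurable borel"
      by (rule measurable_compose[OF _ insert.prems], rule measurable_fun_upd[where J = I]) (use a in auto)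
    then show "(\<integral>\<^sup>+ z. G (a(i := z)) \<partial>walk_law k) = H a"
      unfolding H_def by (rule nn_integral_walk_law)
  qed
  also have "\<dots> = (\<Sum>X\<in>PiE I (\<lambda>_. cube {..<k}). H (\<lambda>i\<in>I. walk k (X i))) * ennreal ((1 / 2 ^ k) ^ card I)"
    by (rule insert.IH[OF H])
  also have "\<dots> = (\<Sum>X\<in>PiE I (\<lambda>_. cube {..<k}). \<Sum>y\<in>cube {..<k}. G ((\<lambda>i\<in>I. walk k (X i))(i := walk k y)))
      * (ennreal (1 / 2 ^ k) * ennreal ((1 / 2 ^ k) ^ card I))"
    by (simp add: H_def sum_distrib_right mult.assoc)
  also have "ennreal (1 / 2 ^ k) * ennreal ((1 / 2 ^ k) ^ card I) = ennreal ((1 / 2 ^ k) ^ card (insert i I))"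
    using insert.hyps by (simp add: ennreal_mult[symmetric])
  also have "(\<Sum>X\<in>PiE I (\<lambda>_. cube {..<k}). \<Sum>y\<in>cube {..<k}. G ((\<lambda>i\<in>I. walk k (X i))(i := walk k y)))
      = (\<Sum>X\<in>PiE (insert i I) (\<lambda>_. cube {..<k}). G (\<lambda>i'\<in>insert i I. walk k (X i')))"
    unfolding sum_PiE_insert[OF insert.hyps(2)]
    by (intro sum.cong refl arg_cong[of _ _ G]) (use insert.hyps(2) in \<open>auto simp: fun_eq_iff restrict_def\<close>)
  finally show ?case .
qed

text \<open>
  Independent walks, one for each entry, are the same as one cube containing the bits of all of them.
\<close>

lemma nn_integral_PiM_walk_law_grid:
  fixes g :: "(nat \<times> nat \<Rightarrow> real) \<Rightarrow> real"
  assumes g: "g \<in> borel_measurable (PiM ({..<m} \<times> {..<n}) (\<lambda>_. borel))" "\<And>a. 0 \<le> g a"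
  defines "I \<equiv> {..<m} \<times> {..<n}"
  shows "(\<integral>\<^sup>+ a. ennreal (g a) \<partial>PiM I (\<lambda>_. walk_law k))
    = ennreal (cavg ({..<m} \<times> {..<n} \<times> {..<k}) (\<lambda>x. g (restrict (grid k x) I)))"
proof -
  let ?B = "{..<m} \<times> {..<n} \<times> {..<k}"
  define h where "h X = (\<lambda>(i, j, l)\<in>?B. X (i, j) l)" for X :: "nat \<times> nat \<Rightarrow> nat \<Rightarrow> real"
  define h' where "h' x = (\<lambda>p\<in>I. \<lambda>l\<in>{..<k}. x (fst p, snd p, l))" for x :: "nat \<times> nat \<times> nat \<Rightarrow> real"
  have bij: "bij_betw h (PiE I (\<lambda>_. cube {..<k})) (cube ?B)"
  proof (rule bij_betwI[where g = h'])
    show "h \<in> PiE I (\<lambda>_. cube {..<k}) \<rightarrow> cube ?B"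
      by (fastforce simp: h_def cube_def I_def PiE_iff)
    show "h' \<in> cube ?B \<rightarrow> PiE I (\<lambda>_. cube {..<k})"
      by (auto simp: h'_def cube_def I_def PiE_iff)
    show "h' (h X) = X" if X: "X \<in> PiE I (\<lambda>_. cube {..<k})" for X
    proof -
      have "h' (h X) p = X p" for p
      proof (cases "p \<in> I")
        case True
        then have "X p \<in> cube {..<k}" using X by auto
        then show ?thesis using True by (auto simp: h_def h'_def I_def fun_eq_iff cube_def PiE_iff extensional_def)
      next
        case False
        then show ?thesis using PiE_arb[OF X False] by (simp add: h'_def)
      qed
      then show ?thesis ..
    qed
    show "h (h' x) = x" if "x \<in> cube ?B" for x
      using that by (auto simp: h_def h'_def I_def fun_eq_iff cube_def PiE_iff extensional_def restrict_def)
  qed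
  have grid: "(\<lambda>p\<in>I. walk k (X p)) = restrict (grid k (h X)) I" for X
    by (auto simp: fun_eq_iff restrict_def I_def walk_def grid_def h_def)
  have fin: "finite (PiE I (\<lambda>_. cube {..<k}))"
    by (auto simp: I_def intro!: finite_PiE finite_cube)
  have "(\<integral>\<^sup>+ a. ennreal (g a) \<partial>PiM I (\<lambda>_. walk_law k))
    = (\<Sum>X\<in>PiE I (\<lambda>_. cube {..<k}). ennreal (g (\<lambda>i\<in>I. walk k (X i)))) * ennreal ((1 / 2 ^ k) ^ card I)"
    using g by (intro nn_integral_PiM_walk_law) (auto simp: I_def)
  also have "\<dots> = ennreal ((\<Sum>X\<in>PiE I (\<lambda>_. cube {..<k}). g (restrict (grid k (h X)) I)) * (1 / 2 ^ k) ^ card I)"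
    unfolding grid using g by (simp add: sum_ennreal ennreal_mult sum_nonneg)
  also have "(\<Sum>X\<in>PiE I (\<lambda>_. cube {..<k}). g (restrict (grid k (h X)) I)) = (\<Sum>x\<in>cube ?B. g (restrict (grid k x) I))"
    by (rule sum.reindex_bij_betw[OF bij])
  also have "(\<Sum>x\<in>cube ?B. g (restrict (grid k x) I)) * (1 / 2 ^ k) ^ card I = cavg ?B (\<lambda>x. g (restrict (grid k x) I))"
    by (simp add: cavg_def I_def card_cartesian_product power_divide mult.commute mult.left_commute flip: power_mult)
  finally show ?thesis .
qed

text \<open>
  Twice the variance when \<open>M\<close> is a probability measure and \<open>u\<close> is square integrable, but meaningful for every
  measurable \<open>u\<close>.
\<close>

definition msd :: "'a measure \<Rightarrow> ('a \<Rightarrow> real) \<Rightarrow> ennreal" where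
  "msd M u = (\<integral>\<^sup>+ x. (\<integral>\<^sup>+ y. ennreal ((u x - u y)\<^sup>2) \<partial>M) \<partial>M)"

lemma msd_distr:
  assumes T: "T \<in> measurable M N" and u: "u \<in> borel_measurable N" and N: "prob_space M"
  shows "msd (distr M N T) u = msd M (\<lambda>x. u (T x))"
proof -
  interpret D: prob_space "distr M N T" by (rule prob_space.prob_space_distr[OF N T])
  have "(\<lambda>(x, y). ennreal ((u x - u y)\<^sup>2)) \<in> borel_measurable (N \<Otimes>\<^sub>M distr M N T)"
    using u by measurable
  from D.borel_measurable_nn_integral[OF this]
  have "(\<lambda>x. \<integral>\<^sup>+ y. ennreal ((u x - u y)\<^sup>2) \<partial>distr M N T) \<in> borel_measurable N" .
  then have "msd (distr M N T) u = (\<integral>\<^sup>+ x. (\<integral>\<^sup>+ y. ennreal ((u (T x) - u y)\<^sup>2) \<partial>distr M N T) \<partial>M)"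
    unfolding msd_def using T by (subst nn_integral_distr) auto
  also have "\<dots> = msd M (\<lambda>x. u (T x))"
    unfolding msd_def using T u by (intro nn_integral_cong nn_integral_distr) auto
  finally show ?thesis .
qed

text \<open>
  Fatou's lemma, once for each of the two variables.
\<close>

lemma msd_le_of_tendsto:
  assumes M: "prob_space M" and v: "\<And>k. v k \<in> borel_measurable M"
    and lim: "\<And>x. x \<in> space M \<Longrightarrow> (\<lambda>k. v k x) \<longlonglongrightarrow> u x"
    and le: "\<forall>\<^sub>F k in sequentially. msd M (v k) \<le> c"
  shows "msd M u \<le> c"
proof -
  interpret prob_space M by fact
  let ?g = "\<lambda>k x. \<integral>\<^sup>+ y. ennreal ((v k x - v k y)\<^sup>2) \<partial>M"
  have pair: "(\<lambda>(x, y). ennreal ((v k x - v k y)\<^sup>2)) \<in> borel_measurable (M \<Otimes>\<^sub>M M)" for k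
    using v[of k] by measurable
  have "(\<integral>\<^sup>+ y. ennreal ((u x - u y)\<^sup>2) \<partial>M) \<le> liminf (\<lambda>k. ?g k x)" if x: "x \<in> space M" for x
  proof -
    have "(\<integral>\<^sup>+ y. ennreal ((u x - u y)\<^sup>2) \<partial>M) = (\<integral>\<^sup>+ y. liminf (\<lambda>k. ennreal ((v k x - v k y)\<^sup>2)) \<partial>M)"
    proof (rule nn_integral_cong)
      fix y assume y: "y \<in> space M"
      have "(\<lambda>k. ennreal ((v k x - v k y)\<^sup>2)) \<longlonglongrightarrow> ennreal ((u x - u y)\<^sup>2)"
        by (intro tendsto_ennrealI tendsto_intros lim x y)
      from lim_imp_Liminf[OF _ this] show "ennreal ((u x - u y)\<^sup>2) = liminf (\<lambda>k. ennreal ((v k x - v k y)\<^sup>2))"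
        by simp
    qed
    also have "\<dots> \<le> liminf (\<lambda>k. ?g k x)"
      using v by (intro nn_integral_liminf) auto
    finally show ?thesis .
  qed
  then have "msd M u \<le> (\<integral>\<^sup>+ x. liminf (\<lambda>k. ?g k x) \<partial>M)"
    unfolding msd_def by (rule nn_integral_mono)
  also have "\<dots> \<le> liminf (\<lambda>k. msd M (v k))"
    unfolding msd_def using borel_measurable_nn_integral[OF pair] by (intro nn_integral_liminf) auto
  also have "\<dots> \<le> limsup (\<lambda>k. msd M (v k))"
    by (rule Liminf_le_Limsup) simp
  also have "\<dots> \<le> c" using le by (intro Limsup_bounded) auto
  finally show ?thesis .
qed

lemma gap_cong:
  assumes "\<And>i j. i < m \<Longrightarrow> j < n \<Longrightarrow> a (i, j) = b (i, j)"
  shows "gap \<nu> m n Q F a = gap \<nu> m n Q F b"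
proof -
  have "residual m n a \<sigma> y = residual m n b \<sigma> y" for \<sigma> y
    using assms by (auto simp: residual_def mat_vec_def fun_eq_iff)
  then show ?thesis by (simp add: gap_def)
qed

lemma abs_coordinate_le_1:
  fixes n :: nat
  assumes "L2_set \<sigma> {..<n} \<le> 1" "j < n"
  shows "\<bar>\<sigma> j\<bar> \<le> 1"
proof -
  have "\<bar>\<sigma> j\<bar> \<le> L2_set \<sigma> {..<n}"
    using member_le_L2_set[of "{..<n}" j "\<lambda>i. \<bar>\<sigma> i\<bar>"] assms by (simp add: L2_set_def)
  then show ?thesis using assms by simp
qed

text \<open>
  Points of the unit ball have coordinates of modulus at most one, so each row of the residual moves by at most the
  \<open>\<ell>\<^sup>1\<close>-change of that row of the matrix.
\<close>

lemma abs_gap_diff_le: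
  assumes \<nu>: "\<And>r. 0 \<le> \<nu> r" "\<And>r r'. \<nu> r \<le> \<nu> r' + (\<Sum>i<m. \<bar>r i - r' i\<bar>)"
    and ne: "Q \<noteq> {}" "F \<noteq> {}" and Q: "\<And>\<sigma>. \<sigma> \<in> Q \<Longrightarrow> L2_set \<sigma> {..<n} \<le> 1"
  shows "\<bar>gap \<nu> m n Q F a - gap \<nu> m n Q F b\<bar> \<le> (\<Sum>i<m. \<Sum>j<n. \<bar>a (i, j) - b (i, j)\<bar>)"
proof -
  have le: "gap \<nu> m n Q F a \<le> gap \<nu> m n Q F b + (\<Sum>i<m. \<Sum>j<n. \<bar>a (i, j) - b (i, j)\<bar>)" for a b
  proof (rule gap_le_gap_add[OF \<nu>(1) ne])
    fix \<sigma> y assume \<sigma>: "\<sigma> \<in> Q" and "y \<in> F"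
    have \<sigma>1: "\<bar>\<sigma> j\<bar> \<le> 1" if "j < n" for j
      using abs_coordinate_le_1[OF Q[OF \<sigma>] that] .
    have "\<bar>residual m n a \<sigma> y i - residual m n b \<sigma> y i\<bar> \<le> (\<Sum>j<n. \<bar>a (i, j) - b (i, j)\<bar>)" if "i < m" for i
    proof -
      have "residual m n a \<sigma> y i - residual m n b \<sigma> y i = (\<Sum>j<n. (a (i, j) - b (i, j)) * \<sigma> j)"
        using that by (simp add: residual_def mat_vec_def sum_subtractf left_diff_distrib)
      then have "\<bar>residual m n a \<sigma> y i - residual m n b \<sigma> y i\<bar> \<le> (\<Sum>j<n. \<bar>(a (i, j) - b (i, j)) * \<sigma> j\<bar>)"
        by (simp add: sum_abs)
      also have "\<dots> \<le> (\<Sum>j<n. \<bar>a (i, j) - b (i, j)\<bar>)"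
        using \<sigma>1 by (intro sum_mono) (simp add: abs_mult mult_left_le)
      finally show ?thesis .
    qed
    then have "(\<Sum>i<m. \<bar>residual m n a \<sigma> y i - residual m n b \<sigma> y i\<bar>) \<le> (\<Sum>i<m. \<Sum>j<n. \<bar>a (i, j) - b (i, j)\<bar>)"
      by (intro sum_mono) auto
    then show "\<nu> (residual m n a \<sigma> y) \<le> \<nu> (residual m n b \<sigma> y) + (\<Sum>i<m. \<Sum>j<n. \<bar>a (i, j) - b (i, j)\<bar>)"
      using \<nu>(2)[of "residual m n a \<sigma> y" "residual m n b \<sigma> y"] by linarith
  qed
  show ?thesis using le[of a b] le[of b a] by (simp add: abs_le_iff abs_minus_commute)
qed

lemma continuous_gap:
  assumes "\<And>r. 0 \<le> \<nu> r" "\<And>r r'. \<nu> r \<le> \<nu> r' + (\<Sum>i<m. \<bar>r i - r' i\<bar>)"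
    and "Q \<noteq> {}" "F \<noteq> {}" and "\<And>\<sigma>. \<sigma> \<in> Q \<Longrightarrow> L2_set \<sigma> {..<n} \<le> 1"
  shows "continuous_on UNIV (gap \<nu> m n Q F)"
  unfolding continuous_on_def
proof
  fix a :: "nat \<times> nat \<Rightarrow> real"
  let ?h = "\<lambda>b. \<Sum>i<m. \<Sum>j<n. \<bar>b (i, j) - a (i, j)\<bar>"
  have "continuous_on UNIV ?h"
    by (intro continuous_intros continuous_on_product_coordinates)
  then have "(?h \<longlongrightarrow> ?h a) (at a)"
    unfolding continuous_on_def by blast
  moreover have "?h a = 0" by simp
  ultimately have "(?h \<longlongrightarrow> 0) (at a)" by metis
  then have "((\<lambda>b. gap \<nu> m n Q F b - gap \<nu> m n Q F a) \<longlongrightarrow> 0) (at a)"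
    by (rule Lim_null_comparison[rotated]) (use abs_gap_diff_le[OF assms] in auto)
  then show "(gap \<nu> m n Q F \<longlongrightarrow> gap \<nu> m n Q F a) (at a)"
    by (rule LIM_zero_cancel)
qed

lemma measurable_gap:
  assumes \<nu>: "\<And>r. 0 \<le> \<nu> r" "\<And>r r'. \<nu> r \<le> \<nu> r' + (\<Sum>i<m. \<bar>r i - r' i\<bar>)"
    and ne: "Q \<noteq> {}" "F \<noteq> {}" and Q: "\<And>\<sigma>. \<sigma> \<in> Q \<Longrightarrow> L2_set \<sigma> {..<n} \<le> 1"
    and A: "\<And>i j. i < m \<Longrightarrow> j < n \<Longrightarrow> (\<lambda>\<omega>. A \<omega> (i, j)) \<in> borel_measurable M"
  shows "(\<lambda>\<omega>. gap \<nu> m n Q F (A \<omega>)) \<in> borel_measurable M"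
proof -
  let ?A = "\<lambda>\<omega> p. if p \<in> {..<m} \<times> {..<n} then A \<omega> p else 0"
  have "?A \<in> borel_measurable M"
  proof (rule measurable_coordinatewise_then_product)
    fix p :: "nat \<times> nat"
    show "(\<lambda>\<omega>. ?A \<omega> p) \<in> borel_measurable M"
      using A[of "fst p" "snd p"] by (cases "p \<in> {..<m} \<times> {..<n}") auto
  qed
  from measurable_compose[OF this borel_measurable_continuous_onI[OF continuous_gap[OF \<nu> ne Q]]]
  have "(\<lambda>\<omega>. gap \<nu> m n Q F (?A \<omega>)) \<in> borel_measurable M" by simp
  also have "(\<lambda>\<omega>. gap \<nu> m n Q F (?A \<omega>)) = (\<lambda>\<omega>. gap \<nu> m n Q F (A \<omega>))"
    by (intro ext gap_cong) auto
  finally show ?thesis .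
qed

lemma rnorm_Lipschitz:
  assumes "1 \<le> q"
  shows "rnorm q \<rho> m r \<le> rnorm q \<rho> m r' + (\<Sum>i<m. \<bar>r i - r' i\<bar>)"
proof -
  have "(\<Sum>i\<in>{..m}. \<bar>(r(m := \<rho>)) i - (r'(m := \<rho>)) i\<bar>) = (\<Sum>i<m. \<bar>r i - r' i\<bar>)"
    by (simp add: lessThan_Suc_atMost[symmetric])
  then show ?thesis
    using pnorm_diff_le[of "{..m}" q "r(m := \<rho>)" "r'(m := \<rho>)"] assms by (simp add: rnorm_def)
qed

lemma msd_walk_law:
  fixes u :: "(nat \<times> nat \<Rightarrow> real) \<Rightarrow> real" and k :: nat
  assumes u: "u \<in> borel_measurable (PiM ({..<m} \<times> {..<n}) (\<lambda>_. borel))"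
  defines "I \<equiv> {..<m} \<times> {..<n}" and "B \<equiv> {..<m} \<times> {..<n} \<times> {..<k}"
  shows "msd (PiM I (\<lambda>_. walk_law k)) u
    = ennreal (cavg B (\<lambda>x. cavg B (\<lambda>y. (u (restrict (grid k x) I) - u (restrict (grid k y) I))\<^sup>2)))"
proof -
  have "msd (PiM I (\<lambda>_. walk_law k)) u
      = (\<integral>\<^sup>+ a. ennreal (cavg B (\<lambda>y. (u a - u (restrict (grid k y) I))\<^sup>2)) \<partial>PiM I (\<lambda>_. walk_law k))"
    unfolding msd_def I_def B_def using u by (intro nn_integral_cong nn_integral_PiM_walk_law_grid) auto
  also have "\<dots> = ennreal (cavg B (\<lambda>x. cavg B (\<lambda>y. (u (restrict (grid k x) I) - u (restrict (grid k y) I))\<^sup>2)))"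
    unfolding I_def B_def
  proof (rule nn_integral_PiM_walk_law_grid)
    show "(\<lambda>a. cavg ({..<m} \<times> {..<n} \<times> {..<k}) (\<lambda>y. (u a - u (restrict (grid k y) ({..<m} \<times> {..<n})))\<^sup>2))
        \<in> borel_measurable (PiM ({..<m} \<times> {..<n}) (\<lambda>_. borel))"
      unfolding cavg_def using u by measurable
  qed (auto intro: cavg_nonneg)
  finally show ?thesis .
qed

definition gaussian :: "nat \<Rightarrow> nat \<Rightarrow> (nat \<times> nat \<Rightarrow> real) measure" where
  "gaussian m n = PiM ({..<m} \<times> {..<n}) (\<lambda>_. std_normal_distribution)"

lemma prob_space_std_normal: "prob_space std_normal_distribution"
  using real_dist_normal_dist by (simp add: real_distribution_def)

lemma prob_space_gaussian: "prob_space (gaussian m n)"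
  unfolding gaussian_def by (intro prob_space_PiM prob_space_std_normal)

lemma sets_gaussian: "sets (gaussian m n) = sets (PiM ({..<m} \<times> {..<n}) (\<lambda>_. borel))"
  unfolding gaussian_def by (intro sets_PiM_cong) auto

text \<open>
  The bound on the cube is uniform in the length of the walks. By Skorohod's theorem, applied to each entry
  separately, the walks can be realised so that they converge pointwise to Gaussian variables; the margin is
  continuous, so Fatou's lemma carries the bound to the limit.
\<close>

lemma msd_gaussian_rnorm_gap:
  fixes Q E :: "(nat \<Rightarrow> real) set"
  assumes q: "2 < q" and \<rho>: "0 < \<rho>" and m: "1 \<le> m" and L: "1 \<le> (L::nat)"
    and ne: "Q \<noteq> {}" "E \<noteq> {}" and Q: "\<And>\<sigma>. \<sigma> \<in> Q \<Longrightarrow> L2_set \<sigma> {..<n} \<le> 1"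
    and E: "permutation_invariant m E" "E \<subseteq> Rn m"
  shows "msd (gaussian m n) (gap (rnorm q \<rho> m) m n Q E) \<le> ennreal (2 * (96 * 3 ^ L * m powr (1 / q - 1 / 2) + 4 / L))"
proof -
  let ?I = "{..<m} \<times> {..<n}" and ?W = "2 * (96 * 3 ^ L * m powr (1 / q - 1 / 2) + 4 / L)"
  define f where "f = gap (rnorm q \<rho> m) m n Q E"
  have Lip: "rnorm q \<rho> m r \<le> rnorm q \<rho> m r' + (\<Sum>i<m. \<bar>r i - r' i\<bar>)" for r r'
    using q by (intro rnorm_Lipschitz) simp
  have f_cong: "f a = f b" if "\<And>p. p \<in> ?I \<Longrightarrow> a p = b p" for a b
    unfolding f_def using that by (intro gap_cong) auto
  have f_meas: "(\<lambda>\<omega>. f (A \<omega>)) \<in> borel_measurable M" if "\<And>p. p \<in> ?I \<Longrightarrow> (\<lambda>\<omega>. A \<omega> p) \<in> borel_measurable M"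
    for M :: "'z measure" and A
    unfolding f_def using that by (intro measurable_gap[OF rnorm_nonneg Lip ne Q]) auto
  have f_PiM: "f \<in> borel_measurable (PiM ?I (\<lambda>_. borel))"
    using f_meas[of "\<lambda>\<omega>. \<omega>" "PiM ?I (\<lambda>_. borel)"] by simp
  obtain \<Omega> :: "real measure" and Yk :: "nat \<Rightarrow> real \<Rightarrow> real" and Y :: "real \<Rightarrow> real" where
    coupling: "prob_space \<Omega> \<and> (\<forall>k. Yk k \<in> borel_measurable \<Omega>) \<and> (\<forall>k. distr \<Omega> borel (Yk k) = walk_law k)
      \<and> Y \<in> measurable \<Omega> lborel \<and> distr \<Omega> borel Y = std_normal_distribution
      \<and> (\<forall>x\<in>space \<Omega>. (\<lambda>k. Yk k x) \<longlonglongrightarrow> Y x)"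
    using Skorohod[OF real_distribution_walk_law real_dist_normal_dist weak_conv_walk_law]
    by (elim exE) (rule that)
  then have \<Omega>: "prob_space \<Omega>" and Yk: "\<And>k. Yk k \<in> borel_measurable \<Omega>" "\<And>k. distr \<Omega> borel (Yk k) = walk_law k"
    and Y: "Y \<in> borel_measurable \<Omega>" "distr \<Omega> borel Y = std_normal_distribution"
    and lim: "\<And>x. x \<in> space \<Omega> \<Longrightarrow> (\<lambda>k. Yk k x) \<longlonglongrightarrow> Y x"
    by auto
  interpret \<Omega>: prob_space \<Omega> by fact
  define P where "P = PiM ?I (\<lambda>_. \<Omega>)"
  have P: "prob_space P" unfolding P_def by (intro prob_space_PiM \<Omega>)
  have push: "PiM ?I (\<lambda>_. distr \<Omega> borel Z) = distr P (PiM ?I (\<lambda>_. borel)) (compose ?I Z)"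
    and comp: "compose ?I Z \<in> measurable P (PiM ?I (\<lambda>_. borel))"
    if Z: "Z \<in> borel_measurable \<Omega>" for Z :: "real \<Rightarrow> real"
  proof -
    \<comment> \<open>The library lemma asks for probability measures on the target; a point mass provides the Borel sets.\<close>
    have "prob_space (return borel (0::real))" by (intro prob_space_return) simp
    from distr_PiM_finite_prob_space'[of ?I "\<lambda>_. \<Omega>" "\<lambda>_. return borel (0::real)" Z]
    have "distr P (PiM ?I (\<lambda>_. return borel (0::real))) (compose ?I Z) = PiM ?I (\<lambda>_. distr \<Omega> (return borel (0::real)) Z)"
      unfolding P_def using \<Omega> \<open>prob_space (return borel 0)\<close> Z by simp
    moreover have "distr \<Omega> (return borel (0::real)) Z = distr \<Omega> borel Z"
      by (intro distr_cong) auto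
    moreover have "distr P (PiM ?I (\<lambda>_. return borel (0::real))) (compose ?I Z) = distr P (PiM ?I (\<lambda>_. borel)) (compose ?I Z)"
      by (intro distr_cong sets_PiM_cong) auto
    ultimately show "PiM ?I (\<lambda>_. distr \<Omega> borel Z) = distr P (PiM ?I (\<lambda>_. borel)) (compose ?I Z)" by simp
    show "compose ?I Z \<in> measurable P (PiM ?I (\<lambda>_. borel))"
      unfolding P_def compose_def using Z by measurable
  qed
  have coord: "(\<lambda>\<omega>. Z (\<omega> p)) \<in> borel_measurable P" if "Z \<in> borel_measurable \<Omega>" "p \<in> ?I" for Z :: "real \<Rightarrow> real" and p
    unfolding P_def using that by measurable
  have msd_push: "msd (PiM ?I (\<lambda>_. distr \<Omega> borel Z)) f = msd P (\<lambda>\<omega>. f (\<lambda>p. Z (\<omega> p)))"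
    if Z: "Z \<in> borel_measurable \<Omega>" for Z :: "real \<Rightarrow> real"
  proof -
    have "msd (PiM ?I (\<lambda>_. distr \<Omega> borel Z)) f = msd P (\<lambda>\<omega>. f (compose ?I Z \<omega>))"
      unfolding push[OF Z] by (rule msd_distr[OF comp[OF Z] f_PiM P])
    also have "(\<lambda>\<omega>. f (compose ?I Z \<omega>)) = (\<lambda>\<omega>. f (\<lambda>p. Z (\<omega> p)))"
      by (intro ext f_cong) (auto simp: compose_def)
    finally show ?thesis .
  qed
  have "\<forall>\<^sub>F k in sequentially. cavg ({..<m} \<times> {..<n} \<times> {..<k})
      (\<lambda>x. cavg ({..<m} \<times> {..<n} \<times> {..<k}) (\<lambda>y. (f (grid k x) - f (grid k y))\<^sup>2)) \<le> ?W"
    unfolding f_def by (rule cube_variance_gap[OF q \<rho> m L ne Q E])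
  then have ev: "\<forall>\<^sub>F k in sequentially. msd P (\<lambda>\<omega>. f (\<lambda>p. Yk k (\<omega> p))) \<le> ennreal ?W"
  proof eventually_elim
    case (elim k)
    have "f (restrict (grid k x) ?I) = f (grid k x)" for x
      by (rule f_cong) auto
    then have "msd P (\<lambda>\<omega>. f (\<lambda>p. Yk k (\<omega> p))) = ennreal (cavg ({..<m} \<times> {..<n} \<times> {..<k})
        (\<lambda>x. cavg ({..<m} \<times> {..<n} \<times> {..<k}) (\<lambda>y. (f (grid k x) - f (grid k y))\<^sup>2)))"
      unfolding msd_push[OF Yk(1), symmetric] Yk(2) msd_walk_law[OF f_PiM] by simp
    then show ?case using ennreal_leI[OF elim] by (simp only:)
  qed
  have conv: "(\<lambda>k. f (\<lambda>p. Yk k (\<omega> p))) \<longlonglongrightarrow> f (\<lambda>p. Y (\<omega> p))" if \<omega>: "\<omega> \<in> space P" for \<omega>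
  proof -
    have "(\<lambda>k. \<Sum>i<m. \<Sum>j<n. \<bar>Yk k (\<omega> (i, j)) - Y (\<omega> (i, j))\<bar>) \<longlonglongrightarrow> (\<Sum>i<m. \<Sum>j<n. \<bar>Y (\<omega> (i, j)) - Y (\<omega> (i, j))\<bar>)"
      using \<omega> by (intro tendsto_intros lim) (auto simp: P_def space_PiM)
    then have "(\<lambda>k. \<Sum>i<m. \<Sum>j<n. \<bar>Yk k (\<omega> (i, j)) - Y (\<omega> (i, j))\<bar>) \<longlonglongrightarrow> 0" by simp
    then have "(\<lambda>k. f (\<lambda>p. Yk k (\<omega> p)) - f (\<lambda>p. Y (\<omega> p))) \<longlonglongrightarrow> 0"
      by (rule Lim_null_comparison[rotated])
        (use abs_gap_diff_le[OF rnorm_nonneg Lip ne Q, of "\<lambda>p. Yk _ (\<omega> p)" "\<lambda>p. Y (\<omega> p)"] in \<open>auto simp: f_def\<close>)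
    then show ?thesis by (rule LIM_zero_cancel)
  qed
  have meas: "(\<lambda>\<omega>. f (\<lambda>p. Yk k (\<omega> p))) \<in> borel_measurable P" for k
    by (rule f_meas, rule coord[OF Yk(1)])
  have "msd P (\<lambda>\<omega>. f (\<lambda>p. Y (\<omega> p))) \<le> ennreal ?W"
    by (rule msd_le_of_tendsto[OF P meas conv ev])
  then show ?thesis
    using msd_push[OF Y(1)] by (simp add: gaussian_def Y(2) f_def)
qed

section \<open>The sharp threshold\<close>

lemma lq_norm_ereal: "lq_norm (ereal p) m x = pnorm p {..<m} x"
  by (simp add: lq_norm_def pnorm_def)

lemma lq_norm_infinity: "lq_norm \<infinity> m x = Max ((\<lambda>i. \<bar>x i\<bar>) ` {..<m})"
  by (simp add: lq_norm_def)

lemma q_cases: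
  fixes q :: ereal
  assumes "2 < q"
  obtains p where "q = ereal p" "2 < p" | "q = \<infinity>"
  using assms by (cases q) auto

lemma lq_norm_infinity_le_iff:
  assumes "1 \<le> m"
  shows "lq_norm \<infinity> m x \<le> c \<longleftrightarrow> (\<forall>i<m. \<bar>x i\<bar> \<le> c)"
proof -
  have "0 \<in> {..<m}" using assms by simp
  then have "{..<m} \<noteq> {}" by blast
  then show ?thesis unfolding lq_norm_infinity by (subst Max_le_iff) auto
qed

lemma abs_le_lq_norm_infinity: "i < m \<Longrightarrow> \<bar>x i\<bar> \<le> lq_norm \<infinity> m x"
  unfolding lq_norm_infinity by (rule Max_ge) auto

lemma lq_norm_nonneg:
  assumes "2 < q" "1 \<le> m"
  shows "0 \<le> lq_norm q m x"
  using assms(1)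
proof (cases rule: q_cases)
  case 2
  then show ?thesis using abs_le_lq_norm_infinity[of 0 m x] assms(2) by simp
qed (simp add: lq_norm_ereal pnorm_nonneg)

lemma lq_norm_triangle:
  assumes "2 < q" "1 \<le> m"
  shows "lq_norm q m (\<lambda>i. x i + y i) \<le> lq_norm q m x + lq_norm q m y"
  using assms(1)
proof (cases rule: q_cases)
  case (1 p)
  then show ?thesis by (simp add: lq_norm_ereal pnorm_triangle)
next
  case 2
  have "\<bar>x i + y i\<bar> \<le> lq_norm \<infinity> m x + lq_norm \<infinity> m y" if "i < m" for i
    using abs_le_lq_norm_infinity[OF that, of x] abs_le_lq_norm_infinity[OF that, of y] by linarith
  then show ?thesis unfolding 2 lq_norm_infinity_le_iff[OF assms(2)] by blast
qed

lemma lq_norm_le_sum: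
  assumes "2 < q" "1 \<le> m"
  shows "lq_norm q m x \<le> (\<Sum>i<m. \<bar>x i\<bar>)"
  using assms(1)
proof (cases rule: q_cases)
  case (1 p)
  then show ?thesis by (simp add: lq_norm_ereal pnorm_le_sum)
next
  case 2
  have "\<bar>x i\<bar> \<le> (\<Sum>i<m. \<bar>x i\<bar>)" if "i < m" for i
    using that by (intro member_le_sum) auto
  then show ?thesis unfolding 2 lq_norm_infinity_le_iff[OF assms(2)] by blast
qed

lemma lq_norm_Lipschitz:
  assumes "2 < q" "1 \<le> m"
  shows "lq_norm q m r \<le> lq_norm q m r' + (\<Sum>i<m. \<bar>r i - r' i\<bar>)"
  using lq_norm_triangle[OF assms, of r' "\<lambda>i. r i - r' i"] lq_norm_le_sum[OF assms, of "\<lambda>i. r i - r' i"] by simp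

lemma lq_norm_zero: "2 < q \<Longrightarrow> 1 \<le> m \<Longrightarrow> lq_norm q m (\<lambda>i. 0) = 0"
  using lq_norm_nonneg[of q m "\<lambda>i. 0"] lq_norm_le_sum[of q m "\<lambda>i. 0"] by simp

lemma lq_norm_le_rnorm:
  assumes "0 < p"
  shows "lq_norm (ereal p) m r \<le> rnorm p \<rho> m r"
  unfolding lq_norm_ereal rnorm_def pnorm_def using assms
  by (intro powr_mono2) (auto simp: lessThan_Suc_atMost[symmetric] intro: sum_nonneg)

lemma rnorm_le_lq_norm:
  assumes "1 \<le> p" "0 \<le> \<rho>"
  shows "rnorm p \<rho> m r \<le> lq_norm (ereal p) m r + \<rho>"
proof -
  have "(\<Sum>i\<in>{..m}. \<bar>(r(m := \<rho>)) i - (r(m := 0)) i\<bar>) = \<rho>"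
    using assms by (simp add: lessThan_Suc_atMost[symmetric])
  moreover have "pnorm p {..m} (r(m := 0)) = lq_norm (ereal p) m r"
    using assms by (simp add: lq_norm_ereal pnorm_def lessThan_Suc_atMost[symmetric])
  ultimately show ?thesis
    using pnorm_diff_le[of "{..m}" p "r(m := \<rho>)" "r(m := 0)"] assms by (simp add: rnorm_def)
qed

lemma lq_norm_infinity_le_lq_norm:
  assumes "0 < p" "1 \<le> m"
  shows "lq_norm \<infinity> m r \<le> lq_norm (ereal p) m r"
  unfolding lq_norm_infinity_le_iff[OF assms(2)] lq_norm_ereal
  using assms by (auto intro!: abs_le_pnorm)

text \<open>
  Together with the opposite inequality this shows that the maximum norm is the limit of the \<open>\<ell>\<^sup>p\<close>-norms, since
  \<open>m powr (1 / p)\<close> tends to one for fixed \<open>m\<close>.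
\<close>

lemma lq_norm_le_lq_norm_infinity:
  assumes "0 < p" "1 \<le> m"
  shows "lq_norm (ereal p) m r \<le> m powr (1 / p) * lq_norm \<infinity> m r"
proof -
  let ?c = "lq_norm \<infinity> m r"
  have c: "0 \<le> ?c" using abs_le_lq_norm_infinity[of 0 m r] assms by simp
  have "(\<Sum>i<m. \<bar>r i\<bar> powr p) \<le> (\<Sum>i<m. ?c powr p)"
    using assms by (intro sum_mono powr_mono2 abs_le_lq_norm_infinity) auto
  then have "(\<Sum>i<m. \<bar>r i\<bar> powr p) \<le> (m powr (1 / p) * ?c) powr p"
    using c assms by (simp add: powr_mult powr_powr)
  then show ?thesis
    unfolding lq_norm_ereal using c assms by (intro pnorm_leI) auto
qed

lemma gap_nonneg:
  assumes "\<And>r. 0 \<le> \<nu> r" "Q \<noteq> {}" "F \<noteq> {}"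
  shows "0 \<le> gap \<nu> m n Q F a"
  using assms by (intro gap_greatest) auto

lemma borel_measurable_gaussian_gap:
  assumes "\<And>r. 0 \<le> \<nu> r" "\<And>r r'. \<nu> r \<le> \<nu> r' + (\<Sum>i<m. \<bar>r i - r' i\<bar>)"
    and "Q \<noteq> {}" "F \<noteq> {}" and "\<And>\<sigma>. \<sigma> \<in> Q \<Longrightarrow> L2_set \<sigma> {..<n} \<le> 1"
  shows "gap \<nu> m n Q F \<in> borel_measurable (gaussian m n)"
proof -
  have "(\<lambda>\<omega>. gap \<nu> m n Q F \<omega>) \<in> borel_measurable (gaussian m n)"
    by (rule measurable_gap[OF assms]) (auto simp: gaussian_def)
  then show ?thesis by simp
qed

text \<open>
  Removing the regularisation: the regularised norm exceeds the norm by at most \<open>\<rho>\<close>, so the margins converge as \<open>\<rho>\<close>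
  tends to zero, and the bound does not depend on \<open>\<rho>\<close>.
\<close>

lemma msd_gaussian_lq_gap_finite:
  fixes Q E :: "(nat \<Rightarrow> real) set"
  assumes p: "2 < p" and m: "1 \<le> m" and L: "1 \<le> (L::nat)"
    and ne: "Q \<noteq> {}" "E \<noteq> {}" and Q: "\<And>\<sigma>. \<sigma> \<in> Q \<Longrightarrow> L2_set \<sigma> {..<n} \<le> 1"
    and E: "permutation_invariant m E" "E \<subseteq> Rn m"
  shows "msd (gaussian m n) (gap (lq_norm (ereal p) m) m n Q E) \<le> ennreal (2 * (96 * 3 ^ L * m powr (1 / p - 1 / 2) + 4 / L))"
proof -
  have p1: "1 \<le> p" "0 < p" and q: "2 < ereal p" using p by auto
  define v where "v k = gap (rnorm p (1 / real (Suc k)) m) m n Q E" for k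
  have lim: "(\<lambda>k. v k a) \<longlonglongrightarrow> gap (lq_norm (ereal p) m) m n Q E a" for a
  proof (rule real_tendsto_sandwich)
    show "\<forall>\<^sub>F k in sequentially. gap (lq_norm (ereal p) m) m n Q E a \<le> v k a"
      unfolding v_def
      using gap_le_gap_add[OF lq_norm_nonneg[OF q m] ne, where d = 0 and \<nu>' = "rnorm p _ m"] lq_norm_le_rnorm[OF p1(2)]
      by (intro always_eventually) simp
    show "\<forall>\<^sub>F k in sequentially. v k a \<le> gap (lq_norm (ereal p) m) m n Q E a + 1 / real (Suc k)"
      unfolding v_def using rnorm_le_lq_norm[OF p1(1)]
      by (intro always_eventually allI gap_le_gap_add[OF rnorm_nonneg ne]) simp
    have "(\<lambda>k. gap (lq_norm (ereal p) m) m n Q E a + 1 / real (Suc k)) \<longlonglongrightarrow> gap (lq_norm (ereal p) m) m n Q E a + 0"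
      by (intro tendsto_intros LIMSEQ_Suc[OF lim_1_over_n])
    then show "(\<lambda>k. gap (lq_norm (ereal p) m) m n Q E a + 1 / real (Suc k)) \<longlonglongrightarrow> gap (lq_norm (ereal p) m) m n Q E a"
      by simp
  qed simp
  show ?thesis
  proof (rule msd_le_of_tendsto[OF prob_space_gaussian, where v = v])
    show "v k \<in> borel_measurable (gaussian m n)" for k
      unfolding v_def by (rule borel_measurable_gaussian_gap[OF rnorm_nonneg rnorm_Lipschitz[OF p1(1)] ne Q])
    show "\<forall>\<^sub>F k in sequentially. msd (gaussian m n) (v k) \<le> ennreal (2 * (96 * 3 ^ L * m powr (1 / p - 1 / 2) + 4 / L))"
      unfolding v_def by (intro always_eventually allI msd_gaussian_rnorm_gap[OF p _ m L ne Q E]) auto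
  qed (rule lim)
qed

text \<open>
  For finite \<open>q\<close> the exponent is \<open>1 / 2 - 1 / q\<close>. For \<open>q = \<infinity>\<close> the margin is the limit of the margins for exponents
  \<open>p \<ge> 4\<close>, for all of which \<open>1 / 2 - 1 / p \<ge> 1 / 4\<close>.
\<close>

lemma msd_gaussian_lq_gap:
  fixes q :: ereal
  assumes q: "2 < q"
  obtains \<gamma> where "0 < \<gamma>"
    and "\<And>m n L Q E. 1 \<le> m \<Longrightarrow> 1 \<le> (L::nat) \<Longrightarrow> Q \<noteq> {} \<Longrightarrow> E \<noteq> {} \<Longrightarrow> (\<And>\<sigma>. \<sigma> \<in> Q \<Longrightarrow> L2_set \<sigma> {..<n} \<le> 1)
      \<Longrightarrow> permutation_invariant m E \<Longrightarrow> E \<subseteq> Rn m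
      \<Longrightarrow> msd (gaussian m n) (gap (lq_norm q m) m n Q E) \<le> ennreal (2 * (96 * 3 ^ L * m powr (- \<gamma>) + 4 / L))"
  using q
proof (cases rule: q_cases)
  case (1 p)
  show ?thesis
  proof (rule that[of "1 / 2 - 1 / p"])
    show "0 < 1 / 2 - 1 / p" using 1 by (simp add: field_simps)
  qed (use msd_gaussian_lq_gap_finite[OF 1(2)] in \<open>simp add: 1(1)\<close>)
next
  case 2
  show ?thesis
  proof (rule that[of "1 / 4"])
    fix m n L :: nat and Q E :: "(nat \<Rightarrow> real) set"
    assume m: "1 \<le> m" and L: "1 \<le> L" and ne: "Q \<noteq> {}" "E \<noteq> {}"
      and Q: "\<And>\<sigma>. \<sigma> \<in> Q \<Longrightarrow> L2_set \<sigma> {..<n} \<le> 1" and E: "permutation_invariant m E" "E \<subseteq> Rn m"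
    let ?W = "2 * (96 * 3 ^ L * m powr (- (1 / 4)) + 4 / L)"
    define p where "p k = real (k + 4)" for k
    have p: "2 < p k" "1 \<le> p k" "0 < p k" "2 < ereal (p k)" for k by (auto simp: p_def)
    have inf: "(2::ereal) < \<infinity>" by simp
    define v where "v k = gap (lq_norm (ereal (p k)) m) m n Q E" for k
    define u where "u = gap (lq_norm \<infinity> m) m n Q E"
    have lim: "(\<lambda>k. v k a) \<longlonglongrightarrow> u a" for a
    proof (rule real_tendsto_sandwich)
      show "\<forall>\<^sub>F k in sequentially. u a \<le> v k a"
        unfolding u_def v_def
        using gap_le_gap_add[OF lq_norm_nonneg[OF inf m] ne, where d = 0 and \<nu>' = "lq_norm (ereal (p _)) m"]
          lq_norm_infinity_le_lq_norm[OF p(3) m]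
        by (intro always_eventually) simp
      have "v k a \<le> m powr (1 / p k) * u a" for k
      proof -
        have c: "0 < m powr (1 / p k)" using m by simp
        have "v k a / m powr (1 / p k) \<le> u a"
          unfolding u_def
        proof (rule gap_greatest[OF ne])
          fix \<sigma> y assume "\<sigma> \<in> Q" "y \<in> E"
          then have "v k a \<le> lq_norm (ereal (p k)) m (residual m n a \<sigma> y)"
            unfolding v_def by (intro gap_lower lq_norm_nonneg[OF p(4) m])
          also have "\<dots> \<le> m powr (1 / p k) * lq_norm \<infinity> m (residual m n a \<sigma> y)"
            by (rule lq_norm_le_lq_norm_infinity[OF p(3) m])
          finally show "v k a / m powr (1 / p k) \<le> lq_norm \<infinity> m (residual m n a \<sigma> y)"
            using c by (simp add: field_simps)
        qed
        then show ?thesis using c by (simp add: field_simps)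
      qed
      then show "\<forall>\<^sub>F k in sequentially. v k a \<le> m powr (1 / p k) * u a" by simp
      have "filterlim p at_top sequentially"
        unfolding p_def by (intro filterlim_compose[OF filterlim_real_sequentially] filterlim_add_const_nat_at_top)
      then have "(\<lambda>k. 1 / p k) \<longlonglongrightarrow> 0"
        by (intro tendsto_divide_0[OF tendsto_const] filterlim_at_top_imp_at_infinity)
      then have "(\<lambda>k. m powr (1 / p k) * u a) \<longlonglongrightarrow> m powr 0 * u a"
        using m by (intro tendsto_intros) auto
      then show "(\<lambda>k. m powr (1 / p k) * u a) \<longlonglongrightarrow> u a" using m by simp
    qed simp
    have "msd (gaussian m n) (v k) \<le> ennreal ?W" for k
    proof -
      have "msd (gaussian m n) (v k) \<le> ennreal (2 * (96 * 3 ^ L * m powr (1 / p k - 1 / 2) + 4 / L))"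
        unfolding v_def by (rule msd_gaussian_lq_gap_finite[OF p(1) m L ne Q E])
      also have "\<dots> \<le> ennreal ?W"
      proof (intro ennreal_leI mult_left_mono add_right_mono)
        have "1 / p k \<le> 1 / 4" by (simp add: p_def field_simps)
        then show "m powr (1 / p k - 1 / 2) \<le> m powr (- (1 / 4))" using m by (intro powr_mono) auto
      qed auto
      finally show ?thesis .
    qed
    then have "msd (gaussian m n) u \<le> ennreal ?W"
      by (intro msd_le_of_tendsto[OF prob_space_gaussian _ lim])
        (auto simp: v_def intro!: borel_measurable_gaussian_gap[OF lq_norm_nonneg lq_norm_Lipschitz ne Q] p m)
    then show "msd (gaussian m n) (gap (lq_norm q m) m n Q E) \<le> ennreal ?W"
      by (simp add: u_def 2)
  qed simp
qed

lemma lq_margin_eq_gap: "lq_margin q m n Q F A = gap (lq_norm q m) m n Q F (\<lambda>(i, j). A i j)"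
  by (simp add: lq_margin_def lq_dist_def gap_def residual_def)

lemma lq_dist_le:
  assumes "2 < q" "1 \<le> m" "y \<in> E"
  shows "lq_dist q m x E \<le> lq_norm q m (\<lambda>i. x i - y i)"
  unfolding lq_dist_def using assms lq_norm_nonneg
  by (intro cINF_lower bdd_belowI[of _ 0]) auto

lemma subset_lq_expansion:
  assumes "2 < q" "1 \<le> m" "0 \<le> K" "E \<subseteq> Rn m"
  shows "E \<subseteq> lq_expansion q m K E"
proof
  fix y assume y: "y \<in> E"
  have "lq_dist q m y E \<le> 0"
    using lq_dist_le[OF assms(1,2) y, of y] lq_norm_zero[OF assms(1,2)] by simp
  then show "y \<in> lq_expansion q m K E"
    using y assms(3,4) by (auto simp: lq_expansion_def)
qed

text \<open>
  A competitor at distance less than \<open>K\<close> from \<open>E\<close> lies in the expansion, which makes the margin to the expansion zero.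
\<close>

lemma satisfiable_if_gap_less:
  assumes q: "2 < q" and m: "1 \<le> m" and ne: "Q \<noteq> {}" "E \<noteq> {}"
    and less: "gap (lq_norm q m) m n Q E (\<lambda>(i, j). A i j) < K"
  shows "satisfiable q m n A Q (lq_expansion q m K E)"
proof -
  obtain \<sigma> y where \<sigma>: "\<sigma> \<in> Q" and y: "y \<in> E" and K: "lq_norm q m (residual m n (\<lambda>(i, j). A i j) \<sigma> y) < K"
    by (rule gap_near[OF ne less])
  define z where "z = mat_vec m n A \<sigma>"
  have "lq_dist q m z E \<le> K"
    using lq_dist_le[OF q m y, of z] K by (simp add: residual_def z_def)
  moreover have "z \<in> Rn m"
    by (simp add: z_def mat_vec_def topspace_Euclidean_space)
  ultimately have z: "z \<in> lq_expansion q m K E" by (simp add: lq_expansion_def)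
  have "gap (lq_norm q m) m n Q (lq_expansion q m K E) (\<lambda>(i, j). A i j) \<le> 0"
    using gap_lower[of "lq_norm q m", OF lq_norm_nonneg[OF q m] \<sigma> z, of m n "\<lambda>(i, j). A i j"] lq_norm_zero[OF q m]
    by (simp add: residual_def z_def)
  moreover have "0 \<le> gap (lq_norm q m) m n Q (lq_expansion q m K E) (\<lambda>(i, j). A i j)"
    using z ne by (intro gap_nonneg lq_norm_nonneg[OF q m]) auto
  ultimately show ?thesis by (simp add: satisfiable_def lq_margin_eq_gap)
qed

text \<open>
  The triangle inequality, with arbitrarily small errors since the infima need not be attained. This and the preceding lemma
  identify the satisfiability threshold in \<open>K\<close> with the margin to \<open>E\<close>.
\<close>

lemma gap_le_if_satisfiable:
  assumes q: "2 < q" and m: "1 \<le> m" and ne: "Q \<noteq> {}" "E \<noteq> {}" and E: "E \<subseteq> Rn m" and K: "0 \<le> K"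
    and sat: "satisfiable q m n A Q (lq_expansion q m K E)"
  shows "gap (lq_norm q m) m n Q E (\<lambda>(i, j). A i j) \<le> K"
proof (rule field_le_epsilon)
  fix e :: real assume e: "0 < e"
  let ?a = "\<lambda>(i, j). A i j"
  have ne': "lq_expansion q m K E \<noteq> {}" using subset_lq_expansion[OF q m K E] ne by auto
  have "gap (lq_norm q m) m n Q (lq_expansion q m K E) ?a < e / 2"
    using sat e by (simp add: satisfiable_def lq_margin_eq_gap)
  then obtain \<sigma> z where \<sigma>: "\<sigma> \<in> Q" and z: "z \<in> lq_expansion q m K E"
    and near: "lq_norm q m (residual m n ?a \<sigma> z) < e / 2"
    using gap_near[OF ne(1) ne'] by metis
  have "(INF y\<in>E. lq_norm q m (\<lambda>i. z i - y i)) < K + e / 2"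
    using z e by (simp add: lq_expansion_def lq_dist_def)
  then obtain y where y: "y \<in> E" and zy: "lq_norm q m (\<lambda>i. z i - y i) < K + e / 2"
    using cINF_greatest[OF ne(2), of "K + e / 2" "\<lambda>y. lq_norm q m (\<lambda>i. z i - y i)"] by (meson not_le)
  have "gap (lq_norm q m) m n Q E ?a \<le> lq_norm q m (residual m n ?a \<sigma> y)"
    by (rule gap_lower[OF lq_norm_nonneg[OF q m] \<sigma> y])
  also have "residual m n ?a \<sigma> y = (\<lambda>i. residual m n ?a \<sigma> z i + (z i - y i))"
    by (simp add: residual_def)
  also have "lq_norm q m \<dots> \<le> lq_norm q m (residual m n ?a \<sigma> z) + lq_norm q m (\<lambda>i. z i - y i)"
    by (rule lq_norm_triangle[OF q m])
  also have "\<dots> \<le> K + e" using near zy by simp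
  finally show "gap (lq_norm q m) m n Q E ?a \<le> K + e" .
qed

text \<open>
  One of the two independent copies can be frozen at a value that does not exceed the average. The centre depends only
  on \<open>u\<close> and not on any bound for \<open>msd\<close>.
\<close>

lemma exists_center_msd:
  assumes M: "prob_space M" and u: "u \<in> borel_measurable M"
  shows "\<exists>c. (\<integral>\<^sup>+ x. ennreal ((u x - c)\<^sup>2) \<partial>M) \<le> msd M u"
proof (rule ccontr)
  assume *: "\<not> ?thesis"
  interpret prob_space M by fact
  let ?g = "\<lambda>x. \<integral>\<^sup>+ y. ennreal ((u x - u y)\<^sup>2) \<partial>M"
  have g: "msd M u < ?g x" for x
    using *[simplified, rule_format, of "u x"] by (simp add: not_le power2_commute[of "u x"])
  have "(\<lambda>(x, y). ennreal ((u x - u y)\<^sup>2)) \<in> borel_measurable (M \<Otimes>\<^sub>M M)"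
    using u by measurable
  from borel_measurable_nn_integral[OF this] have meas: "?g \<in> borel_measurable M" .
  obtain x0 where "x0 \<in> space M" using not_empty by auto
  have fin: "msd M u \<noteq> \<infinity>" using g[of x0] by auto
  have "\<not> (AE x in M. ?g x \<le> msd M u)"
  proof
    assume "AE x in M. ?g x \<le> msd M u"
    then have "AE x in M. False" using g by (auto simp: not_le[symmetric])
    then show False by (simp add: AE_False)
  qed
  then have "(\<integral>\<^sup>+ x. msd M u \<partial>M) < (\<integral>\<^sup>+ x. ?g x \<partial>M)"
    using meas g fin by (intro nn_integral_less) (auto simp: emeasure_space_1 less_imp_le)
  then show False by (simp add: emeasure_space_1 msd_def)
qed

text \<open>
  Chebyshev's inequality around an arbitrary centre.
\<close>

lemma Chebyshev_center:
  assumes M: "prob_space M" and u: "u \<in> borel_measurable M" and \<epsilon>: "0 < \<epsilon>" and d: "0 \<le> d"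
    and c: "(\<integral>\<^sup>+ x. ennreal ((u x - c)\<^sup>2) \<partial>M) \<le> ennreal d"
    and S: "S \<in> sets M" "\<And>x. x \<in> space M \<Longrightarrow> \<bar>u x - c\<bar> \<le> \<epsilon> \<Longrightarrow> x \<in> S"
  shows "1 - d / \<epsilon>\<^sup>2 \<le> measure M S"
proof -
  interpret prob_space M by fact
  define T where "T = {x \<in> space M. \<epsilon> < \<bar>u x - c\<bar>}"
  have T: "T \<in> sets M" unfolding T_def using u by measurable
  have "emeasure M T \<le> emeasure M {x \<in> space M. 1 \<le> ennreal (1 / \<epsilon>\<^sup>2) * ennreal ((u x - c)\<^sup>2)}"
  proof (rule emeasure_mono)
    show "T \<subseteq> {x \<in> space M. 1 \<le> ennreal (1 / \<epsilon>\<^sup>2) * ennreal ((u x - c)\<^sup>2)}"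
    proof
      fix x assume x: "x \<in> T"
      have "\<epsilon>\<^sup>2 \<le> \<bar>u x - c\<bar>\<^sup>2" using x \<epsilon> by (intro power_mono) (auto simp: T_def)
      then have "1 \<le> 1 / \<epsilon>\<^sup>2 * (u x - c)\<^sup>2" using \<epsilon> by simp
      then have "1 \<le> ennreal (1 / \<epsilon>\<^sup>2 * (u x - c)\<^sup>2)" by (simp add: ennreal_ge_1)
      also have "\<dots> = ennreal (1 / \<epsilon>\<^sup>2) * ennreal ((u x - c)\<^sup>2)" by (rule ennreal_mult) auto
      finally have "1 \<le> ennreal (1 / \<epsilon>\<^sup>2) * ennreal ((u x - c)\<^sup>2)" .
      then show "x \<in> {x \<in> space M. 1 \<le> ennreal (1 / \<epsilon>\<^sup>2) * ennreal ((u x - c)\<^sup>2)}"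
        using x by (simp add: T_def)
    qed
    show "{x \<in> space M. 1 \<le> ennreal (1 / \<epsilon>\<^sup>2) * ennreal ((u x - c)\<^sup>2)} \<in> sets M"
      using u by measurable
  qed
  also have "\<dots> \<le> ennreal (1 / \<epsilon>\<^sup>2) * (\<integral>\<^sup>+ x. ennreal ((u x - c)\<^sup>2) * indicator (space M) x \<partial>M)"
    using u by (intro nn_integral_Markov_inequality) auto
  also have "\<dots> \<le> ennreal (1 / \<epsilon>\<^sup>2) * ennreal d"
    using c by (intro mult_left_mono) (auto cong: nn_integral_cong)
  also have "\<dots> = ennreal (d / \<epsilon>\<^sup>2)" using d by (simp add: ennreal_mult[symmetric])
  finally have "prob T \<le> d / \<epsilon>\<^sup>2" using d by (simp add: emeasure_eq_measure)
  moreover have "prob (space M - T) = 1 - prob T" by (rule prob_compl[OF T])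
  moreover have "prob (space M - T) \<le> prob S"
  proof (rule finite_measure_mono[OF _ S(1)])
    show "space M - T \<subseteq> S" using S(2) by (force simp: T_def not_less)
  qed
  ultimately show ?thesis by linarith
qed

lemma std_normal_matrix_law:
  assumes P: "prob_space P" and A: "std_normal_matrix P m n A" and mn: "1 \<le> m" "1 \<le> n"
  shows "\<And>i j. i < m \<Longrightarrow> j < n \<Longrightarrow> (\<lambda>\<omega>. A \<omega> i j) \<in> borel_measurable P"
    and "distr P (PiM ({..<m} \<times> {..<n}) (\<lambda>_. borel)) (\<lambda>\<omega>. \<lambda>(i, j)\<in>{..<m} \<times> {..<n}. A \<omega> i j) = gaussian m n"
proof -
  interpret prob_space P by fact
  let ?I = "{..<m} \<times> {..<n}" and ?X = "\<lambda>(i, j) \<omega>. A \<omega> i j"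
  have indep: "indep_vars (\<lambda>_. borel) ?X ?I"
    and dist: "\<And>i j. i < m \<Longrightarrow> j < n \<Longrightarrow> distributed P lborel (\<lambda>\<omega>. A \<omega> i j) std_normal_density"
    using A by (auto simp: std_normal_matrix_def)
  have rv: "?X p \<in> borel_measurable P" if "p \<in> ?I" for p
    using indep that by (auto simp: indep_vars_def)
  then show "(\<lambda>\<omega>. A \<omega> i j) \<in> borel_measurable P" if "i < m" "j < n" for i j
    using that rv[of "(i, j)"] by simp
  have "(0, 0) \<in> ?I" using mn by simp
  then have ne: "?I \<noteq> {}" by blast
  have law: "distr P borel (?X p) = std_normal_distribution" if "p \<in> ?I" for p
  proof -
    have "distr P borel (?X p) = distr P lborel (?X p)" by (intro distr_cong) auto
    then show ?thesis using dist[of "fst p" "snd p"] that by (auto simp: distributed_def split_beta)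
  qed
  have "distr P (PiM ?I (\<lambda>_. borel)) (\<lambda>\<omega>. \<lambda>p\<in>?I. ?X p \<omega>) = PiM ?I (\<lambda>p. distr P borel (?X p))"
    by (rule iffD1[OF indep_vars_iff_distr_eq_PiM'[OF ne] indep]) (rule rv)
  also have "\<dots> = gaussian m n" unfolding gaussian_def by (intro PiM_cong law) auto
  also have "(\<lambda>\<omega>. \<lambda>p\<in>?I. ?X p \<omega>) = (\<lambda>\<omega>. \<lambda>(i, j)\<in>?I. A \<omega> i j)"
    by (auto simp: fun_eq_iff restrict_def)
  finally show "distr P (PiM ?I (\<lambda>_. borel)) (\<lambda>\<omega>. \<lambda>(i, j)\<in>?I. A \<omega> i j) = gaussian m n" .
qed

lemma msd_std_normal_matrix:
  assumes P: "prob_space P" and A: "std_normal_matrix P m n A" and mn: "1 \<le> m" "1 \<le> n"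
    and \<nu>: "\<And>r. 0 \<le> \<nu> r" "\<And>r r'. \<nu> r \<le> \<nu> r' + (\<Sum>i<m. \<bar>r i - r' i\<bar>)"
    and ne: "Q \<noteq> {}" "F \<noteq> {}" and Q: "\<And>\<sigma>. \<sigma> \<in> Q \<Longrightarrow> L2_set \<sigma> {..<n} \<le> 1"
  shows "msd P (\<lambda>\<omega>. gap \<nu> m n Q F (\<lambda>(i, j). A \<omega> i j)) = msd (gaussian m n) (gap \<nu> m n Q F)"
proof -
  let ?I = "{..<m} \<times> {..<n}" and ?T = "\<lambda>\<omega>. \<lambda>(i, j)\<in>{..<m} \<times> {..<n}. A \<omega> i j"
  have T: "?T \<in> measurable P (PiM ?I (\<lambda>_. borel))"
    using std_normal_matrix_law(1)[OF P A mn] by (intro measurable_restrict) (auto simp: split_beta)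
  have "gap \<nu> m n Q F \<in> borel_measurable (PiM ?I (\<lambda>_. borel))"
    using borel_measurable_gaussian_gap[OF \<nu> ne Q] by (simp add: measurable_cong_sets[OF sets_gaussian refl])
  from msd_distr[OF T this P] have "msd (gaussian m n) (gap \<nu> m n Q F) = msd P (\<lambda>\<omega>. gap \<nu> m n Q F (?T \<omega>))"
    by (simp add: std_normal_matrix_law(2)[OF P A mn])
  also have "(\<lambda>\<omega>. gap \<nu> m n Q F (?T \<omega>)) = (\<lambda>\<omega>. gap \<nu> m n Q F (\<lambda>(i, j). A \<omega> i j))"
    by (intro ext gap_cong) auto
  finally show ?thesis ..
qed

text \<open>
  Measurability matters because \<open>measure\<close> vanishes on non-measurable sets. The margin to any non-empty set is
  continuous in the matrix.
\<close>

lemma sets_satisfiable: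
  assumes q: "2 < q" and P: "prob_space P" and A: "std_normal_matrix P m n A" and mn: "1 \<le> m" "1 \<le> n"
    and ne: "Q \<noteq> {}" "F \<noteq> {}" and Q: "\<And>\<sigma>. \<sigma> \<in> Q \<Longrightarrow> L2_set \<sigma> {..<n} \<le> 1"
  shows "{\<omega> \<in> space P. satisfiable q m n (A \<omega>) Q F} \<in> sets P"
    and "{\<omega> \<in> space P. \<not> satisfiable q m n (A \<omega>) Q F} \<in> sets P"
proof -
  have [measurable]: "(\<lambda>\<omega>. gap (lq_norm q m) m n Q F (\<lambda>(i, j). A \<omega> i j)) \<in> borel_measurable P"
    using std_normal_matrix_law(1)[OF P A mn]
    by (intro measurable_gap[OF lq_norm_nonneg[OF q mn(1)] lq_norm_Lipschitz[OF q mn(1)] ne Q]) auto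
  show "{\<omega> \<in> space P. satisfiable q m n (A \<omega>) Q F} \<in> sets P"
    "{\<omega> \<in> space P. \<not> satisfiable q m n (A \<omega>) Q F} \<in> sets P"
    unfolding satisfiable_def lq_margin_eq_gap by measurable
qed

theorem theorem2p4:
  fixes q :: ereal and \<alpha> :: real
    and Q E :: "nat \<Rightarrow> (nat \<Rightarrow> real) set"
    and P :: "nat \<Rightarrow> 'w measure"
    and A :: "nat \<Rightarrow> 'w \<Rightarrow> nat \<Rightarrow> nat \<Rightarrow> real"
  assumes "2 < q" and "0 < \<alpha>"
    and "\<And>N m. 1 \<le> N \<Longrightarrow> real m = \<alpha> * real N \<Longrightarrow>
           Q N \<noteq> {} \<and> Q N \<subseteq> {x \<in> Rn N. L2_set x {..<N} \<le> 1}"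
    and "\<And>N m. 1 \<le> N \<Longrightarrow> real m = \<alpha> * real N \<Longrightarrow>
           E N \<noteq> {} \<and> closedin (Euclidean_space m) (E N) \<and> permutation_invariant m (E N)"
    and "\<And>N m. 1 \<le> N \<Longrightarrow> real m = \<alpha> * real N \<Longrightarrow>
           prob_space (P N) \<and> std_normal_matrix (P N) m N (A N)"
  shows "\<exists>K\<^sub>c :: nat \<Rightarrow> real. \<forall>\<epsilon>>0. \<forall>\<eta>>0. \<exists>N\<^sub>0. \<forall>N m.
           N\<^sub>0 \<le> N \<longrightarrow> 1 \<le> N \<longrightarrow> real m = \<alpha> * real N \<longrightarrow>
           (\<forall>K\<ge>0.
              (K < K\<^sub>c N - \<epsilon> \<longrightarrow>
                 measure (P N) {\<omega> \<in> space (P N).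
                   \<not> satisfiable q m N (A N \<omega>) (Q N) (lq_expansion q m K (E N))} \<ge> 1 - \<eta>) \<and>
              (K > K\<^sub>c N + \<epsilon> \<longrightarrow>
                 measure (P N) {\<omega> \<in> space (P N).
                   satisfiable q m N (A N \<omega>) (Q N) (lq_expansion q m K (E N))} \<ge> 1 - \<eta>))"
proof -
  note q = assms(1) and \<alpha> = assms(2)
  define u where "u N m \<omega> = gap (lq_norm q m) m N (Q N) (E N) (\<lambda>(i, j). A N \<omega> i j)" for N m \<omega>
  obtain \<gamma> where \<gamma>: "0 < \<gamma>"
    and bound: "\<And>m n L Q E. 1 \<le> m \<Longrightarrow> 1 \<le> (L::nat) \<Longrightarrow> Q \<noteq> {} \<Longrightarrow> E \<noteq> {} \<Longrightarrow> (\<And>\<sigma>. \<sigma> \<in> Q \<Longrightarrow> L2_set \<sigma> {..<n} \<le> 1)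
      \<Longrightarrow> permutation_invariant m E \<Longrightarrow> E \<subseteq> Rn m
      \<Longrightarrow> msd (gaussian m n) (gap (lq_norm q m) m n Q E) \<le> ennreal (2 * (96 * 3 ^ L * m powr (- \<gamma>) + 4 / L))"
    using msd_gaussian_lq_gap[OF q] by blast
  have m1: "1 \<le> m" if "1 \<le> N" "real m = \<alpha> * real N" for N m
  proof -
    have "0 < real m" using that \<alpha> by simp
    then show ?thesis by simp
  qed
  have ne: "Q N \<noteq> {}" "E N \<noteq> {}" and Q: "\<And>\<sigma>. \<sigma> \<in> Q N \<Longrightarrow> L2_set \<sigma> {..<N} \<le> 1"
    and E: "permutation_invariant m (E N)" "E N \<subseteq> Rn m"
    and P: "prob_space (P N)" and A: "std_normal_matrix (P N) m N (A N)"
    if "1 \<le> N" "real m = \<alpha> * real N" for N m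
    using assms(3,4,5)[OF that] closedin_subset by auto
  have u_meas: "u N m \<in> borel_measurable (P N)" if "1 \<le> N" "real m = \<alpha> * real N" for N m
    unfolding u_def using std_normal_matrix_law(1)[OF P[OF that] A[OF that] m1[OF that] that(1)]
    by (intro measurable_gap[OF lq_norm_nonneg[OF q m1[OF that]] lq_norm_Lipschitz[OF q m1[OF that]] ne[OF that] Q[OF that]]) auto
  have u_msd: "msd (P N) (u N m) \<le> ennreal (2 * (96 * 3 ^ L * m powr (- \<gamma>) + 4 / L))"
    if Nm: "1 \<le> N" "real m = \<alpha> * real N" and L: "1 \<le> L" for N m L
  proof -
    have "msd (P N) (u N m) = msd (gaussian m N) (gap (lq_norm q m) m N (Q N) (E N))"
      unfolding u_def
      by (rule msd_std_normal_matrix[OF P[OF Nm] A[OF Nm] m1[OF Nm] Nm(1)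
        lq_norm_nonneg[OF q m1[OF Nm]] lq_norm_Lipschitz[OF q m1[OF Nm]] ne[OF Nm] Q[OF Nm]])
    also have "\<dots> \<le> ennreal (2 * (96 * 3 ^ L * m powr (- \<gamma>) + 4 / L))"
      by (rule bound[OF m1[OF Nm] L ne[OF Nm] Q[OF Nm] E[OF Nm]])
    finally show ?thesis .
  qed
  \<comment> \<open>The equation determines \<open>m\<close> from \<open>N\<close>, so the centre can be chosen as a function of \<open>N\<close> alone, before \<open>\<epsilon>\<close> and \<open>\<eta>\<close>.\<close>
  have "\<exists>c. \<forall>m. 1 \<le> N \<longrightarrow> real m = \<alpha> * real N \<longrightarrow>
      (\<integral>\<^sup>+ \<omega>. ennreal ((u N m \<omega> - c)\<^sup>2) \<partial>P N) \<le> msd (P N) (u N m)" for N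
  proof (cases "\<exists>m. 1 \<le> N \<and> real m = \<alpha> * real N")
    case True
    then obtain m where m: "1 \<le> N" "real m = \<alpha> * real N" by blast
    obtain c where c: "(\<integral>\<^sup>+ \<omega>. ennreal ((u N m \<omega> - c)\<^sup>2) \<partial>P N) \<le> msd (P N) (u N m)"
      using exists_center_msd[OF P[OF m] u_meas[OF m]] by blast
    have "m' = m" if "real m' = \<alpha> * real N" for m' using that m by simp
    then show ?thesis using c by metis
  qed blast
  then obtain c where c: "\<And>N m. 1 \<le> N \<Longrightarrow> real m = \<alpha> * real N \<Longrightarrow>
      (\<integral>\<^sup>+ \<omega>. ennreal ((u N m \<omega> - c N)\<^sup>2) \<partial>P N) \<le> msd (P N) (u N m)"
    by metis
  show ?thesis
  proof (intro exI[of _ c] allI impI)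
    fix \<epsilon> \<eta> :: real assume \<epsilon>: "0 < \<epsilon>" and \<eta>: "0 < \<eta>"
    define d where "d = \<epsilon>\<^sup>2 * \<eta>"
    have d: "0 < d" using \<epsilon> \<eta> by (simp add: d_def)
    \<comment> \<open>First \<open>L\<close> makes the contribution of high degrees small; for this fixed \<open>L\<close> the other term vanishes as \<open>N\<close> grows.\<close>
    obtain L :: nat where L: "16 / d < L" using reals_Archimedean2 by blast
    have "0 < 16 / d" using d by simp
    then have "0 < real L" using L by linarith
    then have L1: "1 \<le> L" and Ld: "2 * (4 / L) \<le> d / 2"
      using L d by (auto simp: field_simps)
    have "filterlim (\<lambda>N. \<alpha> * real N) at_top sequentially"
      by (intro filterlim_tendsto_pos_mult_at_top[OF tendsto_const \<alpha>] filterlim_real_sequentially)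
    from tendsto_neg_powr[OF _ this, of "- \<gamma>"] have "(\<lambda>N. (\<alpha> * real N) powr (- \<gamma>)) \<longlonglongrightarrow> 0"
      using \<gamma> by simp
    then have "(\<lambda>N. 2 * (96 * 3 ^ L * (\<alpha> * real N) powr (- \<gamma>))) \<longlonglongrightarrow> 2 * (96 * 3 ^ L * 0)"
      by (intro tendsto_intros)
    from order_tendstoD(2)[OF this, of "d / 2"]
    have "\<forall>\<^sub>F N in sequentially. 2 * (96 * 3 ^ L * (\<alpha> * real N) powr (- \<gamma>)) < d / 2"
      using d by simp
    then obtain N0 where N0: "\<And>N. N0 \<le> N \<Longrightarrow> 2 * (96 * 3 ^ L * (\<alpha> * real N) powr (- \<gamma>)) < d / 2"
      unfolding eventually_sequentially by blast
    show "\<exists>N\<^sub>0. \<forall>N m. N\<^sub>0 \<le> N \<longrightarrow> 1 \<le> N \<longrightarrow> real m = \<alpha> * real N \<longrightarrow>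
           (\<forall>K\<ge>0.
              (K < c N - \<epsilon> \<longrightarrow>
                 measure (P N) {\<omega> \<in> space (P N).
                   \<not> satisfiable q m N (A N \<omega>) (Q N) (lq_expansion q m K (E N))} \<ge> 1 - \<eta>) \<and>
              (K > c N + \<epsilon> \<longrightarrow>
                 measure (P N) {\<omega> \<in> space (P N).
                   satisfiable q m N (A N \<omega>) (Q N) (lq_expansion q m K (E N))} \<ge> 1 - \<eta>))"
    proof (intro exI[of _ N0] allI impI)
      fix N m :: nat and K :: real
      assume N: "N0 \<le> N" "1 \<le> N" and m: "real m = \<alpha> * real N" and K: "0 \<le> K"
      note Nm = N(2) m
      have "(\<integral>\<^sup>+ \<omega>. ennreal ((u N m \<omega> - c N)\<^sup>2) \<partial>P N) \<le> ennreal (2 * (96 * 3 ^ L * m powr (- \<gamma>) + 4 / L))"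
        using c[OF Nm] u_msd[OF Nm L1] by (rule order_trans)
      also have "\<dots> \<le> ennreal d"
        using N0[OF N(1)] Ld unfolding m[symmetric] by (intro ennreal_leI) simp
      finally have center: "(\<integral>\<^sup>+ \<omega>. ennreal ((u N m \<omega> - c N)\<^sup>2) \<partial>P N) \<le> ennreal d" .
      have likely: "1 - \<eta> \<le> measure (P N) S"
        if "S \<in> sets (P N)" "\<And>\<omega>. \<omega> \<in> space (P N) \<Longrightarrow> \<bar>u N m \<omega> - c N\<bar> \<le> \<epsilon> \<Longrightarrow> \<omega> \<in> S" for S
        using Chebyshev_center[OF P[OF Nm] u_meas[OF Nm] \<epsilon> _ center that] d \<epsilon> by (simp add: d_def)
      have ne': "lq_expansion q m K (E N) \<noteq> {}"
        using subset_lq_expansion[OF q m1[OF Nm] K E(2)[OF Nm]] ne(2)[OF Nm] by auto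
      note sets = sets_satisfiable[OF q P[OF Nm] A[OF Nm] m1[OF Nm] N(2) ne(1)[OF Nm] ne' Q[OF Nm]]
      show "(K < c N - \<epsilon> \<longrightarrow>
                 measure (P N) {\<omega> \<in> space (P N).
                   \<not> satisfiable q m N (A N \<omega>) (Q N) (lq_expansion q m K (E N))} \<ge> 1 - \<eta>) \<and>
              (K > c N + \<epsilon> \<longrightarrow>
                 measure (P N) {\<omega> \<in> space (P N).
                   satisfiable q m N (A N \<omega>) (Q N) (lq_expansion q m K (E N))} \<ge> 1 - \<eta>)"
      proof (intro conjI impI)
        assume less: "K < c N - \<epsilon>"
        show "1 - \<eta> \<le> measure (P N) {\<omega> \<in> space (P N). \<not> satisfiable q m N (A N \<omega>) (Q N) (lq_expansion q m K (E N))}"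
        proof (rule likely[OF sets(2)])
          fix \<omega> assume "\<omega> \<in> space (P N)" "\<bar>u N m \<omega> - c N\<bar> \<le> \<epsilon>"
          moreover from this less have "K < u N m \<omega>" by linarith
          ultimately show "\<omega> \<in> {\<omega> \<in> space (P N). \<not> satisfiable q m N (A N \<omega>) (Q N) (lq_expansion q m K (E N))}"
            using gap_le_if_satisfiable[OF q m1[OF Nm] ne[OF Nm] E(2)[OF Nm] K, of N "A N \<omega>"] by (auto simp: u_def)
        qed
      next
        assume less: "c N + \<epsilon> < K"
        show "1 - \<eta> \<le> measure (P N) {\<omega> \<in> space (P N). satisfiable q m N (A N \<omega>) (Q N) (lq_expansion q m K (E N))}"
        proof (rule likely[OF sets(1)])
          fix \<omega> assume "\<omega> \<in> space (P N)" "\<bar>u N m \<omega> - c N\<bar> \<le> \<epsilon>"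
          moreover from this less have "u N m \<omega> < K" by linarith
          ultimately show "\<omega> \<in> {\<omega> \<in> space (P N). satisfiable q m N (A N \<omega>) (Q N) (lq_expansion q m K (E N))}"
            using satisfiable_if_gap_less[OF q m1[OF Nm] ne[OF Nm], of N "A N \<omega>" K] by (auto simp: u_def)
        qed
      qed
    qed
  qed
qed

end
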